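(* Let $m\ge1$. If $f\in\mathcal D(\mathcal P_m)$, then for all $k\in\mathbb N$ and $s\in\mathcal P_m$, $$(I_+^{k/2}f)(s)=\pi^{-km/2}\int_{\{\omega\in\mathfrak M_{k,m}:\,\omega'\omega<s\}}f(s-\omega'\omega)\,d\omega.$$ Moreover, $(I_+^0f)(s)=f(s)$.
   Context: $\mathfrak M_{k,m}$: real $k\times m$ matrices with Lebesgue measure; $\omega'$ transpose; $|a|$ absolute value of the determinant. $\mathcal P_m$: cone of positive definite symmetric $m\times m$ matrices, $dr=\prod_{i\le j}dr_{i,j}$; $a<b$ means $b-a\in\mathcal P_m$. $\mathcal D(\mathcal P_m)$: $C^\infty$ functions with compact support in the open cone $\mathcal P_m$. $d=(m+1)/2$; $\Gamma_m(\alpha)=\pi^{m(m-1)/4}\prod_{j=0}^{m-1}\Gamma(\alpha-j/2)$. $D_+=\det(\eta_{i,j}\,\partial/\partial r_{i,j})$ with $\eta_{i,i}=1$, $\eta_{i,j}=1/2$ for $i\ne j$. Left-sided Gårding–Gindikin fractional integral of $f\in\mathcal D(\mathcal P_m)$, $\alpha\in\mathbb C$, $s\in\mathcal P_m$: $(I_+^\alpha f)(s)=\frac1{\Gamma_m(\alpha)}\int_{\{r\in\mathcal P_m:\,r<s\}}f(r)|s-r|^{\alpha-d}dr$ if $\operatorname{Re}\alpha>d-1$; $(I_+^\alpha f)(s)=(I_+^{\alpha+\ell}D_+^\ell f)(s)$ if $d-1-\ell<\operatorname{Re}\alpha\le d-\ell$, $\ell=1,2,\dots$. *)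

theory Defs
  imports "HOL-Analysis.Analysis"
begin

text \<open>
  \<open>('k, 'm) rmat\<close> is \<open>real^'m^'k\<close>, the \<open>k \<times> m\<close> matrices (the infix notation would impose
  the sort \<open>finite\<close> on \<open>'m\<close>). The linear order on \<open>'m\<close> makes the condition \<open>i \<le> j\<close> on pairs of
  indices available. Functions on the cone \<open>\<P>\<^sub>m\<close> are total functions on \<open>'m sqmat\<close>; their values
  outside the cone are irrelevant in all that follows.
\<close>

type_synonym ('k, 'm) rmat = "((real, 'm) vec, 'k) vec"
type_synonym 'm sqmat = "('m, 'm) rmat"

definition pd_cone :: "('m::finite sqmat) set" where
  "pd_cone = {r. transpose r = r \<and> (\<forall>x. x \<noteq> 0 \<longrightarrow> x \<bullet> (r *v x) > 0)}"

text \<open>A separate symbol is needed: \<open><\<close> on \<open>'m sqmat\<close> is the componentwise order.\<close>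

definition pd_less :: "'m::finite sqmat \<Rightarrow> 'm sqmat \<Rightarrow> bool"  (infix \<open>\<prec>\<^sub>P\<close> 50) where
  "a \<prec>\<^sub>P b \<longleftrightarrow> b - a \<in> pd_cone"

text \<open>
  The measure \<open>dr = \<Prod>\<^bsub>i \<le> j\<^esub> dr\<^bsub>i,j\<^esub>\<close>, transported from \<open>\<real>\<^bsup>m(m+1)/2\<^esup>\<close> to the symmetric matrices.
\<close>

definition sym_of_upper :: "('m::{finite,linorder} \<times> 'm \<Rightarrow> real) \<Rightarrow> 'm sqmat" where
  "sym_of_upper x = (\<chi> i j. x (min i j, max i j))"

definition sym_lebesgue :: "('m::{finite,linorder} sqmat) measure" where
  "sym_lebesgue = distr (\<Pi>\<^sub>M p\<in>{(i, j). i \<le> j}. lborel) borel sym_of_upper"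

text \<open>
  The coordinates of a symmetric matrix are its entries \<open>r\<^bsub>i,j\<^esub>\<close> with \<open>i \<le> j\<close>, so the coordinate
  direction belonging to \<open>i \<noteq> j\<close> changes the entries \<open>(i,j)\<close> and \<open>(j,i)\<close> simultaneously,
  and \<open>\<partial>/\<partial>r\<^bsub>j,i\<^esub> = \<partial>/\<partial>r\<^bsub>i,j\<^esub>\<close>.
\<close>

definition sym_unit :: "'m::finite \<Rightarrow> 'm \<Rightarrow> 'm sqmat" where
  "sym_unit i j = (\<chi> a b. if (a = i \<and> b = j) \<or> (a = j \<and> b = i) then 1 else 0)"

definition sym_partial :: "'m::finite \<Rightarrow> 'm \<Rightarrow> ('m sqmat \<Rightarrow> complex) \<Rightarrow> 'm sqmat \<Rightarrow> complex" where
  "sym_partial i j f r = vector_derivative (\<lambda>t. f (r + t *\<^sub>R sym_unit i j)) (at 0)"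

definition sym_partials :: "('m::finite \<times> 'm) list \<Rightarrow> ('m sqmat \<Rightarrow> complex) \<Rightarrow> 'm sqmat \<Rightarrow> complex" where
  "sym_partials ps f = foldr (\<lambda>(i, j). sym_partial i j) ps f"

text \<open>\<open>C\<^sup>\<infinity>\<close> on the open cone: all iterated partial derivatives exist and are continuous.\<close>

definition smooth_on_cone :: "('m::finite sqmat \<Rightarrow> complex) \<Rightarrow> bool" where
  "smooth_on_cone f \<longleftrightarrow>
     (\<forall>ps. continuous_on pd_cone (sym_partials ps f) \<and>
           (\<forall>r\<in>pd_cone. \<forall>i j.
              (\<lambda>t::real. sym_partials ps f (r + t *\<^sub>R sym_unit i j)) differentiable (at 0)))"

definition test_functions :: "('m::finite sqmat \<Rightarrow> complex) set" where
  "test_functions =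
     {f. smooth_on_cone f \<and> (\<exists>K. compact K \<and> K \<subseteq> pd_cone \<and> (\<forall>r\<in>pd_cone - K. f r = 0))}"

text \<open>
  The determinant of the matrix of commuting operators \<open>\<eta>\<^bsub>i,j\<^esub> \<partial>/\<partial>r\<^bsub>i,j\<^esub>\<close>, by the Leibniz formula.
  The derivatives in a product are applied in the order of the indices; on smooth functions
  the order does not matter.
\<close>

definition eta :: "'m \<Rightarrow> 'm \<Rightarrow> real" where
  "eta i j = (if i = j then 1 else 1/2)"

definition D_plus :: "('m::{finite,linorder} sqmat \<Rightarrow> complex) \<Rightarrow> 'm sqmat \<Rightarrow> complex" where
  "D_plus f r =
     (\<Sum>p | p permutes (UNIV :: 'm set).
        of_int (sign p) * complex_of_real (\<Prod>i\<in>UNIV. eta i (p i)) *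
        sym_partials (map (\<lambda>i. (i, p i)) (sorted_list_of_set UNIV)) f r)"

definition dd :: "'m::finite itself \<Rightarrow> real" where
  "dd _ = (real CARD('m) + 1) / 2"

definition Siegel_Gamma :: "'m::finite itself \<Rightarrow> complex \<Rightarrow> complex" where
  "Siegel_Gamma _ \<alpha> =
     complex_of_real (pi powr (real CARD('m) * (real CARD('m) - 1) / 4)) *
     (\<Prod>j<CARD('m). Gamma (\<alpha> - of_nat j / 2))"

definition GG_integral ::
  "complex \<Rightarrow> ('m::{finite,linorder} sqmat \<Rightarrow> complex) \<Rightarrow> 'm sqmat \<Rightarrow> complex" where
  "GG_integral \<alpha> f s =
     1 / Siegel_Gamma TYPE('m) \<alpha> *
     (LINT r : {r \<in> pd_cone. r \<prec>\<^sub>P s} | sym_lebesgue.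
        f r * complex_of_real \<bar>det (s - r)\<bar> powr (\<alpha> - complex_of_real (dd TYPE('m))))"

definition I_plus ::
  "complex \<Rightarrow> ('m::{finite,linorder} sqmat \<Rightarrow> complex) \<Rightarrow> 'm sqmat \<Rightarrow> complex" where
  "I_plus \<alpha> f s =
     (if Re \<alpha> > dd TYPE('m) - 1 then GG_integral \<alpha> f s
      else let l = (THE l::nat. l \<ge> 1 \<and> dd TYPE('m) - 1 - real l < Re \<alpha> \<and> Re \<alpha> \<le> dd TYPE('m) - real l)
           in GG_integral (\<alpha> + of_nat l) ((D_plus ^^ l) f) s)"

lemma sym_of_upper_measurable:
  "sym_of_upper \<in> measurable (\<Pi>\<^sub>M p\<in>{(i, j). i \<le> j}. lborel) (borel :: ('m::{finite,linorder} sqmat) measure)"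
proof -
  have *: "(\<lambda>x. x (min i j, max i j)) \<in> borel_measurable (\<Pi>\<^sub>M p\<in>{(i, j). i \<le> j}. lborel :: real measure)"
    for i j :: 'm
  proof -
    have "(\<lambda>x. x (min i j, max i j)) \<in> measurable (\<Pi>\<^sub>M p\<in>{(i, j). i \<le> j}. lborel :: real measure) lborel"
      by (rule measurable_component_singleton) (auto simp: min_def max_def)
    then show ?thesis by simp
  qed
  show ?thesis
    unfolding borel_measurable_euclidean_space[where 'c = "'m sqmat"]
    using * by (auto simp: Basis_vec_def inner_axis sym_of_upper_def)
qed

lemma I_plus_step_ex1:
  fixes d x :: real
  assumes "x \<le> d - 1"
  shows "\<exists>!l::nat. l \<ge> 1 \<and> d - 1 - real l < x \<and> x \<le> d - real l"
proof (rule ex1I)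
  let ?l = "nat \<lfloor>d - x\<rfloor>"
  show "?l \<ge> 1 \<and> d - 1 - real ?l < x \<and> x \<le> d - real ?l"
    using assms by (intro conjI) linarith+
  show "l = ?l" if "l \<ge> 1 \<and> d - 1 - real l < x \<and> x \<le> d - real l" for l
    using that assms by linarith
qed

end

theory Submission
  imports Defs
begin

text \<open>
  Let \<open>\<mu>\<^sub>k\<close> be the image of \<open>\<pi>\<^bsup>-km/2\<^esup> d\<omega>\<close> under \<open>\<omega> \<mapsto> \<omega>'\<omega>\<close> and \<open>\<nu>\<^sub>\<alpha> = |r|\<^bsup>\<alpha>-d\<^esup> dr / \<Gamma>\<^sub>m(\<alpha>)\<close> on the cone, so that
  the claim reads \<open>I\<^sup>k\<^sup>/\<^sup>2 f = f * \<mu>\<^sub>k\<close>. Two facts suffice.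

  (1) \<open>\<mu>\<^sub>n = \<nu>\<^bsub>n/2\<^esub>\<close> for \<open>n \<ge> m\<close>. For \<open>n = m\<close> one integrates out the columns of \<open>\<omega>\<close> one at a time, using an
  orthonormal completion of the previous columns and a Schur complement. The step
  \<open>\<nu>\<^sub>\<alpha> * \<mu>\<^sub>1 = \<nu>\<^bsub>\<alpha>+1/2\<^esub>\<close> is the identity \<open>|r - xx'| = |r| (1 - x'r\<^sup>-\<^sup>1x)\<close> and a Beta integral.

  (2) \<open>f = D\<^sub>+ f * \<mu>\<^sub>2\<close>, that is \<open>\<pi>\<^sup>m f(s) = \<integral> (D\<^sub>+ f)(s - Re zz\<^sup>*) dz\<close> over \<open>z \<in> \<complex>\<^sup>m\<close>. By Cramer's rule
  \<open>z\<^sub>j D\<^sub>+ f\<close> is a combination of derivatives in the conjugate variables, and the Cauchy-Pompeiu formula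
  in the variable \<open>z\<^sub>j\<close> reduces \<open>D\<^sub>+\<close> to its minor without the index \<open>j\<close>.

  Since \<open>\<mu>\<^bsub>k+2l\<^esub> = \<mu>\<^sub>k * \<mu>\<^bsub>2l\<^esub>\<close>, (2) gives \<open>f * \<mu>\<^sub>k = D\<^sub>+\<^sup>l f * \<mu>\<^bsub>k+2l\<^esub>\<close>, which is \<open>I\<^sup>k\<^sup>/\<^sup>2 f\<close> by (1) once \<open>k + 2l \<ge> m\<close>;
  for \<open>k = 0\<close> the measure \<open>\<mu>\<^sub>0\<close> is the point mass at \<open>0\<close>.
\<close>

section \<open>Product Lebesgue measures and linear substitutions\<close>

text \<open>The obstacle is \<open>k < m\<close>: Gram matrices are then singular, their
  distribution has no density, and the fractional integral is defined only through
  \<open>D_plus\<close>. Two is the number of rows by which this operator can be undone explicitly: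
  two real rows form one vector z in C^m, and 1 / (\<pi> z_j) is the fundamental solution of the
  Cauchy-Riemann operator, whence the factor \<pi>^m. The weights \<open>eta\<close> fit because the
  derivative of f at s - Re zz^* in the conjugate of z_l is minus the sum over a of z_a
  \<open>eta a l\<close> times the partial derivative of f in r_{a,l}; the vector of these
  derivatives is -z' times the operator matrix. Both inductions, over columns and over minors, run
  over subsets of one fixed index type; hence blocks padded by the identity and principal minors
  \<open>det_op S\<close>. Rows are indexed by finite sets, so that k + 2l of them can be split. The
  analysis takes place on the space of all symmetric matrices, to which f is extended by zero,
  because s - \<omega>'\<omega> leaves the cone.\<close>

interpretation lborel_PiM: product_sigma_finite "\<lambda>_::'i. lborel :: 'a::euclidean_space measure"
  by standard

abbreviation prod_leb :: "'i set \<Rightarrow> ('i \<Rightarrow> 'a::euclidean_space) measure" where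
  "prod_leb I \<equiv> PiM I (\<lambda>_. lborel)"

abbreviation real_leb :: "'i set \<Rightarrow> ('i \<Rightarrow> real) measure" where
  "real_leb \<equiv> prod_leb"

text \<open>A coordinatewise preimage of a box is a box, and uniqueness of the product measure needs
  only the values on boxes. This serves the affine maps of symmetric matrices (\<open>k = 1\<close>)
  and dilations (\<open>k\<close> the modulus of the factor).\<close>

lemma PiM_lborel_coordinatewise:
  fixes T :: "'i \<Rightarrow> 'a::euclidean_space \<Rightarrow> 'a"
  assumes "finite I" and T[measurable]: "\<And>i. i \<in> I \<Longrightarrow> T i \<in> borel_measurable borel"
    and inv: "\<And>i. i \<in> I \<Longrightarrow> density (distr lborel borel (T i)) (\<lambda>_. k) = lborel"
  shows "density (distr (prod_leb I) (prod_leb I) (\<lambda>x. \<lambda>i\<in>I. T i (x i))) (\<lambda>_. k ^ card I) = prod_leb I"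
    (is "?D = _")
proof (rule lborel_PiM.PiM_eqI)
  interpret finite_product_sigma_finite "\<lambda>_. lborel :: 'a measure" I
    by standard (fact assms)
  have meas: "(\<lambda>x. \<lambda>i\<in>I. T i (x i)) \<in> measurable (prod_leb I) (prod_leb I)"
    by (rule measurable_restrict) (auto intro!: measurable_compose[OF measurable_component_singleton] T)
  fix A :: "'i \<Rightarrow> 'a set" assume A: "\<And>i. i \<in> I \<Longrightarrow> A i \<in> sets lborel"
  have box: "Pi\<^sub>E I A \<in> sets (prod_leb I)" using A assms(1) by (intro sets_PiM_I_finite) auto
  have "(\<lambda>x. \<lambda>i\<in>I. T i (x i)) -` Pi\<^sub>E I A \<inter> space (prod_leb I) = Pi\<^sub>E I (\<lambda>i. T i -` A i)"
    by (auto simp: space_PiM PiE_iff)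
  then have "emeasure ?D (Pi\<^sub>E I A) = k ^ card I * emeasure (prod_leb I) (Pi\<^sub>E I (\<lambda>i. T i -` A i))"
    using box meas by (simp add: emeasure_density_const emeasure_distr)
  also have "emeasure (prod_leb I) (Pi\<^sub>E I (\<lambda>i. T i -` A i)) = (\<Prod>i\<in>I. emeasure lborel (T i -` A i))"
  proof (rule measure_times)
    fix i assume i: "i \<in> I"
    show "T i -` A i \<in> sets lborel"
      using measurable_sets[OF T[OF i], of "A i"] A[OF i] by simp
  qed
  also have "k ^ card I * \<dots> = (\<Prod>i\<in>I. k * emeasure lborel (T i -` A i))"
    by (simp add: prod.distrib)
  also have "\<dots> = (\<Prod>i\<in>I. emeasure lborel (A i))"
  proof (rule prod.cong[OF refl])
    fix i assume i: "i \<in> I"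
    have "emeasure lborel (A i) = emeasure (density (distr lborel borel (T i)) (\<lambda>_. k)) (A i)"
      by (simp only: inv[OF i])
    then show "k * emeasure lborel (T i -` A i) = emeasure lborel (A i)"
      using A[OF i] T[OF i] by (simp add: emeasure_density_const emeasure_distr)
  qed
  finally show "emeasure ?D (Pi\<^sub>E I A) = (\<Prod>i\<in>I. emeasure lborel (A i))" .
qed (use assms in simp_all)

text \<open>Renaming of coordinates, needed for permutation matrices and to read the entries
  \<open>(min i j, max i j)\<close> of a new row and column as a vector indexed by
  \<open>i\<close>.\<close>

lemma PiM_lborel_reindex:
  assumes "finite I" "inj_on t I"
  shows "distr (PiM (t ` I) (\<lambda>_. lborel :: 'a::euclidean_space measure)) (prod_leb I) (\<lambda>x. \<lambda>i\<in>I. x (t i))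
     = prod_leb I"
proof (rule lborel_PiM.PiM_eqI)
  interpret finite_product_sigma_finite "\<lambda>_. lborel :: 'a measure" "t ` I"
    by standard (use assms in simp)
  have meas: "(\<lambda>x. \<lambda>i\<in>I. x (t i)) \<in> measurable (prod_leb (t ` I)) (PiM I (\<lambda>_. lborel :: 'a measure))"
    by (rule measurable_restrict) auto
  fix A :: "'b \<Rightarrow> 'a set" assume A: "\<And>i. i \<in> I \<Longrightarrow> A i \<in> sets lborel"
  define B where "B = (\<lambda>j. A (the_inv_into I t j))"
  have B: "B (t i) = A i" if "i \<in> I" for i
    using that assms by (simp add: B_def the_inv_into_f_f)
  have "(\<lambda>x. \<lambda>i\<in>I. x (t i)) -` Pi\<^sub>E I A \<inter> space (prod_leb (t ` I)) = Pi\<^sub>E (t ` I) B"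
    using B by (auto simp: space_PiM PiE_iff)
  then have "emeasure (distr (prod_leb (t ` I)) (prod_leb I) (\<lambda>x. \<lambda>i\<in>I. x (t i))) (Pi\<^sub>E I A)
     = emeasure (prod_leb (t ` I)) (Pi\<^sub>E (t ` I) B)"
    using A assms(1) meas by (subst emeasure_distr) (auto intro!: sets_PiM_I_finite)
  also have "\<dots> = (\<Prod>j\<in>t ` I. emeasure lborel (B j))"
    by (rule measure_times) (use A B in auto)
  also have "\<dots> = (\<Prod>i\<in>I. emeasure lborel (A i))"
    by (subst prod.reindex[OF assms(2)]) (auto intro!: prod.cong simp: B)
  finally show "emeasure (distr (prod_leb (t ` I)) (prod_leb I) (\<lambda>x. \<lambda>i\<in>I. x (t i))) (Pi\<^sub>E I A)
     = (\<Prod>i\<in>I. emeasure lborel (A i))" .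
qed (use assms in simp_all)

text \<open>The components may themselves be vectors, so that the same statement decomposes a vector
  into numbers and a matrix into rows.\<close>

lemma lborel_vec_eq_distr_PiM:
  "(lborel :: (('a::euclidean_space, 'n::finite) vec) measure) =
     distr (prod_leb UNIV) borel vec_lambda"
proof (rule lborel_eqI)
  have [measurable]: "vec_lambda \<in> measurable (PiM UNIV (\<lambda>_. lborel :: 'a measure)) (borel :: (('a, 'n) vec) measure)"
    unfolding borel_measurable_euclidean_space[where 'c = "('a, 'n) vec"]
    by (auto simp: Basis_vec_def inner_axis)
  interpret finite_product_sigma_finite "\<lambda>_. lborel :: 'a measure" "UNIV :: 'n set"
    by standard simp
  show "sets (distr (PiM UNIV (\<lambda>_. lborel :: 'a measure)) borel vec_lambda) = sets (borel :: (('a, 'n) vec) measure)"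
    by simp
  fix l u :: "('a, 'n) vec" assume lu: "\<And>b. b \<in> Basis \<Longrightarrow> l \<bullet> b \<le> u \<bullet> b"
  have lu': "l $ i \<bullet> b \<le> u $ i \<bullet> b" if "b \<in> Basis" for i b
    using lu[of "axis i b"] that by (auto simp: inner_axis axis_in_Basis_iff)
  have "vec_lambda -` box l u \<inter> space (prod_leb UNIV) = Pi\<^sub>E UNIV (\<lambda>i. box (l $ i) (u $ i))"
    by (auto simp: space_PiM PiE_iff box_def Basis_vec_def inner_axis)
  then have "emeasure (distr (prod_leb UNIV) borel vec_lambda) (box l u) =
      emeasure (prod_leb UNIV) (Pi\<^sub>E UNIV (\<lambda>i. box (l $ i) (u $ i)))"
    by (subst emeasure_distr) auto
  also have "\<dots> = (\<Prod>i\<in>UNIV. emeasure lborel (box (l $ i) (u $ i)))"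
    by (rule measure_times) simp
  also have "\<dots> = (\<Prod>i\<in>UNIV. ennreal (\<Prod>b\<in>Basis. (u $ i - l $ i) \<bullet> b))"
    by (intro prod.cong refl emeasure_lborel_box lu')
  also have "\<dots> = ennreal (\<Prod>i\<in>UNIV. \<Prod>b\<in>Basis. (u $ i - l $ i) \<bullet> b)"
    by (intro prod_ennreal prod_nonneg) (use lu' in \<open>auto simp: inner_diff_left\<close>)
  also have "(\<Prod>i\<in>UNIV. \<Prod>b\<in>Basis. (u $ i - l $ i) \<bullet> b) =
     (\<Prod>(i, b)\<in>UNIV \<times> Basis. (u - l) \<bullet> axis i b)"
    by (subst prod.cartesian_product) (auto simp: inner_axis)
  also have "\<dots> = (\<Prod>b\<in>Basis. (u - l) \<bullet> b)"
  proof -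
    have "bij_betw (\<lambda>(i, b). axis i b) (UNIV \<times> Basis) (Basis :: ('a, 'n) vec set)"
      by (auto simp: bij_betw_def inj_on_def Basis_vec_def axis_eq_axis)
    from prod.reindex_bij_betw[OF this, of "\<lambda>b. (u - l) \<bullet> b"] show ?thesis
      by (simp add: split_def)
  qed
  finally show "emeasure (distr (prod_leb UNIV) borel vec_lambda) (box l u) = ennreal (\<Prod>b\<in>Basis. (u - l) \<bullet> b)" .
qed

lemma nn_integral_lborel_vec:
  assumes [measurable]: "F \<in> borel_measurable (borel :: (('a::euclidean_space, 'n::finite) vec) measure)"
  shows "(\<integral>\<^sup>+x. F x \<partial>lborel) = (\<integral>\<^sup>+w. F (vec_lambda w) \<partial>prod_leb UNIV)"
proof -
  have [measurable]: "vec_lambda \<in> measurable (PiM UNIV (\<lambda>_. lborel :: 'a measure)) (borel :: (('a, 'n) vec) measure)"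
    unfolding borel_measurable_euclidean_space[where 'c = "('a, 'n) vec"]
    by (auto simp: Basis_vec_def inner_axis)
  show ?thesis
    by (subst lborel_vec_eq_distr_PiM) (simp add: nn_integral_distr)
qed

section \<open>Rank-one matrices, radial integrals and the linear change of variables\<close>

definition outer :: "real^'n \<Rightarrow> real^'n \<Rightarrow> real^'n^'n" where
  "outer x y = (\<chi> i j. x $ i * y $ j)"

lemma outer_nth [simp]: "outer x y $ i $ j = x $ i * y $ j"
  by (simp add: outer_def)

lemma transpose_outer [simp]: "transpose (outer x y) = outer y x"
  by (simp add: transpose_def vec_eq_iff mult.commute)

lemma matrix_add_mult_distrib_right: "(A + B) ** C = A ** C + B ** (C :: real^'n^'m)"
  by (simp add: matrix_matrix_mult_def vec_eq_iff algebra_simps sum.distrib)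

lemma matrix_mult_outer: "A ** outer x y = outer (A *v x) y"
  by (simp add: matrix_matrix_mult_def matrix_vector_mult_def vec_eq_iff sum_distrib_right mult.assoc)

lemma outer_mult_matrix: "outer x y ** A = outer x (y v* A)"
  by (simp add: matrix_matrix_mult_def vector_matrix_mult_def vec_eq_iff sum_distrib_left mult_ac)

lemma outer_mult_vec: "outer x y *v z = (y \<bullet> z) *\<^sub>R x"
  by (simp add: matrix_vector_mult_def vec_eq_iff inner_vec_def sum_distrib_left sum_distrib_right mult_ac)

text \<open>Matrix determinant lemma. If \<open>y\<close> is a unit vector, only one column differs
  from the identity and Cramer's rule applies; in general a conjugation by \<open>P\<close> turns
  \<open>y\<close> into a unit vector.\<close>

lemma det_add_outer: "det (mat 1 + outer x y :: real^'n^'n) = 1 + x \<bullet> y"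
proof -
  have ax: "det (mat 1 + outer x (axis k 1) :: real^'n^'n) = 1 + x $ k" for x and k :: 'n
  proof -
    have "mat 1 + outer x (axis k 1) = (\<chi> i j. if j = k then (axis k 1 + x) $ i else mat 1 $ i $ j :: real^'n^'n)"
      by (auto simp: vec_eq_iff mat_def axis_def)
    then show ?thesis
      using cramer_lemma[of k "mat 1 :: real^'n^'n" "axis k 1 + x"] unfolding matrix_vector_mul_lid by (simp add: axis_def)
  qed
  show ?thesis
  proof (cases "y = 0")
    case True
    then have "outer x y = 0" by (simp add: vec_eq_iff)
    then show ?thesis using True by simp
  next
    case False
    then obtain k where k: "y $ k \<noteq> 0" by (auto simp: vec_eq_iff)
    \<comment> \<open>The identity with row \<open>k\<close> replaced by \<open>y\<close>. It is
      invertible because \<open>y $ k\<close> is nonzero, and it maps the row vector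
      \<open>axis k 1\<close> to \<open>y\<close>.\<close>
    define P where "P = ((\<chi> i. if i = k then y else axis i 1) :: real^'n^'n)"
    have yP: "axis k 1 v* P = y"
    proof -
      have "(\<Sum>i\<in>UNIV. P $ i $ j * axis k 1 $ i) = y $ j" for j
        by (subst sum.remove[of _ k]) (auto simp: P_def axis_def intro!: sum.neutral)
      then show ?thesis by (simp add: vec_eq_iff vector_matrix_mult_def mult.commute)
    qed
    have "P = (\<chi> i. if i = k then sum (\<lambda>i. y $ i *s row i (mat 1)) UNIV else row i (mat 1))"
    proof -
      have "(\<Sum>i\<in>UNIV. y $ i *s row i (mat 1 :: real^'n^'n)) $ j = y $ j" for j
        by (simp add: row_def mat_def if_distrib[where f = "\<lambda>x. _ * x"] cong: if_cong)
      then have "(\<Sum>i\<in>UNIV. y $ i *s row i (mat 1 :: real^'n^'n)) = y" by (simp add: vec_eq_iff)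
      then show ?thesis
        by (auto simp: P_def vec_eq_iff row_def mat_def axis_def)
    qed
    then have "det P = y $ k"
      using cramer_lemma_transpose[of k y "mat 1 :: real^'n^'n"] by simp
    moreover have "P ** (mat 1 + outer x y) = (mat 1 + outer (P *v x) (axis k 1)) ** P"
      by (simp add: matrix_add_ldistrib matrix_mult_outer matrix_add_mult_distrib_right outer_mult_matrix yP)
    then have "det P * det (mat 1 + outer x y) = det (mat 1 + outer (P *v x) (axis k 1)) * det P"
      by (metis det_mul)
    ultimately have "det (mat 1 + outer x y) = 1 + (P *v x) $ k"
      using k by (simp add: ax)
    then show ?thesis
      by (simp add: matrix_vector_mult_def P_def inner_vec_def mult.commute)
  qed
qed

text \<open>The volume of the ball of radius \<open>sqrt a\<close> is the distribution function of
  the squared norm; differentiating it gives the density, with half the area of the unit sphere as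
  constant.\<close>

lemma nn_integral_PiM_sum_squares:
  fixes F :: "real \<Rightarrow> ennreal"
  assumes A: "finite A" "A \<noteq> {}" and F[measurable]: "F \<in> borel_measurable borel"
  shows "(\<integral>\<^sup>+e. F (\<Sum>i\<in>A. (e i)\<^sup>2) \<partial>prod_leb A) =
    (\<integral>\<^sup>+t. F t * ennreal (pi powr (card A / 2) / Gamma (card A / 2) * t powr (card A / 2 - 1)) * indicator {0<..} t \<partial>lborel)"
proof -
  define q where "q = real (card A) / 2"
  have q: "q > 0" using A by (simp add: q_def card_gt_0_iff)
  define c where "c = pi powr q / Gamma q"
  have c: "c > 0" using q by (simp add: c_def)
  define N where "N = density lborel (\<lambda>t::real. ennreal (c * t powr (q - 1)) * indicator {0<..} t)"
  have N: "emeasure N {..a} = ennreal (unit_ball_vol (card A) * sqrt a ^ card A)" if a: "a > 0" for a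
  proof -
    have "emeasure N {..a} = (\<integral>\<^sup>+t. ennreal (c * t powr (q - 1)) * indicator {0<..} t * indicator {..a} t \<partial>lborel)"
      by (simp add: N_def emeasure_density)
    also have "\<dots> = (\<integral>\<^sup>+t. ennreal ((c * t powr (q - 1)) * indicator {0..a} t) \<partial>lborel)"
      by (intro nn_integral_cong_AE AE_I[of _ _ "{0}"]) (auto simp: indicator_def)
    also have "\<dots> = ennreal (c * (a powr q / q))"
    proof -
      have "((\<lambda>t. t powr (q - 1)) has_integral (a powr q / q)) {0..a}"
        using has_integral_powr_from_0[of "q - 1" a] q a by simp
      then have "((\<lambda>t. c * t powr (q - 1)) has_integral c * (a powr q / q)) {0..a}"
        by (rule has_integral_mult_right)
      from nn_integral_has_integral_lebesgue[OF _ this] c show ?thesis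
        by (simp add: ennreal_mult' ennreal_indicator mult_ac)
    qed
    also have "c * (a powr q / q) = unit_ball_vol (card A) * sqrt a ^ card A"
    proof -
      have "sqrt a ^ card A = a powr q"
        using a by (simp add: q_def powr_half_sqrt[symmetric] powr_realpow[symmetric] powr_powr)
      moreover have "c / q = unit_ball_vol (card A)"
        using q Gamma_plus1[of q] nonpos_Ints_nonpos[of q] by (force simp: c_def unit_ball_vol_def q_def[symmetric] add.commute mult.commute)
      ultimately show ?thesis by (metis (no_types, lifting) times_divide_eq_left times_divide_eq_right)
    qed
    finally show ?thesis .
  qed
  define D where "D = distr (prod_leb A) borel (\<lambda>e. \<Sum>i\<in>A. (e i :: real)\<^sup>2)"
  have D: "emeasure D {..a} = ennreal (unit_ball_vol (card A) * sqrt a ^ card A)" if a: "a > 0" for a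
  proof -
    have "(\<lambda>e. \<Sum>i\<in>A. (e i :: real)\<^sup>2) -` {..a} = {f. sqrt (\<Sum>i\<in>A. (f i)\<^sup>2) \<le> sqrt a}"
      by auto
    then have "emeasure D {..a} = emeasure (prod_leb A) ({f. sqrt (\<Sum>i\<in>A. (f i)\<^sup>2) \<le> sqrt a} \<inter> space (Pi\<^sub>M A (\<lambda>_. lborel)))"
      unfolding D_def by (subst emeasure_distr) (simp_all)
    then show ?thesis using emeasure_cball_aux[OF A(1), of "sqrt a"] a by simp
  qed
  \<comment> \<open>Below 0 both measures are bounded by the volumes of arbitrarily small balls,
    which tend to 0 because \<open>A\<close> is nonempty.\<close>
  have le0: "emeasure D {..a} = 0 \<and> emeasure N {..a} = 0" if a: "a \<le> 0" for a
  proof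
    have lim: "(\<lambda>n. ennreal (unit_ball_vol (card A) * sqrt (inverse (Suc n)) ^ card A)) \<longlonglongrightarrow> ennreal (unit_ball_vol (card A) * sqrt 0 ^ card A)"
      by (intro tendsto_intros LIMSEQ_inverse_real_of_nat)
    have z: "x \<le> 0" if "\<And>b. b > 0 \<Longrightarrow> x \<le> ennreal (unit_ball_vol (card A) * sqrt b ^ card A)" for x
    proof -
      have "x \<le> ennreal (unit_ball_vol (card A) * sqrt 0 ^ card A)"
        by (rule LIMSEQ_le_const[OF lim]) (use that in auto)
      then show ?thesis using A by (simp add: card_gt_0_iff zero_power)
    qed
    have "emeasure D {..a} \<le> 0"
    proof (rule z)
      fix b :: real assume b: "b > 0"
      show "emeasure D {..a} \<le> ennreal (unit_ball_vol (card A) * sqrt b ^ card A)"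
        unfolding D[OF b, symmetric] by (rule emeasure_mono) (use a b in \<open>auto simp: D_def\<close>)
    qed
    then show "emeasure D {..a} = 0" by simp
    have "emeasure N {..a} \<le> 0"
    proof (rule z)
      fix b :: real assume b: "b > 0"
      show "emeasure N {..a} \<le> ennreal (unit_ball_vol (card A) * sqrt b ^ card A)"
        unfolding N[OF b, symmetric] by (rule emeasure_mono) (use a b in \<open>auto simp: N_def\<close>)
    qed
    then show "emeasure N {..a} = 0" by simp
  qed
  have DN: "D = N"
  proof (rule measure_eqI_generator_eq[where E = "range atMost" and \<Omega> = UNIV and A = "\<lambda>i. {..real i}"])
    show "Int_stable (range (atMost :: real \<Rightarrow> real set))"
      by (auto simp: Int_stable_def)
    show "sets D = sigma_sets UNIV (range atMost)" "sets N = sigma_sets UNIV (range atMost)"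
      by (simp_all add: D_def N_def borel_eq_atMost)
    fix X assume "X \<in> range (atMost :: real \<Rightarrow> real set)"
    then obtain a where "X = {..a}" by auto
    then show "emeasure D X = emeasure N X"
      using D[of a] N[of a] le0[of a] by (cases "a > 0") auto
  next
    fix i
    show "emeasure D {..real i} \<noteq> \<infinity>"
      using D[of i] le0[of i] by (cases "i > 0") auto
  next
    show "(\<Union>i. {..real i}) = UNIV" by (auto intro: real_arch_simple)
  qed auto
  have "(\<integral>\<^sup>+e. F (\<Sum>i\<in>A. (e i)\<^sup>2) \<partial>prod_leb A) = (\<integral>\<^sup>+t. F t \<partial>D)"
    by (simp add: D_def nn_integral_distr)
  also have "\<dots> = (\<integral>\<^sup>+t. (ennreal (c * t powr (q - 1)) * indicator {0<..} t) * F t \<partial>lborel)"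
    unfolding DN N_def by (subst nn_integral_density) simp_all
  finally show ?thesis by (simp add: c_def q_def mult_ac)
qed

text \<open>Reproved because the library version requires a wellordered index type.\<close>

lemma nn_integral_linear_image:
  fixes W :: "real^'n^'n"
  assumes "F \<in> borel_measurable borel" and "det W \<noteq> 0"
  shows "(\<integral>\<^sup>+x. F x \<partial>lborel) = ennreal \<bar>det W\<bar> * (\<integral>\<^sup>+x. F (W *v x) \<partial>lborel)"
proof -
  have mv[measurable]: "(\<lambda>x. A *v x) \<in> borel_measurable borel" for A :: "real^'n^'n"
    by (intro borel_measurable_continuous_onI matrix_vector_mult_linear_continuous_on)
  define P where "P W \<longleftrightarrow> (\<forall>F\<in>borel_measurable borel. det W \<noteq> 0 \<longrightarrow>
     (\<integral>\<^sup>+x. F x \<partial>lborel) = ennreal \<bar>det W\<bar> * (\<integral>\<^sup>+x. F (W *v x) \<partial>lborel))" for W :: "real^'n^'n"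
  have "P W"
  proof (rule induct_matrix_elementary)
    fix A B :: "real^'n^'n" assume A: "P A" and B: "P B"
    show "P (A ** B)"
      unfolding P_def
    proof (intro ballI impI)
      fix F :: "real^'n \<Rightarrow> ennreal" assume F[measurable]: "F \<in> borel_measurable borel"
      assume "det (A ** B) \<noteq> 0"
      then have d: "det A \<noteq> 0" "det B \<noteq> 0" by (auto simp: det_mul)
      have "(\<integral>\<^sup>+x. F x \<partial>lborel) = ennreal \<bar>det A\<bar> * (\<integral>\<^sup>+x. F (A *v x) \<partial>lborel)"
        by (rule A[unfolded P_def, rule_format, OF F d(1)])
      also have "(\<integral>\<^sup>+x. F (A *v x) \<partial>lborel) = ennreal \<bar>det B\<bar> * (\<integral>\<^sup>+x. F (A *v (B *v x)) \<partial>lborel)"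
        by (rule B[unfolded P_def, rule_format, OF _ d(2)]) simp
      finally show "(\<integral>\<^sup>+x. F x \<partial>lborel) = ennreal \<bar>det (A ** B)\<bar> * (\<integral>\<^sup>+x. F ((A ** B) *v x) \<partial>lborel)"
        by (simp add: det_mul abs_mult ennreal_mult' matrix_vector_mul_assoc mult.assoc)
    qed
  next
    fix A :: "real^'n^'n" and i assume "row i A = 0"
    then show "P A" by (simp add: P_def det_zero_row(2))
  next
    fix A :: "real^'n^'n" assume A: "\<And>i j. i \<noteq> j \<Longrightarrow> A $ i $ j = 0"
    have d: "det A = (\<Prod>i\<in>UNIV. A $ i $ i)" by (rule det_diagonal[OF A])
    show "P A" unfolding P_def
    proof (intro ballI impI)
      fix F :: "real^'n \<Rightarrow> ennreal" assume F[measurable]: "F \<in> borel_measurable borel"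
      assume nz: "det A \<noteq> 0"
      define c where "c b = (\<Sum>i\<in>UNIV. b $ i * A $ i $ i)" for b :: "real^'n"
      have c: "c (axis i 1) = A $ i $ i" for i
        by (simp add: c_def axis_def if_distrib[where f = "\<lambda>x. x * _"] cong: if_cong)
      have Basis: "(Basis :: (real^'n) set) = range (\<lambda>i. axis i 1)" by (auto simp: Basis_vec_def)
      have inj: "inj (\<lambda>i. axis i 1 :: real^'n)" by (auto simp: inj_def axis_eq_axis)
      have sm: "(\<Sum>j\<in>Basis. (c j * (x \<bullet> j)) *\<^sub>R j) = A *v x" for x
      proof -
        have "(A *v x) $ i = A $ i $ i * x $ i" for i
          
        proof -
          have "(\<Sum>j\<in>UNIV. A $ i $ j * x $ j) = A $ i $ i * x $ i + (\<Sum>j\<in>UNIV - {i}. A $ i $ j * x $ j)"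
            by (rule sum.remove) auto
          also have "(\<Sum>j\<in>UNIV - {i}. A $ i $ j * x $ j) = 0"
            by (rule sum.neutral) (use A in auto)
          finally show ?thesis by (simp add: matrix_vector_mult_def)
        qed
        moreover have "(\<Sum>j\<in>Basis. (c j * (x \<bullet> j)) *\<^sub>R j) $ i = A $ i $ i * x $ i" for i
          unfolding Basis by (subst sum.reindex[OF inj]) (simp add: c inner_axis, simp add: axis_def if_distrib[where f = "\<lambda>x. _ * x"] cong: if_cong)
        ultimately show ?thesis by (simp add: vec_eq_iff)
      qed
      have "(\<integral>\<^sup>+x. F x \<partial>lborel) = (\<integral>\<^sup>+x. F x \<partial>density (distr lborel borel (\<lambda>x. 0 + (\<Sum>j\<in>Basis. (c j * (x \<bullet> j)) *\<^sub>R j))) (\<lambda>_. \<Prod>j\<in>Basis. \<bar>c j\<bar>))"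
        by (subst lborel_affine_euclidean[of c 0, symmetric]) (use nz in \<open>auto simp: Basis c d\<close>)
      also have "\<dots> = ennreal (\<Prod>j\<in>Basis. \<bar>c j\<bar>) * (\<integral>\<^sup>+x. F (\<Sum>j\<in>Basis. (c j * (x \<bullet> j)) *\<^sub>R j) \<partial>lborel)"
        by (simp add: nn_integral_density nn_integral_distr nn_integral_cmult)
      also have "(\<Prod>j\<in>Basis. \<bar>c j\<bar>) = \<bar>det A\<bar>"
        unfolding Basis by (subst prod.reindex[OF inj]) (simp add: c d abs_prod)
      finally show "(\<integral>\<^sup>+x. F x \<partial>lborel) = ennreal \<bar>det A\<bar> * (\<integral>\<^sup>+x. F (A *v x) \<partial>lborel)"
        by (simp only: sm)
    qed
  next
    fix m n :: 'n assume "m \<noteq> n"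
    define t where "t = Transposition.transpose m n"
    define A where "A = (\<chi> i j. mat 1 $ i $ t j :: real^'n^'n)"
    have tt: "t (t i) = i" for i by (simp add: t_def)
    have perm: "t permutes UNIV" by (simp add: t_def permutes_swap_id)
    have "A = (\<chi> i j. mat 1 $ t i $ j)"
    proof -
      have "(i = t j) = (t i = j)" for i j using tt by metis
      then show ?thesis by (simp add: A_def vec_eq_iff mat_def)
    qed
    then have "det A = of_int (sign t)"
      using det_permute_rows[OF perm, of "mat 1 :: real^'n^'n"] by simp
    then have dA: "\<bar>det A\<bar> = 1" by (simp add: sign_def)
    have "P A" unfolding P_def
    proof (intro ballI impI)
      fix F :: "real^'n \<Rightarrow> ennreal" assume F[measurable]: "F \<in> borel_measurable borel"
      have [measurable]: "vec_lambda \<in> measurable (prod_leb UNIV) (borel :: (real^'n) measure)"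
        unfolding borel_measurable_euclidean_space[where 'c = "real^'n"]
        by (auto simp: Basis_vec_def inner_axis)
      have r: "distr (prod_leb UNIV) (real_leb UNIV) (\<lambda>x. \<lambda>i\<in>UNIV. x (t i)) = prod_leb UNIV"
        using PiM_lborel_reindex[of UNIV t, where 'a = real] permutes_inj[OF perm] permutes_surj[OF perm] by simp
      have "(\<integral>\<^sup>+x. F x \<partial>lborel) = (\<integral>\<^sup>+w. F (vec_lambda w) \<partial>prod_leb UNIV)"
        by (rule nn_integral_lborel_vec) simp
      also have "\<dots> = (\<integral>\<^sup>+w. F (vec_lambda (\<lambda>i\<in>UNIV. w (t i))) \<partial>prod_leb UNIV)"
        by (subst r[symmetric], subst nn_integral_distr) (auto intro!: measurable_restrict)
      also have "\<dots> = (\<integral>\<^sup>+w. F (A *v vec_lambda w) \<partial>prod_leb UNIV)"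
      proof (intro nn_integral_cong arg_cong[where f = F])
        fix w :: "'n \<Rightarrow> real"
        show "(\<chi> i. (\<lambda>i\<in>UNIV. w (t i)) i) = A *v vec_lambda w"
          unfolding \<open>A = (\<chi> i j. mat 1 $ t i $ j)\<close>
          by (simp add: vec_eq_iff matrix_vector_mult_def mat_def if_distrib[where f = "\<lambda>x. x * _"] cong: if_cong)
      qed
      also have "\<dots> = (\<integral>\<^sup>+x. F (A *v x) \<partial>lborel)"
        by (rule nn_integral_lborel_vec[symmetric]) simp
      finally show "(\<integral>\<^sup>+x. F x \<partial>lborel) = ennreal \<bar>det A\<bar> * (\<integral>\<^sup>+x. F (A *v x) \<partial>lborel)"
        by (simp add: dA)
    qed
    then show "P (\<chi> i j. mat 1 $ i $ Transposition.transpose m n j)" by (simp add: A_def t_def)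
  next
    \<comment> \<open>A shear. With coordinate \<open>m\<close> integrated innermost it is a
      translation by \<open>c * x n\<close>, which is constant for the inner integral.\<close>
    fix m n :: 'n and c :: real assume mn: "m \<noteq> n"
    define A where "A = (\<chi> i j. if i = m \<and> j = n then c else of_bool (i = j) :: real^'n^'n)"
    have "A = mat 1 + outer (c *\<^sub>R axis m 1) (axis n 1)"
      using mn by (auto simp: A_def vec_eq_iff mat_def axis_def)
    moreover have "axis m (1::real) $ n = 0" using mn by (simp add: axis_def)
    ultimately have dA: "det A = 1" and Av: "A *v x = x + (c * x $ n) *\<^sub>R axis m 1" for x
      using mn by (simp_all add: det_add_outer inner_axis matrix_vector_mult_add_rdistrib outer_mult_vec inner_axis' mult.commute axis_index)
    have "P A" unfolding P_def
    proof (intro ballI impI)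
      fix F :: "real^'n \<Rightarrow> ennreal" assume F[measurable]: "F \<in> borel_measurable borel"
      have [measurable]: "vec_lambda \<in> measurable (prod_leb UNIV) (borel :: (real^'n) measure)"
        unfolding borel_measurable_euclidean_space[where 'c = "real^'n"]
        by (auto simp: Basis_vec_def inner_axis)
      have U: "insert m (UNIV - {m}) = UNIV" by auto
      have upd[measurable]: "(\<lambda>y. vec_lambda (x(m := y))) \<in> borel_measurable borel" for x :: "'n \<Rightarrow> real"
        unfolding borel_measurable_euclidean_space[where 'c = "real^'n"]
        by (auto simp: Basis_vec_def inner_axis)
      have ins: "(\<integral>\<^sup>+w. G w \<partial>prod_leb UNIV) = (\<integral>\<^sup>+x. (\<integral>\<^sup>+y. G (x(m := y)) \<partial>lborel) \<partial>prod_leb (UNIV - {m}))"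
        if "G \<in> borel_measurable (prod_leb UNIV)" for G :: "('n \<Rightarrow> real) \<Rightarrow> ennreal"
        using lborel_PiM.product_nn_integral_insert[of "UNIV - {m}" m G] that by (simp add: U)
      have "(\<integral>\<^sup>+x. F (A *v x) \<partial>lborel) = (\<integral>\<^sup>+w. F (A *v vec_lambda w) \<partial>prod_leb UNIV)"
        by (rule nn_integral_lborel_vec) simp
      also have "\<dots> = (\<integral>\<^sup>+x. (\<integral>\<^sup>+y. F (A *v vec_lambda (x(m := y))) \<partial>lborel) \<partial>prod_leb (UNIV - {m}))"
        by (rule ins) simp
      also have "\<dots> = (\<integral>\<^sup>+x. (\<integral>\<^sup>+y. F (vec_lambda (x(m := c * x n + 1 * y))) \<partial>lborel) \<partial>prod_leb (UNIV - {m}))"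
        by (intro nn_integral_cong arg_cong[where f = F]) (use mn in \<open>auto simp: Av vec_eq_iff axis_def\<close>)
      also have "\<dots> = (\<integral>\<^sup>+x. (\<integral>\<^sup>+y. F (vec_lambda (x(m := y))) \<partial>lborel) \<partial>prod_leb (UNIV - {m}))"
      proof (rule nn_integral_cong)
        fix x :: "'n \<Rightarrow> real"
        show "(\<integral>\<^sup>+y. F (vec_lambda (x(m := c * x n + 1 * y))) \<partial>lborel) = (\<integral>\<^sup>+y. F (vec_lambda (x(m := y))) \<partial>lborel)"
          using nn_integral_real_affine[of "\<lambda>y. F (vec_lambda (x(m := y)))" 1 "c * x n"] by simp
      qed
      also have "\<dots> = (\<integral>\<^sup>+w. F (vec_lambda w) \<partial>prod_leb UNIV)"
        by (rule ins[symmetric]) simp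
      also have "\<dots> = (\<integral>\<^sup>+x. F x \<partial>lborel)"
        by (rule nn_integral_lborel_vec[symmetric]) simp
      finally show "(\<integral>\<^sup>+x. F x \<partial>lborel) = ennreal \<bar>det A\<bar> * (\<integral>\<^sup>+x. F (A *v x) \<partial>lborel)"
        by (simp add: dA)
    qed
    then show "P (\<chi> i j. if i = m \<and> j = n then c else of_bool (i = j))" by (simp add: A_def)
  qed
  from this[unfolded P_def, rule_format, OF assms] show ?thesis .
qed

section \<open>Positive definite matrices and Schur complements\<close>

lemma inner_transpose_vec: "(transpose A *v x) \<bullet> y = x \<bullet> (A *v (y :: real^'n))" for A :: "real^'n^'m"
  by (simp add: dot_lmul_matrix)

lemma inner_outer: "z \<bullet> (outer x y *v z) = (z \<bullet> x) * (z \<bullet> y)"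
  by (simp add: outer_mult_vec inner_commute mult.commute)

lemma transpose_add: "transpose (A + B) = transpose A + transpose (B :: real^'n^'m)"
  by (simp add: transpose_def vec_eq_iff)

lemma transpose_diff: "transpose (A - B) = transpose A - transpose (B :: real^'n^'m)"
  by (simp add: transpose_def vec_eq_iff)

lemma transpose_scaleR: "transpose (c *\<^sub>R A) = c *\<^sub>R transpose (A :: real^'n^'m)"
  by (simp add: transpose_def vec_eq_iff)

lemma outer_0 [simp]: "outer 0 y = 0" "outer x 0 = 0"
  by (simp_all add: vec_eq_iff)

lemma outer_scaleR: "outer (c *\<^sub>R x) y = c *\<^sub>R outer x y" "outer x (c *\<^sub>R y) = c *\<^sub>R outer x y"
  by (simp_all add: vec_eq_iff)

lemma pd_cone_symD: "A \<in> pd_cone \<Longrightarrow> transpose A = A"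
  by (simp add: pd_cone_def)

lemma pd_cone_posD: "A \<in> pd_cone \<Longrightarrow> x \<noteq> 0 \<Longrightarrow> 0 < x \<bullet> (A *v x)"
  by (simp add: pd_cone_def)

lemma mat_1_pd_cone: "mat 1 \<in> pd_cone"
  by (simp add: pd_cone_def)

lemma transpose_nth [simp]: "transpose A $ i $ j = A $ j $ i"
  by (simp add: transpose_def)

lemma symmetric_nth: "transpose A = A \<Longrightarrow> A $ i $ j = A $ j $ i"
  by (metis transpose_nth)

lemma vec_mult_outer: "z v* outer x y = (z \<bullet> x) *\<^sub>R y"
  by (simp add: vector_matrix_mult_def vec_eq_iff inner_vec_def sum_distrib_left mult_ac)

lemma det_eq_0_kernel:
  fixes A :: "real^'n^'n"
  assumes "det A = 0" obtains x where "x \<noteq> 0" "A *v x = 0"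
  using assms invertible_det_nz[of A] matrix_left_invertible_ker[of A] invertible_left_inverse[of A] by blast

lemma pd_cone_det_nonzero:
  assumes "A \<in> pd_cone" shows "det A \<noteq> 0"
proof
  assume "det A = 0"
  then obtain x where "x \<noteq> 0" "A *v x = 0"
    using det_eq_0_kernel by blast
  then show False using pd_cone_posD[OF assms, of x] by simp
qed

lemma det_nonzero_inverse:
  fixes A :: "real^'n^'n"
  assumes "det A \<noteq> 0"
  shows "A ** matrix_inv A = mat 1" "matrix_inv A ** A = mat 1"
proof -
  have "\<exists>B. A ** B = mat 1 \<and> B ** A = mat 1"
    using assms invertible_det_nz[of A] by (simp add: invertible_def)
  from someI_ex[OF this] show "A ** matrix_inv A = mat 1" "matrix_inv A ** A = mat 1"
    by (simp_all add: matrix_inv_def)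
qed

lemma pd_cone_congruence:
  fixes A :: "'n::finite sqmat"
  assumes P: "det P \<noteq> 0"
  shows "P ** A ** transpose P \<in> pd_cone \<longleftrightarrow> A \<in> pd_cone"
proof -
  have *: "Q ** B ** transpose Q \<in> pd_cone" if B: "B \<in> pd_cone" and Q: "det Q \<noteq> 0" for Q B :: "'n sqmat"
  proof -
    have "0 < x \<bullet> ((Q ** B ** transpose Q) *v x)" if x: "x \<noteq> 0" for x
    proof -
      have nz: "transpose Q *v x \<noteq> 0"
        using Q x invertible_det_nz[of "transpose Q"] matrix_left_invertible_ker[of "transpose Q"]
          invertible_left_inverse[of "transpose Q"] by (auto simp: det_transpose)
      have "x \<bullet> ((Q ** B ** transpose Q) *v x) = x \<bullet> (Q *v (B *v (transpose Q *v x)))"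
        by (simp add: matrix_vector_mul_assoc matrix_mul_assoc del: transpose_matrix_vector)
      also have "\<dots> = (transpose Q *v x) \<bullet> (B *v (transpose Q *v x))"
        by (metis inner_transpose_vec)
      finally show ?thesis using pd_cone_posD[OF B nz] by simp
    qed
    then show ?thesis
      using B by (auto simp: pd_cone_def matrix_transpose_mul matrix_mul_assoc)
  qed
  show ?thesis
  proof
    assume PA: "P ** A ** transpose P \<in> pd_cone"
    define Q where "Q = matrix_inv P"
    have QP: "Q ** P = mat 1" using det_nonzero_inverse[OF P] by (simp add: Q_def)
    then have tQP: "transpose P ** transpose Q = mat 1" by (metis matrix_transpose_mul transpose_mat)
    have "det Q \<noteq> 0" using QP by (metis det_I det_mul mult_zero_left zero_neq_one)
    from *[OF PA this] have "(Q ** P) ** A ** (transpose P ** transpose Q) \<in> pd_cone"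
      by (simp add: matrix_mul_assoc)
    then show "A \<in> pd_cone" by (simp add: QP tQP)
  qed (rule *[OF _ P])
qed

text \<open>The block of \<open>r\<close> with indices in \<open>S\<close>, padded by the identity so that its determinant and
  definiteness are those of a matrix over the full index type.\<close>

definition sub_mat :: "'n set \<Rightarrow> 'n::finite sqmat \<Rightarrow> 'n sqmat" where
  "sub_mat S r = (\<chi> i j. if i \<in> S \<and> j \<in> S then r $ i $ j else of_bool (i = j))"

text \<open>\<open>A\<close> is meant to have the unit vector as its row and column
  \<open>j\<close>. The entry 1 at \<open>(j, j)\<close> is then replaced by \<open>u\<close>, which
  explains \<open>u - 1\<close>, and \<open>b\<close> fills the rest of that row and column.\<close>

definition bordered :: "'n \<Rightarrow> 'n::finite sqmat \<Rightarrow> real^'n \<Rightarrow> real \<Rightarrow> 'n sqmat" where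
  "bordered j A b u = A + outer b (axis j 1) + outer (axis j 1) b + (u - 1) *\<^sub>R outer (axis j 1) (axis j 1)"

lemma sub_mat_empty [simp]: "sub_mat {} r = mat 1"
  by (simp add: sub_mat_def mat_def vec_eq_iff)

lemma sub_mat_UNIV [simp]: "sub_mat UNIV r = r"
  by (simp add: sub_mat_def vec_eq_iff)

text \<open>The quadratic form of the padded block at \<open>x\<close> is the form of
  \<open>r\<close> at the part of \<open>x\<close> supported on \<open>S\<close>, plus the squared
  norm of the remaining part.\<close>

lemma sub_mat_pd_cone:
  assumes r: "r \<in> pd_cone" shows "sub_mat S r \<in> pd_cone"
proof -
  have sym: "r $ i $ j = r $ j $ i" for i j
    by (rule symmetric_nth[OF pd_cone_symD[OF r]])
  have "0 < x \<bullet> (sub_mat S r *v x)" if x: "x \<noteq> 0" for x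
  proof -
    define p where "p = (\<chi> i. if i \<in> S then x $ i else 0)"
    define q where "q = (\<chi> i. if i \<in> S then 0 else x $ i)"
    have "(sub_mat S r *v x) $ i = (if i \<in> S then (r *v p) $ i else q $ i)" for i
    proof -
      have "(sub_mat S r *v x) $ i = (\<Sum>j\<in>UNIV. (if i \<in> S \<and> j \<in> S then r $ i $ j else of_bool (i = j)) * x $ j)"
        by (simp add: matrix_vector_mult_def sub_mat_def)
      also have "\<dots> = (\<Sum>j\<in>UNIV. if i \<in> S then r $ i $ j * p $ j else if j = i then q $ i else 0)"
        by (rule sum.cong) (auto simp: p_def q_def)
      finally show ?thesis by (simp add: matrix_vector_mult_def)
    qed
    then have "x \<bullet> (sub_mat S r *v x) = (\<Sum>i\<in>UNIV. x $ i * (if i \<in> S then (r *v p) $ i else q $ i))"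
      by (simp add: inner_vec_def)
    also have "\<dots> = (\<Sum>i\<in>UNIV. p $ i * (r *v p) $ i + q $ i * q $ i)"
      by (rule sum.cong) (auto simp: p_def q_def)
    finally have e: "x \<bullet> (sub_mat S r *v x) = p \<bullet> (r *v p) + q \<bullet> q"
      by (simp add: inner_vec_def sum.distrib)
    show ?thesis
    proof (cases "p = 0")
      case True
      then have "q \<noteq> 0" using x by (auto simp: p_def q_def vec_eq_iff split: if_splits)
      then show ?thesis using e True by simp
    next
      case False
      then show ?thesis using e pd_cone_posD[OF r False] by (simp add: add_pos_nonneg)
    qed
  qed
  then show ?thesis
    by (auto simp: pd_cone_def sub_mat_def transpose_def vec_eq_iff sym)
qed

lemma sub_mat_axis:
  assumes "j \<notin> S" shows "sub_mat S r *v axis j 1 = axis j 1"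
  using assms unfolding matrix_vector_mult_basis by (auto simp: column_def sub_mat_def vec_eq_iff axis_def)

lemma sub_mat_insert:
  assumes "transpose r = r" "j \<notin> S"
  shows "sub_mat (insert j S) r = bordered j (sub_mat S r) (\<chi> i. if i \<in> S then r $ i $ j else 0) (r $ j $ j)"
proof -
  have sym: "r $ i $ j = r $ j $ i" for i j
    by (rule symmetric_nth[OF assms(1)])
  show ?thesis
    using assms(2) by (auto simp: sub_mat_def bordered_def vec_eq_iff axis_def sym)
qed

text \<open>Elimination of row and column \<open>j\<close>. The vector
  \<open>y = matrix_inv A *v b\<close> is orthogonal to the unit vector e with index
  \<open>j\<close>, and L = 1 + ey' has determinant 1; conjugation by L leaves a matrix that differs
  from \<open>A\<close> only in the entry \<open>(j, j)\<close>, which is \<open>u - q\<close>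
  instead of 1. The third claim, a congruence to \<open>A\<close> itself, is the inductive step of a
  Cholesky factorization.\<close>

lemma schur_complement:
  fixes A :: "'n::finite sqmat"
  assumes A: "A \<in> pd_cone" and Aj: "A *v axis j 1 = axis j 1" and bj: "b $ j = 0"
  defines "q \<equiv> b \<bullet> (matrix_inv A *v b)"
  shows det_bordered: "det (bordered j A b u) = det A * (u - q)"
    and bordered_pd_cone_iff: "bordered j A b u \<in> pd_cone \<longleftrightarrow> q < u"
    and bordered_factor: "q < u \<Longrightarrow> \<exists>P. bordered j A b u = P ** A ** transpose P"
proof -
  define e :: "real^'n" where "e = axis j 1"
  define y where "y = matrix_inv A *v b"
  define c where "c = u - 1 - q"
  have Ae: "A *v e = e" using Aj by (simp add: e_def)
  have Ay: "A *v y = b"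
    using det_nonzero_inverse(1)[OF pd_cone_det_nonzero[OF A]] by (simp add: y_def matrix_vector_mul_assoc)
  have tA: "transpose A = A" using A by (rule pd_cone_symD)
  have ev: "e v* A = e" by (metis Ae tA transpose_matrix_vector)
  have yv: "y v* A = b" by (metis Ay tA transpose_matrix_vector)
  have "e \<bullet> b = e \<bullet> y"
    by (metis Ay Ae tA inner_transpose_vec)
  then have ey: "e \<bullet> y = 0" using bj by (simp add: e_def inner_axis')
  have ee: "e \<bullet> e = 1" by (simp add: e_def)
  define L where "L = mat 1 + outer e y"
  have dL: "det L = 1" by (simp add: L_def det_add_outer ey)
  have tL: "transpose L = mat 1 + outer y e" by (simp add: L_def transpose_add)
  define B where "B = A + c *\<^sub>R outer e e"
  have X: "bordered j A b u = L ** B ** transpose L"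
  proof -
    have "L ** B = A + outer e b + c *\<^sub>R outer e e"
    proof -
      have "y v* B = b"
        by (simp add: B_def vector_matrix_mult_add_rdistrib yv outer_scaleR(1)[symmetric] vec_mult_outer inner_commute ey)
      then have "L ** B = B + outer e b"
        by (simp add: L_def matrix_add_mult_distrib_right outer_mult_matrix)
      then show ?thesis by (simp add: B_def)
    qed
    then have "L ** B ** transpose L = A + outer e b + c *\<^sub>R outer e e + (outer (A *v y) e + outer (outer e b *v y) e + c *\<^sub>R outer (outer e e *v y) e)"
      by (simp add: tL matrix_add_ldistrib matrix_mult_outer matrix_vector_mult_add_rdistrib)
         (simp add: vec_eq_iff matrix_vector_mult_def algebra_simps sum_distrib_left)
    also have "\<dots> = bordered j A b u"
      by (simp add: Ay outer_mult_vec ey outer_scaleR bordered_def e_def[symmetric])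
         (simp add: c_def q_def y_def[symmetric] algebra_simps)
    finally show ?thesis by simp
  qed
  have B1: "B = A ** (mat 1 + outer (c *\<^sub>R e) e)"
    by (simp add: B_def matrix_add_ldistrib matrix_mult_outer outer_scaleR(1)[symmetric] Ae matrix_vector_mult_scaleR)
  have dB: "det B = det A * (1 + c)"
    by (simp add: B1 det_mul det_add_outer ee)
  show "det (bordered j A b u) = det A * (u - q)"
    by (simp add: X det_mul det_transpose dL dB c_def)
  have pX: "bordered j A b u \<in> pd_cone \<longleftrightarrow> B \<in> pd_cone"
    by (simp add: X pd_cone_congruence dL)
  have BD: "\<exists>D. det D \<noteq> 0 \<and> B = D ** A ** transpose D" if "1 + c > 0"
  proof -
    \<comment> \<open>\<open>D\<close> has to stretch the direction \<open>e\<close> by the square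
      root of \<open>1 + c = u - q\<close>; \<open>k\<close> is the excess of this factor over
      1.\<close>
    define k where "k = sqrt (1 + c) - 1"
    have kc: "k + k + k * k = c" using that by (simp add: k_def algebra_simps)
    define D where "D = mat 1 + outer (k *\<^sub>R e) e"
    have "D ** A = A + outer (k *\<^sub>R e) e"
      by (simp add: D_def matrix_add_mult_distrib_right outer_mult_matrix ev)
    moreover have "transpose D = mat 1 + outer e (k *\<^sub>R e)"
      by (simp add: D_def transpose_add)
    moreover have "(A + outer (k *\<^sub>R e) e) *v e = e + k *\<^sub>R e"
      by (simp add: matrix_vector_mult_add_rdistrib Ae outer_mult_vec ee)
    ultimately have "D ** A ** transpose D = A + outer (k *\<^sub>R e) e + outer (e + k *\<^sub>R e) (k *\<^sub>R e)"
      by (simp add: matrix_add_ldistrib matrix_mult_outer)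
    also have "\<dots> = A + (k + k + k * k) *\<^sub>R outer e e"
      by (simp add: vec_eq_iff algebra_simps)
    finally have "D ** A ** transpose D = A + (k + k + k * k) *\<^sub>R outer e e" .
    moreover have "det D \<noteq> 0" using that by (simp add: D_def det_add_outer ee k_def)
    ultimately show ?thesis using kc by (auto simp: B_def intro!: exI[of _ D])
  qed
  show "bordered j A b u \<in> pd_cone \<longleftrightarrow> q < u"
  proof
    assume "bordered j A b u \<in> pd_cone"
    then have "0 < e \<bullet> (B *v e)" using pX pd_cone_posD[of B e] ee by force
    also have "e \<bullet> (B *v e) = 1 + c"
      by (simp add: B_def matrix_vector_mult_add_rdistrib inner_add_right Ae ee scaleR_matrix_vector_assoc[symmetric] inner_outer)
    finally show "q < u" by (simp add: c_def)
  next
    assume "q < u"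
    then obtain D where "det D \<noteq> 0" "B = D ** A ** transpose D" using BD by (auto simp: c_def)
    then have "B \<in> pd_cone" using A by (simp add: pd_cone_congruence)
    then show "bordered j A b u \<in> pd_cone" by (simp add: pX)
  qed
  assume "q < u"
  then obtain D where "B = D ** A ** transpose D" using BD by (auto simp: c_def)
  then have "bordered j A b u = (L ** D) ** A ** transpose (L ** D)"
    by (simp add: X matrix_transpose_mul matrix_mul_assoc)
  then show "\<exists>P. bordered j A b u = P ** A ** transpose P" by blast
qed

text \<open>Cholesky factorization, one index at a time starting from the identity; each index
  contributes the factor from \<open>bordered_factor\<close>. The matrix \<open>h\<close> later
  serves as the substitution that turns an ellipsoid into a ball.\<close>

lemma pd_cone_factor:
  fixes A :: "'n::finite sqmat"
  assumes "A \<in> pd_cone" obtains h :: "'n sqmat" where "A = h ** transpose h" "det h \<noteq> 0"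
proof -
  have "\<exists>h :: 'n sqmat. sub_mat S A = h ** transpose h" if "finite S" for S
    using that
  proof (induction S)
    case empty
    show ?case by (metis matrix_mul_lid sub_mat_empty transpose_mat)
  next
    case (insert j S)
    define b where "b = (\<chi> i. if i \<in> S then A $ i $ j else 0)"
    have X: "sub_mat (insert j S) A = bordered j (sub_mat S A) b (A $ j $ j)"
      using sub_mat_insert[OF pd_cone_symD[OF assms] insert(2)] by (simp add: b_def)
    have pd: "sub_mat S A \<in> pd_cone" "sub_mat (insert j S) A \<in> pd_cone"
      using sub_mat_pd_cone[OF assms] by auto
    have bj: "b $ j = 0" using insert(2) by (simp add: b_def)
    note S = pd(1) sub_mat_axis[OF insert(2)] bj
    obtain P where P: "sub_mat (insert j S) A = P ** sub_mat S A ** transpose P"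
      using bordered_factor[OF S] bordered_pd_cone_iff[OF S] pd(2) X by auto
    obtain h :: "'n sqmat" where "sub_mat S A = h ** transpose h" using insert by auto
    then have "sub_mat (insert j S) A = (P ** h) ** transpose (P ** h)"
      by (simp add: P matrix_transpose_mul matrix_mul_assoc)
    then show ?case by blast
  qed
  from this[of UNIV] obtain h :: "'n sqmat" where h: "A = h ** transpose h" by auto
  moreover have "det h \<noteq> 0"
    using pd_cone_det_nonzero[OF assms] by (auto simp: h det_mul)
  ultimately show ?thesis using that by blast
qed

lemma pd_cone_det_pos: "A \<in> pd_cone \<Longrightarrow> 0 < det A"
  by (erule pd_cone_factor) (auto simp: det_mul det_transpose zero_less_mult_iff)

text \<open>Congruence by \<open>h\<close> leaves the matrix 1 - yy'. Its determinant is 1 - |y|^2,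
  and by Cauchy-Schwarz its quadratic form is positive exactly if |y| < 1.\<close>

lemma pd_cone_diff_outer:
  fixes h :: "'n::finite sqmat" and y :: "real^'n"
  assumes h: "det h \<noteq> 0"
  shows "h ** transpose h - outer (h *v y) (h *v y) \<in> pd_cone \<longleftrightarrow> y \<bullet> y < 1"
    and "det (h ** transpose h - outer (h *v y) (h *v y)) = (det h)\<^sup>2 * (1 - y \<bullet> y)"
proof -
  have e: "h ** transpose h - outer (h *v y) (h *v y) = h ** (mat 1 + outer (- y) y) ** transpose h"
  proof -
    have "h ** (mat 1 + outer (- y) y) ** transpose h = h ** transpose h + outer (h *v (- y)) y ** transpose h"
      by (simp add: matrix_add_ldistrib matrix_mult_outer matrix_add_mult_distrib_right)
    also have "outer (h *v (- y)) y ** transpose h = - outer (h *v y) (h *v y)"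
      by (simp add: outer_mult_matrix vector_transpose_matrix vec_eq_iff matrix_vector_mult_def sum_negf)
    finally show ?thesis by simp
  qed
  have "mat 1 + outer (- y) y \<in> pd_cone \<longleftrightarrow> y \<bullet> y < 1"
  proof
    assume *: "mat 1 + outer (- y) y \<in> pd_cone"
    show "y \<bullet> y < 1"
    proof (cases "y = 0")
      case False
      from pd_cone_posD[OF * this] have "0 < (y \<bullet> y) * (1 - y \<bullet> y)"
        by (simp add: matrix_vector_mult_add_rdistrib inner_add_right inner_outer algebra_simps)
      then show ?thesis using inner_ge_zero[of y] by (simp add: zero_less_mult_iff)
    qed simp
  next
    assume *: "y \<bullet> y < 1"
    have "transpose (mat 1 + outer (- y) y) = mat 1 + outer (- y) y"
      by (simp add: transpose_add vec_eq_iff)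
    moreover have "0 < x \<bullet> ((mat 1 + outer (- y) y) *v x)" if "x \<noteq> 0" for x
    proof -
      have "(x \<bullet> y)\<^sup>2 \<le> (x \<bullet> x) * (y \<bullet> y)" by (rule Cauchy_Schwarz_ineq)
      also have "\<dots> < (x \<bullet> x) * 1" using * that by (intro mult_strict_left_mono) auto
      finally show ?thesis
        by (simp add: matrix_vector_mult_add_rdistrib inner_add_right inner_outer power2_eq_square)
    qed
    ultimately show "mat 1 + outer (- y) y \<in> pd_cone" by (simp add: pd_cone_def)
  qed
  then show "h ** transpose h - outer (h *v y) (h *v y) \<in> pd_cone \<longleftrightarrow> y \<bullet> y < 1"
    by (simp add: e pd_cone_congruence[OF h])
  show "det (h ** transpose h - outer (h *v y) (h *v y)) = (det h)\<^sup>2 * (1 - y \<bullet> y)"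
    by (simp add: e det_mul det_transpose det_add_outer power2_eq_square)
qed

text \<open>The columns outside \<open>S\<close> are orthonormal and orthogonal to the given
  vectors; there is room for them because the span of the latter has dimension at most
  \<open>card S\<close>. The padded block is therefore the Gram matrix of a full frame, and its
  determinant is the squared Jacobian of that frame.\<close>

lemma frame_completion:
  fixes v :: "'n::finite \<Rightarrow> real^'n"
  obtains W :: "'n sqmat" where "transpose W ** W = sub_mat S (\<chi> i j. v i \<bullet> v j)"
    "\<And>s. s \<in> S \<Longrightarrow> column s W = v s"
proof -
  define U where "U = {y. \<forall>x\<in>span (v ` S). orthogonal x y}"
  have U: "subspace U" unfolding U_def
    using subspace_orthogonal_to_vectors[of "span (v ` S)"] by (simp add: orthogonal_commute)
  have "dim U + dim (span (v ` S)) = dim (UNIV :: (real^'n) set)"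
    using dim_subspace_orthogonal_to_vectors[of "span (v ` S)" UNIV] by (simp add: U_def)
  moreover have "dim (span (v ` S)) \<le> card S"
    by (metis dim_span dim_le_card' card_image_le finite finite_imageI order_trans)
  moreover have "card (- S) = CARD('n) - card S" by (simp add: Compl_eq_Diff_UNIV card_Diff_subset)
  ultimately have dU: "card (- S) \<le> dim U" by simp
  obtain B where B: "B \<subseteq> U" "pairwise orthogonal B" "\<And>x. x \<in> B \<Longrightarrow> norm x = 1" "card B = dim U" "independent B"
    using orthonormal_basis_subspace[OF U] by metis
  then have "card (- S) \<le> card B" "finite B" using dU independent_imp_finite by auto
  then obtain g where g: "inj_on g (- S)" "g ` (- S) \<subseteq> B"
    using card_le_inj[of "- S" B] by auto
  define w where "w j = (if j \<in> S then v j else g j)" for j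
  define W :: "'n sqmat" where "W = (\<chi> i j. w j $ i)"
  have col: "column j W = w j" for j by (simp add: column_def W_def)
  have "w i \<bullet> w j = (if i \<in> S \<and> j \<in> S then v i \<bullet> v j else of_bool (i = j))" for i j
  proof -
    have gv: "g k \<bullet> v l = 0" "v l \<bullet> g k = 0" if "k \<notin> S" "l \<in> S" for k l
    proof -
      have "g k \<in> U" using that g B by auto
      moreover have "v l \<in> span (v ` S)" using that by (auto intro: span_base)
      ultimately show "v l \<bullet> g k = 0" "g k \<bullet> v l = 0" by (auto simp: U_def orthogonal_def inner_commute)
    qed
    have gg: "g k \<bullet> g l = of_bool (k = l)" if "k \<notin> S" "l \<notin> S" for k l
    proof (cases "k = l")
      case True
      then show ?thesis using that g B(3)[of "g k"] by (auto simp: norm_eq_1)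
    next
      case False
      then have "g k \<noteq> g l" using g that by (auto simp: inj_on_def)
      then show ?thesis using False that g B(2) by (auto simp: pairwise_def orthogonal_def)
    qed
    show ?thesis using gv gg by (auto simp: w_def)
  qed
  then have "transpose W ** W = sub_mat S (\<chi> i j. v i \<bullet> v j)"
    by (simp add: vec_eq_iff matrix_matrix_mult_def transpose_def W_def sub_mat_def inner_vec_def)
  moreover have "column s W = v s" if "s \<in> S" for s using that by (simp add: col w_def)
  ultimately show ?thesis using that by blast
qed

section \<open>Integration over Gram matrices, column by column\<close>

lemma borel_measurable_vecI:
  fixes f :: "'a \<Rightarrow> ('b::euclidean_space, 'n::finite) vec"
  assumes "\<And>i. (\<lambda>x. f x $ i) \<in> borel_measurable M"
  shows "f \<in> borel_measurable M"
  unfolding borel_measurable_euclidean_space[where 'c = "('b, 'n) vec"]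
  using assms by (auto simp: Basis_vec_def inner_axis)

lemma borel_measurable_nth [measurable]:
  fixes f :: "'a \<Rightarrow> ('b::euclidean_space, 'n::finite) vec"
  assumes "f \<in> borel_measurable M"
  shows "(\<lambda>x. f x $ i) \<in> borel_measurable M"
  by (rule measurable_compose[OF assms borel_measurable_continuous_onI])
     (intro continuous_intros)

lemma continuous_on_det [continuous_intros]:
  fixes f :: "'a::topological_space \<Rightarrow> real^'n^'n"
  assumes "continuous_on S f" shows "continuous_on S (\<lambda>x. det (f x))"
  unfolding det_def by (intro continuous_intros assms)

lemma borel_measurable_det [measurable]:
  fixes f :: "'a \<Rightarrow> real^'n^'n"
  assumes "f \<in> borel_measurable M"
  shows "(\<lambda>x. det (f x)) \<in> borel_measurable M"
  by (rule measurable_compose[OF assms borel_measurable_continuous_onI])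
     (intro continuous_intros)

definition sym_mats :: "'n::finite sqmat set" where
  "sym_mats = {r. transpose r = r}"

lemma continuous_on_transpose [continuous_intros]:
  fixes f :: "'a::topological_space \<Rightarrow> real^'n^'m"
  assumes "continuous_on S f" shows "continuous_on S (\<lambda>x. transpose (f x))"
  unfolding transpose_def by (intro continuous_intros assms)

lemma continuous_on_matrix_vector_mult [continuous_intros]:
  fixes f :: "'a::topological_space \<Rightarrow> real^'n^'m"
  assumes "continuous_on S f" "continuous_on S g" shows "continuous_on S (\<lambda>x. f x *v g x)"
  unfolding matrix_vector_mult_def by (intro continuous_intros assms)

lemma continuous_on_matrix_mult [continuous_intros]:
  fixes f :: "'a::topological_space \<Rightarrow> real^'n^'m"
  assumes "continuous_on S f" "continuous_on S g" shows "continuous_on S (\<lambda>x. f x ** g x)"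
  unfolding matrix_matrix_mult_def by (intro continuous_intros assms)

lemma continuous_on_outer [continuous_intros]:
  assumes "continuous_on S f" "continuous_on S g" shows "continuous_on S (\<lambda>x. outer (f x) (g x))"
  unfolding outer_def by (intro continuous_intros assms)

lemma closed_sym_mats: "closed sym_mats"
  unfolding sym_mats_def by (intro closed_Collect_eq continuous_intros)

text \<open>By homogeneity definiteness is tested on the unit sphere, and the matrices that fail the
  test form the projection of a closed set along this compact set. Openness is relative to the
  symmetric matrices, and the locality arguments below are phrased accordingly.\<close>

lemma pd_cone_open_Int:
  obtains U where "open U" "pd_cone = sym_mats \<inter> (U :: 'n::finite sqmat set)"
proof
  define T where "T = {p :: (real^'n) \<times> 'n sqmat. fst p \<bullet> (snd p *v fst p) \<le> 0}"
  have T: "closed T" unfolding T_def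
    by (intro closed_Collect_le continuous_intros)
  define U where "U = - {r. \<exists>x. x \<in> sphere 0 1 \<and> (x, r) \<in> T}"
  show "open U" unfolding U_def
    by (intro open_Compl closed_compact_projection T) simp
  have "(\<forall>x. x \<noteq> 0 \<longrightarrow> 0 < x \<bullet> (r *v x)) \<longleftrightarrow> (\<forall>x. norm x = 1 \<longrightarrow> 0 < x \<bullet> (r *v x))" for r :: "'n sqmat"
  proof
    assume *: "\<forall>x. norm x = 1 \<longrightarrow> 0 < x \<bullet> (r *v x)"
    show "\<forall>x. x \<noteq> 0 \<longrightarrow> 0 < x \<bullet> (r *v x)"
    proof (intro allI impI)
      fix x :: "real^'n" assume "x \<noteq> 0"
      with * have "0 < (x /\<^sub>R norm x) \<bullet> (r *v (x /\<^sub>R norm x))"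
        by (auto simp del: inner_scaleR_left inner_scaleR_right)
      then show "0 < x \<bullet> (r *v x)"
        using \<open>x \<noteq> 0\<close> by (simp add: matrix_vector_mult_scaleR zero_less_mult_iff)
    qed
  qed (metis norm_zero zero_neq_one)
  then show "pd_cone = sym_mats \<inter> U"
    by (auto simp: pd_cone_def sym_mats_def U_def T_def not_le)
qed

lemma pd_cone_borel [measurable]: "(pd_cone :: 'n::finite sqmat set) \<in> sets borel"
proof -
  obtain U :: "'n sqmat set" where "open U" "pd_cone = sym_mats \<inter> U" by (rule pd_cone_open_Int)
  then show "(pd_cone :: 'n sqmat set) \<in> sets borel"
    using closed_sym_mats by (metis sets.Int borel_open borel_closed)
qed

section \<open>One further column: inner products, distance to the span, and the matching
  coordinates of symmetric matrices\<close>

definition upper_pairs :: "'m::linorder set \<Rightarrow> ('m \<times> 'm) set" where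
  "upper_pairs S = {(i, j). i \<le> j \<and> i \<in> S \<and> j \<in> S}"

lemma finite_upper_pairs [simp]: "finite S \<Longrightarrow> finite (upper_pairs S)"
  by (rule finite_subset[of _ "S \<times> S"]) (auto simp: upper_pairs_def)

abbreviation gram :: "('n \<Rightarrow> real^'k) \<Rightarrow> 'n::finite sqmat" where
  "gram v \<equiv> (\<chi> a b. v a \<bullet> v b)"

definition vec_of :: "'n set \<Rightarrow> ('n \<Rightarrow> real) \<Rightarrow> real^'n" where
  "vec_of S b = (\<chi> i. if i \<in> S then b i else 0)"

text \<open>This equals \<open>b'A\<^sup>-\<^sup>1b\<close>; the quotient of determinants makes Borel measurability in \<open>A\<close> evident.\<close>

definition schur_form :: "'n \<Rightarrow> 'n::finite sqmat \<Rightarrow> real^'n \<Rightarrow> real" where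
  "schur_form j A b = - det (bordered j A b 0) / det A"

lemma schur_form_eq:
  assumes "A \<in> pd_cone" "A *v axis j 1 = axis j 1" "b $ j = 0"
  shows "schur_form j A b = b \<bullet> (matrix_inv A *v b)"
  using det_bordered[OF assms, of 0] pd_cone_det_nonzero[OF assms(1)]
  by (simp add: schur_form_def)

lemma continuous_on_bordered [continuous_intros]:
  assumes "continuous_on S f" "continuous_on S g" "continuous_on S h"
  shows "continuous_on S (\<lambda>x. bordered j (f x) (g x) (h x))"
  unfolding bordered_def by (intro continuous_intros assms)

lemma borel_measurable_bordered [measurable]:
  assumes [measurable]: "f \<in> borel_measurable M" "g \<in> borel_measurable M" "h \<in> borel_measurable M"
  shows "(\<lambda>x. bordered j (f x) (g x) (h x)) \<in> borel_measurable M"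
proof -
  have "(\<lambda>p. bordered j (fst p) (fst (snd p)) (snd (snd p))) \<in> borel_measurable borel"
    by (intro borel_measurable_continuous_onI continuous_intros)
  from measurable_compose[OF _ this, of "\<lambda>x. (f x, g x, h x)" M] show ?thesis by simp
qed

lemma borel_measurable_schur_form [measurable]:
  assumes [measurable]: "f \<in> borel_measurable M" "g \<in> borel_measurable M"
  shows "(\<lambda>x. schur_form j (f x) (g x)) \<in> borel_measurable M"
  unfolding schur_form_def by measurable

lemma borel_measurable_vec_of [measurable]:
  assumes "f \<in> measurable M (prod_leb S)"
  shows "(\<lambda>x. vec_of S (f x)) \<in> borel_measurable M"
proof (rule borel_measurable_vecI)
  fix i
  show "(\<lambda>x. vec_of S (f x) $ i) \<in> borel_measurable M"
  proof (cases "i \<in> S")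
    case True
    have "(\<lambda>x. f x i) \<in> measurable M lborel"
      by (rule measurable_compose[OF assms measurable_component_singleton[OF True]])
    with True show ?thesis by (simp add: vec_of_def)
  qed (simp add: vec_of_def)
qed

lemma borel_measurable_sub_mat_gram [measurable]:
  fixes v :: "'a \<Rightarrow> 'n::finite \<Rightarrow> real^'k"
  assumes "v \<in> measurable M (prod_leb S)"
  shows "(\<lambda>x. sub_mat S (gram (v x))) \<in> borel_measurable M"
proof (intro borel_measurable_vecI)
  fix i j
  have c: "(\<lambda>x. v x k) \<in> measurable M borel" if "k \<in> S" for k
    using measurable_compose[OF assms measurable_component_singleton[OF that]] by simp
  show "(\<lambda>x. sub_mat S (gram (v x)) $ i $ j) \<in> borel_measurable M"
    using c by (cases "i \<in> S \<and> j \<in> S") (auto simp: sub_mat_def intro!: borel_measurable_inner)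
qed

lemma borel_measurable_sub_mat_sym_of_upper [measurable]:
  assumes "x \<in> measurable M (prod_leb (upper_pairs S))"
  shows "(\<lambda>w. sub_mat S (sym_of_upper (x w))) \<in> borel_measurable M"
proof (intro borel_measurable_vecI)
  fix i j
  have c: "(\<lambda>w. x w k) \<in> measurable M borel" if "k \<in> upper_pairs S" for k
    using measurable_compose[OF assms measurable_component_singleton[OF that]] by simp
  show "(\<lambda>w. sub_mat S (sym_of_upper (x w)) $ i $ j) \<in> borel_measurable M"
  proof (cases "i \<in> S \<and> j \<in> S")
    case True
    then have "(min i j, max i j) \<in> upper_pairs S" by (auto simp: upper_pairs_def min_def max_def)
    from c[OF this] True show ?thesis by (simp add: sub_mat_def sym_of_upper_def)
  next
    case False
    then have "sub_mat S r $ i $ j = of_bool (i = j)" for r by (auto simp: sub_mat_def)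
    then show ?thesis by simp
  qed
qed

lemma gram_symmetric: "transpose (gram v) = gram v"
  by (simp add: transpose_def vec_eq_iff inner_commute)

lemma sym_of_upper_symmetric: "transpose (sym_of_upper x) = sym_of_upper x"
  by (simp add: transpose_def vec_eq_iff sym_of_upper_def min.commute max.commute)

lemma nn_integral_PiM_reindex:
  assumes "finite I" "inj_on t I" and [measurable]: "F \<in> borel_measurable (prod_leb I)"
  shows "(\<integral>\<^sup>+y. F (\<lambda>i\<in>I. y (t i)) \<partial>PiM (t ` I) (\<lambda>_. lborel :: 'a::euclidean_space measure)) = (\<integral>\<^sup>+b. F b \<partial>prod_leb I)"
proof -
  have [measurable]: "(\<lambda>x. \<lambda>i\<in>I. x (t i)) \<in> measurable (prod_leb (t ` I)) (PiM I (\<lambda>_. lborel :: 'a measure))"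
    by (rule measurable_restrict) auto
  have "(\<integral>\<^sup>+b. F b \<partial>prod_leb I) = (\<integral>\<^sup>+b. F b \<partial>distr (prod_leb (t ` I)) (prod_leb I) (\<lambda>x. \<lambda>i\<in>I. x (t i)))"
    by (simp only: PiM_lborel_reindex[OF assms(1,2)])
  then show ?thesis by (simp add: nn_integral_distr)
qed

text \<open>The outcome of integrating a column \<open>y\<close> when the previous columns have Gram
  matrix \<open>A\<close>: \<open>b\<close> holds the inner products with them, \<open>t\<close> is
  the squared distance of \<open>y\<close> to their span, with the density of a squared norm in
  dimension \<open>q\<close>, and the power of \<open>det A\<close> is the Jacobian.\<close>

definition column_kernel :: "nat \<Rightarrow> 'n \<Rightarrow> 'n set \<Rightarrow> ('n::finite sqmat \<Rightarrow> ennreal) \<Rightarrow> 'n sqmat \<Rightarrow> ennreal" where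
  "column_kernel q j S F A = ennreal (det A powr (- 1 / 2)) *
     (\<integral>\<^sup>+b. (\<integral>\<^sup>+t. F (bordered j A (vec_of S b) (schur_form j A (vec_of S b) + t)) *
        ennreal (pi powr (q / 2) / Gamma (q / 2) * t powr (q / 2 - 1)) * indicator {0<..} t \<partial>lborel) \<partial>prod_leb S)"

lemma borel_measurable_column_kernel [measurable]:
  fixes F :: "'n::finite sqmat \<Rightarrow> ennreal"
  assumes [measurable]: "F \<in> borel_measurable borel"
  shows "column_kernel q j S F \<in> borel_measurable borel"
proof -
  interpret S: product_sigma_finite "\<lambda>_. lborel :: real measure" by standard
  interpret finite_product_sigma_finite "\<lambda>_. lborel :: real measure" S by standard simp
  show ?thesis
    unfolding column_kernel_def by measurable
qed

text \<open>Substitute w = W'y for the completed frame \<open>W\<close>. The coordinates in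
  \<open>S\<close> are the inner products with the \<open>v i\<close>, the others are orthonormal
  coordinates in the complement, and |y|^2 = w'A^{-1}w because A = W'W.\<close>

lemma nn_integral_column:
  fixes v :: "'n::finite \<Rightarrow> real^'n" and F :: "'n sqmat \<Rightarrow> ennreal" and S :: "'n set"
  defines "A \<equiv> sub_mat S (gram v)"
  assumes F[measurable]: "F \<in> borel_measurable borel" and j: "j \<notin> S" and A: "A \<in> pd_cone"
  shows "(\<integral>\<^sup>+y. F (bordered j A (\<chi> i. if i \<in> S then v i \<bullet> y else 0) (y \<bullet> y)) \<partial>lborel)
    = column_kernel (CARD('n) - card S) j S F A"
proof -
  obtain W where W: "transpose W ** W = A" and col: "\<And>s. s \<in> S \<Longrightarrow> column s W = v s"
    using frame_completion[of S v] unfolding A_def by metis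
  have Aj: "A *v axis k 1 = axis k 1" if "k \<notin> S" for k unfolding A_def by (rule sub_mat_axis[OF that])
  have dA: "det A = (det W)\<^sup>2" by (simp add: W[symmetric] det_mul det_transpose power2_eq_square)
  then have dW: "det W \<noteq> 0" "\<bar>det W\<bar> = sqrt (det A)" using pd_cone_det_nonzero[OF A] by auto
  have AA: "A ** matrix_inv A = mat 1" "matrix_inv A ** A = mat 1"
    using det_nonzero_inverse[OF pd_cone_det_nonzero[OF A]] by auto
  define G where "G w = F (bordered j A (vec_of S (($) w)) (w \<bullet> (matrix_inv A *v w)))" for w
  have vo: "vec_of S (($) w) = (\<chi> i. if i \<in> S then w $ i else 0)" for w by (simp add: vec_of_def)
  have G[measurable]: "G \<in> borel_measurable borel"
  proof -
    have [measurable]: "(\<lambda>w. vec_of S (($) w)) \<in> borel_measurable borel"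
      unfolding vo by (intro borel_measurable_vecI) auto
    have [measurable]: "(\<lambda>w. w \<bullet> (matrix_inv A *v w)) \<in> borel_measurable borel"
      by (intro borel_measurable_continuous_onI continuous_intros)
    show ?thesis unfolding G_def by measurable
  qed
  have GW: "G (transpose W *v y) = F (bordered j A (\<chi> i. if i \<in> S then v i \<bullet> y else 0) (y \<bullet> y))" for y
  proof -
    have "(transpose W *v y) $ i = column i W \<bullet> y" for i
      by (simp add: matrix_vector_mult_def column_def inner_vec_def transpose_def del: transpose_matrix_vector)
    then have "vec_of S (($) (transpose W *v y)) = (\<chi> i. if i \<in> S then v i \<bullet> y else 0)"
      by (intro vec_eq_iff[THEN iffD2] allI) (simp add: vo col del: transpose_matrix_vector)
    moreover have "(transpose W *v y) \<bullet> (matrix_inv A *v (transpose W *v y)) = y \<bullet> y"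
    proof -
      have "transpose W *v (W *v (matrix_inv A *v (transpose W *v y))) = transpose W *v y"
        by (simp add: matrix_vector_mul_assoc W AA matrix_mul_assoc del: transpose_matrix_vector)
      moreover have "transpose W *v x = transpose W *v z \<Longrightarrow> x = z" for x z
        using dW det_nonzero_inverse[of "transpose W"]
        by (metis det_transpose matrix_vector_mul_assoc matrix_vector_mul_lid)
      ultimately have "W *v (matrix_inv A *v (transpose W *v y)) = y" by blast
      then show ?thesis by (metis inner_transpose_vec)
    qed
    ultimately show ?thesis by (simp add: G_def del: transpose_matrix_vector)
  qed
  have "(\<integral>\<^sup>+w. G w \<partial>lborel) = ennreal \<bar>det (transpose W)\<bar> * (\<integral>\<^sup>+y. G (transpose W *v y) \<partial>lborel)"
    by (rule nn_integral_linear_image) (use dW in \<open>auto simp: det_transpose\<close>)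
  then have "ennreal (1 / sqrt (det A)) * (\<integral>\<^sup>+w. G w \<partial>lborel) = ennreal (1 / sqrt (det A)) * ennreal (sqrt (det A)) * (\<integral>\<^sup>+y. G (transpose W *v y) \<partial>lborel)"
    by (simp add: det_transpose dW mult.assoc)
  also have "ennreal (1 / sqrt (det A)) * ennreal (sqrt (det A)) = 1"
    using pd_cone_det_pos[OF A] by (simp add: ennreal_mult'[symmetric])
  finally have 1: "(\<integral>\<^sup>+y. G (transpose W *v y) \<partial>lborel) = ennreal (det A powr (- 1 / 2)) * (\<integral>\<^sup>+w. G w \<partial>lborel)"
    using pd_cone_det_pos[OF A] by (simp add: powr_minus powr_half_sqrt divide_simps)
  have SU: "S \<union> - S = UNIV" by auto
  have cS: "card (- S) = CARD('n) - card S" by (simp add: Compl_eq_Diff_UNIV card_Diff_subset)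
  have neS: "- S \<noteq> {}" using j by auto
  have [measurable]: "vec_lambda \<in> measurable (prod_leb UNIV) (borel :: (real^'n) measure)"
    by (rule borel_measurable_vecI) simp
  have "(\<integral>\<^sup>+w. G w \<partial>lborel) = (\<integral>\<^sup>+w. G (vec_lambda w) \<partial>prod_leb UNIV)"
    by (rule nn_integral_lborel_vec) simp
  also have "\<dots> = (\<integral>\<^sup>+b. (\<integral>\<^sup>+e. G (vec_lambda (merge S (- S) (b, e))) \<partial>prod_leb (- S)) \<partial>prod_leb S)"
    using lborel_PiM.product_nn_integral_fold[of S "- S" "\<lambda>w. G (vec_lambda w)"] by (simp add: SU)
  also have "\<dots> = (\<integral>\<^sup>+b. (\<integral>\<^sup>+e. F (bordered j A (vec_of S b) (schur_form j A (vec_of S b) + (\<Sum>i\<in>- S. (e i)\<^sup>2))) \<partial>prod_leb (- S)) \<partial>prod_leb S)"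
  proof (intro nn_integral_cong)
    fix b e :: "'n \<Rightarrow> real"
    define w where "w = vec_lambda (merge S (- S) (b, e))"
    define z where "z = vec_of (- S) e"
    define bb where "bb = vec_of S b"
    define y where "y = matrix_inv A *v bb"
    have w: "w = bb + z" by (auto simp: w_def bb_def z_def vec_of_def merge_def vec_eq_iff)
    have "vec_of S (($) w) = bb" by (auto simp: w_def bb_def vec_of_def merge_def vec_eq_iff)
    \<comment> \<open>\<open>A\<close> and hence its inverse act as the identity on vectors
      supported outside \<open>S\<close>. In \<open>w = bb + z\<close> the mixed terms vanish, and
      the form splits into the Schur form of \<open>bb\<close> and the squared norm of
      \<open>z\<close>.\<close>
    moreover have "w \<bullet> (matrix_inv A *v w) = schur_form j A bb + (\<Sum>i\<in>- S. (e i)\<^sup>2)"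
    proof -
      have Ay: "A *v y = bb" by (simp add: y_def matrix_vector_mul_assoc AA)
      have yk: "y $ k = 0" if "k \<notin> S" for k
      proof -
        have "y $ k = y \<bullet> (A *v axis k 1)" using Aj[OF that] by (simp add: inner_axis)
        also have "\<dots> = (A *v y) \<bullet> axis k 1"
          using pd_cone_symD[OF A] by (metis inner_transpose_vec)
        finally show ?thesis using that by (simp add: Ay inner_axis bb_def vec_of_def)
      qed
      have Az: "A *v z = z"
      proof -
        have "z = (\<Sum>k\<in>-S. e k *\<^sub>R axis k 1)"
          by (auto simp: vec_eq_iff z_def vec_of_def axis_def if_distrib[where f = "\<lambda>x. _ * x"] cong: if_cong)
        then show ?thesis
          by (simp add: linear_sum[OF matrix_vector_mul_linear] matrix_vector_mult_scaleR Aj)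
      qed
      have "matrix_inv A *v z = z"
        by (metis AA(2) Az matrix_vector_mul_assoc matrix_vector_mul_lid)
      then have "matrix_inv A *v w = y + z" by (simp add: w matrix_vector_right_distrib y_def)
      moreover have "bb \<bullet> z = 0" "z \<bullet> y = 0"
        using yk by (auto simp: inner_vec_def bb_def z_def vec_of_def intro!: sum.neutral)
      moreover have "z \<bullet> z = (\<Sum>i\<in>- S. (e i)\<^sup>2)"
        by (simp add: inner_vec_def z_def vec_of_def if_distrib power2_eq_square sum.If_cases Compl_eq cong: if_cong)
      ultimately show ?thesis
        using schur_form_eq[OF A Aj[OF j], of bb] j
        by (simp add: w inner_add_left inner_add_right y_def bb_def vec_of_def)
    qed
    ultimately show "G (vec_lambda (merge S (- S) (b, e))) = F (bordered j A (vec_of S b) (schur_form j A (vec_of S b) + (\<Sum>i\<in>- S. (e i)\<^sup>2)))"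
      by (simp add: G_def w_def[symmetric] bb_def)
  qed
  also have "\<dots> = (\<integral>\<^sup>+b. (\<integral>\<^sup>+t. F (bordered j A (vec_of S b) (schur_form j A (vec_of S b) + t)) * ennreal (pi powr (card (- S) / 2) / Gamma (card (- S) / 2) * t powr (card (- S) / 2 - 1)) * indicator {0<..} t \<partial>lborel) \<partial>prod_leb S)"
    by (intro nn_integral_cong nn_integral_PiM_sum_squares neS) auto
  finally show ?thesis
    using 1 unfolding GW column_kernel_def cS by simp
qed

text \<open>\<open>F\<close> times the density of the fractional integral without its Gamma factor,
  where \<open>e\<close> stands for \<alpha> - d.\<close>

definition pd_weighted :: "real \<Rightarrow> ('n::finite sqmat \<Rightarrow> ennreal) \<Rightarrow> 'n sqmat \<Rightarrow> ennreal" where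
  "pd_weighted e F A = (if A \<in> pd_cone then F A * ennreal (det A powr e) else 0)"

lemma borel_measurable_pd_weighted [measurable]:
  assumes [measurable]: "F \<in> borel_measurable borel"
  shows "pd_weighted e F \<in> borel_measurable borel"
proof -
  have "(\<lambda>A :: 'n::finite sqmat. ennreal (det A powr e)) \<in> borel_measurable borel" by measurable
  then show ?thesis unfolding pd_weighted_def
    by (intro measurable_If borel_measurable_times assms) (auto simp: pd_cone_borel)
qed

lemma upper_pairs_insert:
  "upper_pairs (insert j S) = insert (j, j) (upper_pairs S \<union> (\<lambda>i. (min i j, max i j)) ` S)"
  (is "?L = ?R")
proof
  show "?L \<subseteq> ?R"
  proof
    fix p assume "p \<in> ?L"
    then obtain a b where p: "p = (a, b)" "a \<le> b" "a \<in> insert j S" "b \<in> insert j S"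
      by (auto simp: upper_pairs_def)
    have "(a, b) = (min i j, max i j)" if "a = i \<and> b = j \<or> a = j \<and> b = i" for i
      using that p by (auto simp: min_def max_def)
    then show "p \<in> ?R" using p by (auto simp: upper_pairs_def)
  qed
  show "?R \<subseteq> ?L" by (auto simp: upper_pairs_def min_def max_def)
qed

text \<open>The index \<open>j\<close> adds the diagonal entry \<open>u\<close> and one entry for
  each \<open>i\<close> in \<open>S\<close>, stored at \<open>(i, j)\<close> or
  \<open>(j, i)\<close> depending on the order of the indices; \<open>t\<close> sends
  \<open>i\<close> to that position.\<close>

lemma nn_integral_upper_pairs_insert:
  fixes G :: "'n::{finite,linorder} sqmat \<Rightarrow> ennreal"
  assumes G[measurable]: "G \<in> borel_measurable borel" and j: "j \<notin> S"
  shows "(\<integral>\<^sup>+x. G (sub_mat (insert j S) (sym_of_upper x)) \<partial>prod_leb (upper_pairs (insert j S))) =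
    (\<integral>\<^sup>+x. (\<integral>\<^sup>+b. (\<integral>\<^sup>+u. G (bordered j (sub_mat S (sym_of_upper x)) (vec_of S b) u) \<partial>lborel)
        \<partial>prod_leb S) \<partial>prod_leb (upper_pairs S))"
proof -
  define t where "t i = (min i j, max i j)" for i
  define N where "N = t ` S"
  have inj: "inj_on t S" by (auto simp: inj_on_def t_def min_def max_def split: if_splits)
  have up: "upper_pairs (insert j S) = insert (j, j) (upper_pairs S \<union> N)"
    unfolding N_def t_def by (rule upper_pairs_insert)
  have jj: "(j, j) \<notin> upper_pairs S \<union> N"
    using j by (auto simp: upper_pairs_def N_def t_def min_def max_def split: if_splits)
  have dj: "upper_pairs S \<inter> N = {}"
    using j by (auto simp: upper_pairs_def N_def t_def min_def max_def split: if_splits)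
  have fin: "finite (upper_pairs S)" "finite N" by (simp_all add: N_def)
  have m0: "(\<lambda>x. G (sub_mat (insert j S) (sym_of_upper x))) \<in> borel_measurable (prod_leb (upper_pairs (insert j S)))"
    by measurable
  note m1 = m0[unfolded up]
  define H where "H x = (\<integral>\<^sup>+u. G (sub_mat (insert j S) (sym_of_upper (x((j, j) := u)))) \<partial>lborel)" for x
  have mH: "H \<in> borel_measurable (prod_leb (upper_pairs S \<union> N))"
  proof -
    have 1: "(\<lambda>p. (fst p)((j, j) := snd p)) \<in> measurable (prod_leb (upper_pairs S \<union> N) \<Otimes>\<^sub>M lborel) (real_leb (upper_pairs (insert j S)))"
      unfolding up by (rule measurable_fun_upd[where J = "upper_pairs S \<union> N"]) auto
    show ?thesis unfolding H_def
      by (rule lborel.borel_measurable_nn_integral) (use measurable_compose[OF 1 m0] in \<open>simp add: case_prod_beta\<close>)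
  qed
  have key: "sub_mat (insert j S) (sym_of_upper ((merge (upper_pairs S) N (x, y))((j, j) := u)))
      = bordered j (sub_mat S (sym_of_upper x)) (vec_of S (\<lambda>i\<in>S. y (t i))) u" for x y u
  proof -
    define z where "z = (merge (upper_pairs S) N (x, y))((j, j) := u)"
    have "sub_mat (insert j S) (sym_of_upper z) = bordered j (sub_mat S (sym_of_upper z)) (\<chi> i. if i \<in> S then sym_of_upper z $ i $ j else 0) (sym_of_upper z $ j $ j)"
      by (rule sub_mat_insert[OF sym_of_upper_symmetric j])
    also have "sub_mat S (sym_of_upper z) = sub_mat S (sym_of_upper x)"
    proof -
      have "z (min a b, max a b) = x (min a b, max a b)" if "a \<in> S" "b \<in> S" for a b
      proof -
        have "(min a b, max a b) \<in> upper_pairs S" using that by (auto simp: upper_pairs_def min_def max_def)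
        then show ?thesis using jj by (auto simp: z_def merge_def)
      qed
      then show ?thesis by (auto simp: sub_mat_def sym_of_upper_def vec_eq_iff)
    qed
    also have "(\<chi> i. if i \<in> S then sym_of_upper z $ i $ j else 0) = vec_of S (\<lambda>i\<in>S. y (t i))"
    proof -
      have "z (t i) = y (t i)" if "i \<in> S" for i
      proof -
        have "t i \<in> N" using that by (simp add: N_def)
        then show ?thesis using jj dj by (auto simp: z_def merge_def)
      qed
      then show ?thesis by (auto simp: vec_of_def sym_of_upper_def vec_eq_iff t_def)
    qed
    also have "sym_of_upper z $ j $ j = u" by (simp add: sym_of_upper_def z_def)
    finally show ?thesis unfolding z_def .
  qed
  have "(\<integral>\<^sup>+x. G (sub_mat (insert j S) (sym_of_upper x)) \<partial>prod_leb (upper_pairs (insert j S))) =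
      (\<integral>\<^sup>+x. H x \<partial>prod_leb (upper_pairs S \<union> N))"
    unfolding up H_def
    by (rule lborel_PiM.product_nn_integral_insert[OF _ jj m1]) (use fin in auto)
  also have "\<dots> = (\<integral>\<^sup>+x. (\<integral>\<^sup>+y. H (merge (upper_pairs S) N (x, y)) \<partial>prod_leb N) \<partial>prod_leb (upper_pairs S))"
    by (rule lborel_PiM.product_nn_integral_fold[OF dj fin mH])
  also have "\<dots> = (\<integral>\<^sup>+x. (\<integral>\<^sup>+b. (\<integral>\<^sup>+u. G (bordered j (sub_mat S (sym_of_upper x)) (vec_of S b) u) \<partial>lborel)
        \<partial>prod_leb S) \<partial>prod_leb (upper_pairs S))"
  proof (rule nn_integral_cong)
    fix x
    have "(\<lambda>b. \<integral>\<^sup>+u. G (bordered j (sub_mat S (sym_of_upper x)) (vec_of S b) u) \<partial>lborel) \<in> borel_measurable (prod_leb S)"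
      by measurable
    from nn_integral_PiM_reindex[OF _ inj this]
    show "(\<integral>\<^sup>+y. H (merge (upper_pairs S) N (x, y)) \<partial>prod_leb N) =
      (\<integral>\<^sup>+b. (\<integral>\<^sup>+u. G (bordered j (sub_mat S (sym_of_upper x)) (vec_of S b) u) \<partial>lborel) \<partial>prod_leb S)"
      unfolding H_def key unfolding N_def by simp
  qed
  finally show ?thesis .
qed

text \<open>Shift \<open>u\<close> by the Schur form. The bordered matrix is positive definite
  exactly for \<open>t > 0\<close>, and its determinant is \<open>det A * t\<close>, so the weight
  factorizes.\<close>

lemma nn_integral_pd_weighted_bordered:
  fixes F :: "'n::finite sqmat \<Rightarrow> ennreal"
  assumes [measurable]: "F \<in> borel_measurable borel"
    and A: "A \<in> pd_cone" "A *v axis j 1 = axis j 1" "b $ j = 0"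
  shows "(\<integral>\<^sup>+u. pd_weighted e F (bordered j A b u) \<partial>lborel) =
    ennreal (det A powr e) * (\<integral>\<^sup>+t. F (bordered j A b (schur_form j A b + t)) * ennreal (t powr e) * indicator {0<..} t \<partial>lborel)"
proof -
  define Q where "Q = schur_form j A b"
  have Q: "Q = b \<bullet> (matrix_inv A *v b)" unfolding Q_def by (rule schur_form_eq[OF A])
  have "(\<integral>\<^sup>+u. pd_weighted e F (bordered j A b u) \<partial>lborel) = (\<integral>\<^sup>+t. pd_weighted e F (bordered j A b (Q + 1 * t)) \<partial>lborel)"
    using nn_integral_real_affine[of "\<lambda>u. pd_weighted e F (bordered j A b u)" 1 Q] by simp
  also have "\<dots> = (\<integral>\<^sup>+t. ennreal (det A powr e) * (F (bordered j A b (Q + t)) * ennreal (t powr e) * indicator {0<..} t) \<partial>lborel)"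
  proof (rule nn_integral_cong)
    fix t :: real
    have "pd_weighted e F (bordered j A b (Q + t)) = ennreal (det A powr e) * (F (bordered j A b (Q + t)) * ennreal (t powr e))" if "t > 0"
    proof -
      have "bordered j A b (Q + t) \<in> pd_cone" using bordered_pd_cone_iff[OF A] that by (simp add: Q)
      moreover have "det (bordered j A b (Q + t)) powr e = det A powr e * t powr e"
        using det_bordered[OF A] that pd_cone_det_pos[OF A(1)] by (simp add: Q powr_mult)
      ultimately show ?thesis by (simp add: pd_weighted_def ennreal_mult mult_ac)
    qed
    moreover have "pd_weighted e F (bordered j A b (Q + t)) = 0" if "\<not> t > 0"
      using bordered_pd_cone_iff[OF A] that by (simp add: Q pd_weighted_def)
    ultimately show "pd_weighted e F (bordered j A b (Q + 1 * t)) = ennreal (det A powr e) * (F (bordered j A b (Q + t)) * ennreal (t powr e) * indicator {0<..} t)"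
      by (cases "t > 0") auto
  qed
  also have "\<dots> = ennreal (det A powr e) * (\<integral>\<^sup>+t. F (bordered j A b (Q + t)) * ennreal (t powr e) * indicator {0<..} t \<partial>lborel)"
    by (rule nn_integral_cmult) measurable
  finally show ?thesis by (simp add: Q_def)
qed

lemma bordered_pd_cone_imp:
  assumes "bordered j (sub_mat S r) b u \<in> pd_cone" "j \<notin> S" "\<And>i. i \<notin> S \<Longrightarrow> b $ i = 0"
  shows "sub_mat S r \<in> pd_cone"
proof -
  have "sub_mat S (bordered j (sub_mat S r) b u) = sub_mat S r"
    using assms(2) by (auto simp: sub_mat_def bordered_def vec_eq_iff axis_def)
  then show ?thesis using sub_mat_pd_cone[OF assms(1), of S] by simp
qed

text \<open>Product of half the areas of the unit spheres in dimensions \<open>n\<close>,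
  \<open>n - 1\<close>, and so on, one factor per column.\<close>

definition frame_const :: "nat \<Rightarrow> nat \<Rightarrow> real" where
  "frame_const n p = (\<Prod>i<p. pi powr (real (n - i) / 2) / Gamma (real (n - i) / 2))"

lemma frame_const_pos: "p \<le> n \<Longrightarrow> 0 < frame_const n p"
  unfolding frame_const_def by (intro prod_pos) (auto intro!: divide_pos_pos)

lemma nn_integral_PiM_empty: "(\<integral>\<^sup>+x. f x \<partial>PiM {} M) = f (\<lambda>_. undefined)"
  by (simp add: PiM_empty nn_integral_count_space_finite)

text \<open>With \<open>q\<close> the dimension left for a new column, the exponent passes from
  \<open>(q - 1) / 2\<close> to \<open>q / 2 - 1\<close>: the loss of 1/2 is the Jacobian of the
  frame. For \<open>S = UNIV\<close> the exponent is -1/2, which is m/2 - d.\<close>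

theorem nn_integral_sub_gram:
  fixes F :: "'n::{finite,linorder} sqmat \<Rightarrow> ennreal" and S :: "'n set"
  assumes "F \<in> borel_measurable borel"
  shows "(\<integral>\<^sup>+v. F (sub_mat S (gram v)) \<partial>PiM S (\<lambda>_. lborel :: ((real, 'n) vec) measure)) =
    ennreal (frame_const CARD('n) (card S)) *
    (\<integral>\<^sup>+x. pd_weighted ((real CARD('n) - real (card S) - 1) / 2) F (sub_mat S (sym_of_upper x)) \<partial>prod_leb (upper_pairs S))"
  using finite[of S] assms
proof (induction S arbitrary: F)
  case empty
  have "upper_pairs {} = ({} :: ('n \<times> 'n) set)" by (simp add: upper_pairs_def)
  then show ?case by (simp del: nn_integral_const add: nn_integral_PiM_empty frame_const_def pd_weighted_def mat_1_pd_cone)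
next
  case (insert j S)
  note [measurable] = insert.prems
  define p where "p = card S"
  define q where "q = CARD('n) - p"
  have "card S < CARD('n)"
    using insert(2) by (metis psubset_card_mono finite psubsetI subset_UNIV UNIV_I)
  then have pq: "p < CARD('n)" "real q = real CARD('n) - real p" "q > 0" by (auto simp: p_def q_def)
  define e where "e = real q / 2 - 1"
  define K where "K = pi powr (real q / 2) / Gamma (real q / 2)"
  have K: "K > 0" using pq by (simp add: K_def)
  let ?M = "PiM S (\<lambda>_. lborel :: ((real, 'n) vec) measure)"
  let ?R = "real_leb (upper_pairs S)"
  let ?A = "\<lambda>x. sub_mat S (sym_of_upper x)"
  \<comment> \<open>Almost every family of vectors is linearly independent: this is the induction
    hypothesis for the indicator of the complement of the cone, whose weighted version
    vanishes.\<close>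
  have ae: "AE v in ?M. sub_mat S (gram v) \<in> pd_cone"
  proof -
    have "(\<integral>\<^sup>+v. indicator (- pd_cone) (sub_mat S (gram v)) \<partial>?M) = 0"
      by (subst insert.IH) (auto simp: pd_weighted_def indicator_def nn_integral_0_iff_AE cong: if_cong)
    then show ?thesis by (subst (asm) nn_integral_0_iff_AE) (auto simp: indicator_def)
  qed
  have upd: "sub_mat (insert j S) (gram (v(j := y))) = bordered j (sub_mat S (gram v)) (\<chi> i. if i \<in> S then v i \<bullet> y else 0) (y \<bullet> y)" for v :: "'n \<Rightarrow> (real, 'n) vec" and y
  proof -
    have "sub_mat S (gram (v(j := y))) = sub_mat S (gram v)"
      using insert(2) by (auto simp: sub_mat_def vec_eq_iff)
    moreover have "(\<chi> i. if i \<in> S then gram (v(j := y)) $ i $ j else 0) = (\<chi> i. if i \<in> S then v i \<bullet> y else 0)"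
      using insert(2) by (auto simp: vec_eq_iff)
    ultimately show ?thesis
      using sub_mat_insert[OF gram_symmetric insert(2), of "v(j := y)"] by simp
  qed
  have "(\<integral>\<^sup>+v. F (sub_mat (insert j S) (gram v)) \<partial>PiM (insert j S) (\<lambda>_. lborel :: ((real, 'n) vec) measure)) =
     (\<integral>\<^sup>+v. (\<integral>\<^sup>+y. F (sub_mat (insert j S) (gram (v(j := y)))) \<partial>lborel) \<partial>?M)"
    by (rule lborel_PiM.product_nn_integral_insert) (use insert in measurable)
  also have "\<dots> = (\<integral>\<^sup>+v. column_kernel q j S F (sub_mat S (gram v)) \<partial>?M)"
  proof (rule nn_integral_cong_AE)
    show "AE v in ?M. (\<integral>\<^sup>+y. F (sub_mat (insert j S) (gram (v(j := y)))) \<partial>lborel) = column_kernel q j S F (sub_mat S (gram v))"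
      using ae
    proof eventually_elim
      case (elim v)
      then show ?case
        unfolding upd q_def p_def by (intro nn_integral_column insert)
    qed
  qed
  also have "\<dots> = ennreal (frame_const CARD('n) p) * (\<integral>\<^sup>+x. pd_weighted ((real q - 1) / 2) (column_kernel q j S F) (?A x) \<partial>?R)"
    using insert.IH[of "column_kernel q j S F"] by (simp add: p_def pq(2))
  also have "(\<integral>\<^sup>+x. pd_weighted ((real q - 1) / 2) (column_kernel q j S F) (?A x) \<partial>?R)
      = (\<integral>\<^sup>+x. ennreal K * (\<integral>\<^sup>+b. (\<integral>\<^sup>+u. pd_weighted e F (bordered j (?A x) (vec_of S b) u) \<partial>lborel) \<partial>prod_leb S) \<partial>?R)"
  proof (rule nn_integral_cong)
    fix x
    show "pd_weighted ((real q - 1) / 2) (column_kernel q j S F) (?A x) =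
      ennreal K * (\<integral>\<^sup>+b. (\<integral>\<^sup>+u. pd_weighted e F (bordered j (?A x) (vec_of S b) u) \<partial>lborel) \<partial>prod_leb S)"
    proof (cases "?A x \<in> pd_cone")
      case False
      then have "pd_weighted e F (bordered j (?A x) (vec_of S b) u) = 0" for b u
        using bordered_pd_cone_imp[of j S "sym_of_upper x" "vec_of S b" u] insert(2)
        by (auto simp: pd_weighted_def vec_of_def)
      then show ?thesis using False by (simp add: pd_weighted_def)
    next
      case True
      define A where "A = ?A x"
      have A: "A \<in> pd_cone" "A *v axis j 1 = axis j 1" "vec_of S b $ j = 0" for b
        using True sub_mat_axis[OF insert(2)] insert(2) by (auto simp: A_def vec_of_def)
      define I where "I b = (\<integral>\<^sup>+t. F (bordered j A (vec_of S b) (schur_form j A (vec_of S b) + t)) * ennreal (t powr e) * indicator {0<..} t \<partial>lborel)" for b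
      have mI[measurable]: "I \<in> borel_measurable (prod_leb S)" unfolding I_def by measurable
      have "column_kernel q j S F A = ennreal (det A powr (-1/2)) * (\<integral>\<^sup>+b. ennreal K * I b \<partial>prod_leb S)"
        unfolding column_kernel_def I_def
        using K by (subst nn_integral_cmult[symmetric])
          (auto intro!: nn_integral_cong arg_cong2[where f = "(*)"] simp: K_def[symmetric] e_def[symmetric] ennreal_mult mult_ac)
      then have "column_kernel q j S F A * ennreal (det A powr ((real q - 1) / 2)) =
         ennreal K * (ennreal (det A powr (-1/2)) * ennreal (det A powr ((real q - 1) / 2)) * (\<integral>\<^sup>+b. I b \<partial>prod_leb S))"
        by (simp add: nn_integral_cmult mult_ac)
      also have "ennreal (det A powr (-1/2)) * ennreal (det A powr ((real q - 1) / 2)) = ennreal (det A powr e)"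
      proof -
        have "- 1 / 2 + (real q - 1) / 2 = e" by (simp add: e_def field_simps)
        then show ?thesis by (simp only: ennreal_mult[symmetric] powr_ge_zero powr_add[symmetric])
      qed
      also have "ennreal (det A powr e) * (\<integral>\<^sup>+b. I b \<partial>prod_leb S) = (\<integral>\<^sup>+b. (\<integral>\<^sup>+u. pd_weighted e F (bordered j A (vec_of S b) u) \<partial>lborel) \<partial>prod_leb S)"
        unfolding nn_integral_pd_weighted_bordered[OF insert.prems A] I_def[symmetric]
        by (subst nn_integral_cmult) auto
      finally show ?thesis using True by (simp add: pd_weighted_def A_def)
    qed
  qed
  also have "\<dots> = ennreal K * (\<integral>\<^sup>+x. (\<integral>\<^sup>+b. (\<integral>\<^sup>+u. pd_weighted e F (bordered j (?A x) (vec_of S b) u) \<partial>lborel) \<partial>prod_leb S) \<partial>?R)"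
  proof (rule nn_integral_cmult)
    interpret finite_product_sigma_finite "\<lambda>_. lborel :: real measure" S by standard simp
    show "(\<lambda>x. \<integral>\<^sup>+b. (\<integral>\<^sup>+u. pd_weighted e F (bordered j (?A x) (vec_of S b) u) \<partial>lborel) \<partial>prod_leb S) \<in> borel_measurable ?R"
      by measurable
  qed
  also have "(\<integral>\<^sup>+x. (\<integral>\<^sup>+b. (\<integral>\<^sup>+u. pd_weighted e F (bordered j (?A x) (vec_of S b) u) \<partial>lborel) \<partial>prod_leb S) \<partial>?R) =
    (\<integral>\<^sup>+x. pd_weighted e F (sub_mat (insert j S) (sym_of_upper x)) \<partial>prod_leb (upper_pairs (insert j S)))"
    by (rule nn_integral_upper_pairs_insert[symmetric]) (use insert in auto)
  finally have "(\<integral>\<^sup>+v. F (sub_mat (insert j S) (gram v)) \<partial>PiM (insert j S) (\<lambda>_. lborel :: ((real, 'n) vec) measure)) =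
    ennreal (frame_const CARD('n) p * K) * (\<integral>\<^sup>+x. pd_weighted e F (sub_mat (insert j S) (sym_of_upper x)) \<partial>prod_leb (upper_pairs (insert j S)))"
    using K frame_const_pos[of p "CARD('n)"] pq by (simp add: ennreal_mult mult.assoc)
  moreover have "frame_const CARD('n) p * K = frame_const CARD('n) (card (insert j S))"
    using insert(1,2) by (simp add: frame_const_def K_def q_def p_def)
  moreover have "e = (real CARD('n) - real (card (insert j S)) - 1) / 2"
    using insert(1,2) pq by (simp add: e_def p_def field_simps)
  ultimately show ?case by simp
qed

section \<open>Adding rows\<close>

text \<open>Convolution with the image of dx under x -> xx', acting on functions. Its powers count
  rows by a natural number, independently of any index type.\<close>

definition gram_op :: "('n::finite sqmat \<Rightarrow> ennreal) \<Rightarrow> 'n sqmat \<Rightarrow> ennreal" where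
  "gram_op F A = (\<integral>\<^sup>+x. F (A + outer x x) \<partial>lborel)"

lemma borel_measurable_outer [measurable]:
  fixes f g :: "'a \<Rightarrow> real^'n"
  assumes [measurable]: "f \<in> borel_measurable M" "g \<in> borel_measurable M"
  shows "(\<lambda>x. outer (f x) (g x)) \<in> borel_measurable M"
  by (intro borel_measurable_vecI) simp

lemma borel_measurable_gram_op [measurable]:
  fixes F :: "'n::finite sqmat \<Rightarrow> ennreal"
  assumes [measurable]: "F \<in> borel_measurable borel"
  shows "gram_op F \<in> borel_measurable borel"
  unfolding gram_op_def by measurable

text \<open>\<omega>'\<omega> as a sum over the rows of \<omega>. The index is a set and not a type,
  since the number of rows varies and the rows are split into groups.\<close>

definition rows_gram :: "'i set \<Rightarrow> ('i \<Rightarrow> (real, 'n) vec) \<Rightarrow> 'n::finite sqmat" where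
  "rows_gram I x = (\<Sum>i\<in>I. outer (x i) (x i))"

lemma borel_measurable_rows_gram [measurable]:
  "rows_gram I \<in> borel_measurable (prod_leb I)"
proof -
  have "(\<lambda>x. outer (x i) (x i)) \<in> borel_measurable (PiM I (\<lambda>_. lborel :: (real^'n) measure))" if "i \<in> I" for i
    using measurable_component_singleton[OF that, of "\<lambda>_. lborel :: (real^'n) measure"]
    by (intro borel_measurable_outer) auto
  then show ?thesis unfolding rows_gram_def by (intro borel_measurable_sum) auto
qed

lemma nn_integral_rows_gram:
  fixes F :: "'n::finite sqmat \<Rightarrow> ennreal"
  assumes "finite I" "F \<in> borel_measurable borel"
  shows "(\<integral>\<^sup>+x. F (A + rows_gram I x) \<partial>prod_leb I) = (gram_op ^^ card I) F A"
  using assms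
proof (induction I arbitrary: F)
  case empty
  then show ?case by (simp del: nn_integral_const add: nn_integral_PiM_empty rows_gram_def)
next
  case (insert i I)
  note [measurable] = insert.prems
  have "(\<integral>\<^sup>+x. F (A + rows_gram (insert i I) x) \<partial>prod_leb (insert i I)) =
     (\<integral>\<^sup>+x. (\<integral>\<^sup>+y. F (A + rows_gram (insert i I) (x(i := y))) \<partial>lborel) \<partial>prod_leb I)"
    by (rule lborel_PiM.product_nn_integral_insert) (use insert in auto)
  also have "\<dots> = (\<integral>\<^sup>+x. gram_op F (A + rows_gram I x) \<partial>prod_leb I)"
  proof (intro nn_integral_cong)
    fix x :: "'a \<Rightarrow> real^'n"
    have "rows_gram (insert i I) (x(i := y)) = rows_gram I x + outer y y" for y
    proof -
      have "(\<Sum>k\<in>I. outer ((x(i := y)) k) ((x(i := y)) k)) = (\<Sum>k\<in>I. outer (x k) (x k))"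
        by (rule sum.cong) (use insert in auto)
      then show ?thesis using insert by (simp add: rows_gram_def add.commute)
    qed
    then show "(\<integral>\<^sup>+y. F (A + rows_gram (insert i I) (x(i := y))) \<partial>lborel) = gram_op F (A + rows_gram I x)"
      by (simp add: gram_op_def add.assoc)
  qed
  also have "\<dots> = (gram_op ^^ card I) (gram_op F) A" by (rule insert.IH) simp
  finally show ?case using insert by (simp add: funpow_swap1)
qed

text \<open>Adding rows produces \<open>transpose V ** V\<close>, whereas the inner products of a
  family of vectors, read as the rows of \<open>V\<close>, produce \<open>V ** transpose V\<close>.
  For square matrices transposition exchanges the two.\<close>

lemma lborel_distr_transpose:
  "distr lborel borel transpose = (lborel :: ((real, 'n::finite) vec, 'm::finite) vec measure)"
proof (rule lborel_eqI[symmetric])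
  have [measurable]: "transpose \<in> borel_measurable (borel :: ((real, 'm) vec, 'n) vec measure)"
    by (intro borel_measurable_continuous_onI continuous_intros)
  show "sets (distr lborel borel transpose) = sets borel" by simp
  have in_t: "x \<bullet> transpose y = transpose x \<bullet> y" for x :: "((real, 'n) vec, 'm) vec" and y
    by (simp add: inner_vec_def) (rule sum.swap)
  have tB: "transpose ` (Basis :: ((real, 'm) vec, 'n) vec set) = Basis"
  proof -
    have ax: "transpose (axis i (axis j 1)) = (axis j (axis i 1) :: ((real, 'c::finite) vec, 'd::finite) vec)" for i j
      by (auto simp: vec_eq_iff axis_def)
    show ?thesis by (force simp: Basis_vec_def ax image_iff)
  qed
  fix l u :: "((real, 'n) vec, 'm) vec" assume lu: "\<And>b. b \<in> Basis \<Longrightarrow> l \<bullet> b \<le> u \<bullet> b"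
  have tB': "transpose b \<in> (Basis :: ((real, 'n) vec, 'm) vec set)" if "b \<in> Basis" for b
    using tB that by blast
  have "transpose -` box l u = box (transpose l) (transpose u)"
  proof (rule set_eqI)
    fix x :: "((real, 'm) vec, 'n) vec"
    have "x \<in> box (transpose l) (transpose u) \<longleftrightarrow> (\<forall>b\<in>Basis. l \<bullet> transpose b < transpose x \<bullet> transpose b \<and> transpose x \<bullet> transpose b < u \<bullet> transpose b)"
      by (simp add: box_def in_t)
    also have "\<dots> \<longleftrightarrow> (\<forall>b\<in>transpose ` Basis. l \<bullet> b < transpose x \<bullet> b \<and> transpose x \<bullet> b < u \<bullet> b)"
      by blast
    finally show "x \<in> transpose -` box l u \<longleftrightarrow> x \<in> box (transpose l) (transpose u)"
      by (simp add: tB box_def)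
  qed
  then have "emeasure (distr lborel borel transpose) (box l u) = emeasure lborel (box (transpose l) (transpose u))"
    by (simp add: emeasure_distr)
  also have "\<dots> = ennreal (\<Prod>b\<in>Basis. (transpose u - transpose l) \<bullet> b)"
    by (rule emeasure_lborel_box) (use lu tB' in_t in metis)
  also have "(\<Prod>b\<in>Basis. (transpose u - transpose l) \<bullet> b) = (\<Prod>b\<in>transpose ` (Basis :: ((real, 'm) vec, 'n) vec set). (u - l) \<bullet> b)"
  proof -
    have inj: "inj_on transpose (Basis :: ((real, 'm) vec, 'n) vec set)"
      by (metis inj_onI transpose_transpose)
    show ?thesis by (subst prod.reindex[OF inj]) (simp add: in_t transpose_diff comp_def)
  qed
  finally show "emeasure (distr lborel borel transpose) (box l u) = ennreal (\<Prod>b\<in>Basis. (u - l) \<bullet> b)"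
    by (simp add: tB)
qed

section \<open>Translations and reflections of the measure on symmetric matrices\<close>

lemma lborel_affine_unit: "\<bar>c\<bar> = 1 \<Longrightarrow> distr lborel borel (\<lambda>x. t + c * x) = (lborel :: real measure)"
  using lborel_real_affine[of c t] by (auto simp: density_1)

lemma upper_pairs_UNIV: "upper_pairs UNIV = {(i, j). i \<le> j}"
  by (simp add: upper_pairs_def)

lemma sym_of_upper_borel [measurable]:
  "sym_of_upper \<in> measurable (prod_leb (upper_pairs (UNIV :: 'm::{finite,linorder} set))) borel"
  unfolding upper_pairs_UNIV by (rule sym_of_upper_measurable)

lemma sym_lebesgue_eq: "sym_lebesgue = distr (prod_leb (upper_pairs UNIV)) borel sym_of_upper"
  by (simp add: sym_lebesgue_def upper_pairs_UNIV)

lemma sets_sym_lebesgue [simp, measurable_cong]: "sets sym_lebesgue = sets borel"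
  by (simp add: sym_lebesgue_def)

lemma space_sym_lebesgue [simp]: "space sym_lebesgue = UNIV"
  by (simp add: sym_lebesgue_def)

text \<open>In the coordinates with \<open>i \<le> j\<close> the map is affine in each coordinate
  separately. The case \<open>c = 1\<close> serves the convolution with \<open>outer x x\<close>,
  the case \<open>c = -1\<close> the substitution r -> s - r in the fractional integral.\<close>

lemma sym_lebesgue_affine:
  fixes B :: "'m::{finite,linorder} sqmat"
  assumes c: "\<bar>c\<bar> = 1" and B: "transpose B = B"
  shows "distr sym_lebesgue borel (\<lambda>r. B + c *\<^sub>R r) = sym_lebesgue"
proof -
  let ?I = "upper_pairs (UNIV :: 'm set)"
  let ?P = "real_leb ?I"
  define T where "T x = (\<lambda>p\<in>?I. B $ fst p $ snd p + c * x p)" for x :: "'m \<times> 'm \<Rightarrow> real"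
  have T: "distr ?P ?P T = ?P"
    unfolding T_def using PiM_lborel_coordinatewise[of ?I "\<lambda>p x. B $ fst p $ snd p + c * x" 1]
    by (simp add: lborel_affine_unit[OF c] density_1)
  have [measurable]: "T \<in> measurable ?P ?P"
    unfolding T_def by (intro measurable_restrict) auto
  have TS: "sym_of_upper (T x) = B + c *\<^sub>R sym_of_upper x" for x
    using symmetric_nth[OF B] by (auto simp: sym_of_upper_def T_def vec_eq_iff upper_pairs_def min_def max_def)
  have [measurable]: "(\<lambda>r. B + c *\<^sub>R r) \<in> borel_measurable borel" by simp
  have "distr sym_lebesgue borel (\<lambda>r. B + c *\<^sub>R r) = distr ?P borel (\<lambda>x. B + c *\<^sub>R sym_of_upper x)"
    unfolding sym_lebesgue_eq by (subst distr_distr) (auto simp: comp_def)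
  also have "\<dots> = distr ?P borel (\<lambda>x. sym_of_upper (T x))" by (simp add: TS)
  also have "\<dots> = distr (distr ?P ?P T) borel sym_of_upper"
    by (subst distr_distr) (auto simp: comp_def)
  also have "\<dots> = sym_lebesgue" unfolding T sym_lebesgue_eq ..
  finally show ?thesis .
qed

section \<open>The effect of one further row on a power of the determinant\<close>

lemma pd_cone_add_outer: "A \<in> pd_cone \<Longrightarrow> A + outer x x \<in> pd_cone"
  by (auto simp: pd_cone_def transpose_add matrix_vector_mult_add_rdistrib inner_add_right inner_outer add_pos_nonneg)

text \<open>In the variable \<open>t = y \<bullet> y\<close> this is a Beta integral with parameters
  \<open>CARD('n) / 2\<close> and \<open>e + 1\<close>; the hypothesis on \<open>e\<close> is its
  convergence.\<close>

lemma nn_integral_ball_powr: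
  assumes e: "e > -1"
  shows "(\<integral>\<^sup>+(y::real^'n). ennreal ((1 - y \<bullet> y) powr e) * indicator {y. y \<bullet> y < 1} y \<partial>lborel) =
     ennreal (pi powr (CARD('n) / 2) * Gamma (e + 1) / Gamma (CARD('n) / 2 + e + 1))"
proof -
  define a where "a = real CARD('n) / 2"
  have a: "a > 0" by (simp add: a_def)
  define g where "g t = ennreal ((1 - t) powr e) * indicator {..<1} t" for t :: real
  have [measurable]: "g \<in> borel_measurable borel" unfolding g_def by measurable
  have "(\<integral>\<^sup>+(y::real^'n). ennreal ((1 - y \<bullet> y) powr e) * indicator {y. y \<bullet> y < 1} y \<partial>lborel) = (\<integral>\<^sup>+(y::real^'n). g (y \<bullet> y) \<partial>lborel)"
    by (intro nn_integral_cong) (auto simp: g_def indicator_def)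
  also have "\<dots> = (\<integral>\<^sup>+w. g (\<Sum>i\<in>(UNIV :: 'n set). (w i)\<^sup>2) \<partial>prod_leb UNIV)"
    by (subst nn_integral_lborel_vec) (auto simp: inner_vec_def power2_eq_square)
  also have "\<dots> = (\<integral>\<^sup>+t. g t * ennreal (pi powr a / Gamma a * t powr (a - 1)) * indicator {0<..} t \<partial>lborel)"
    unfolding a_def by (rule nn_integral_PiM_sum_squares) auto
  also have "\<dots> = (\<integral>\<^sup>+t. ennreal (pi powr a / Gamma a * (t powr (a - 1) * (1 - t) powr e) * indicator {0..1} t) \<partial>lborel)"
    using a by (intro nn_integral_cong_AE AE_I[of _ _ "{0, 1}"])
      (auto simp: g_def indicator_def ennreal_mult[symmetric] Gamma_real_pos mult_ac emeasure_lborel_countable)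
  also have "\<dots> = ennreal (pi powr a / Gamma a * Beta a (e + 1))"
  proof -
    have "((\<lambda>t. t powr (a - 1) * (1 - t) powr e) has_integral Beta a (e + 1)) {0..1}"
      using has_integral_Beta_real[of a "e + 1"] a e by simp
    then have "((\<lambda>t. pi powr a / Gamma a * (t powr (a - 1) * (1 - t) powr e)) has_integral pi powr a / Gamma a * Beta a (e + 1)) {0..1}"
      by (rule has_integral_mult_right)
    from nn_integral_has_integral_lebesgue[OF _ this] show ?thesis
      using a by (simp add: ennreal_mult' ennreal_indicator mult_ac Gamma_real_pos)
  qed
  also have "pi powr a / Gamma a * Beta a (e + 1) = pi powr a * Gamma (e + 1) / Gamma (a + e + 1)"
    using a e by (simp add: Beta_def Gamma_real_pos add.assoc less_imp_neq[symmetric])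
  finally show ?thesis by (simp add: a_def)
qed

text \<open>This is \<pi>^{m/2} \<Gamma>_m(\<alpha>) / \<Gamma>_m(\<alpha> + 1/2) for \<alpha> = e +
  d, after cancellation of all but two Gamma factors.\<close>

definition shift_const :: "nat \<Rightarrow> real \<Rightarrow> real" where
  "shift_const m e = pi powr (real m / 2) * Gamma (e + 1) / Gamma (real m / 2 + e + 1)"

text \<open>For \<open>r = h ** transpose h\<close> the substitution \<open>x = h *v y\<close> makes
  the domain a unit ball, and the Jacobian |det h| is the half power by which the exponent grows. If
  \<open>r\<close> is not in the cone, neither is \<open>r - outer x x\<close>.\<close>

lemma nn_integral_pd_diff_outer:
  fixes r :: "'n::finite sqmat"
  assumes e: "e > -1"
  shows "(\<integral>\<^sup>+x. pd_weighted e (\<lambda>_. 1) (r - outer x x) \<partial>lborel) =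
    pd_weighted (e + 1/2) (\<lambda>_. ennreal (shift_const CARD('n) e)) r"
proof (cases "r \<in> pd_cone")
  case False
  then have "r - outer x x \<notin> pd_cone" for x using pd_cone_add_outer[of "r - outer x x" x] by auto
  then show ?thesis using False by (simp add: pd_weighted_def)
next
  case True
  obtain h where h: "r = h ** transpose h" "det h \<noteq> 0" by (rule pd_cone_factor[OF True])
  have dr: "det r = (det h)\<^sup>2" by (simp add: h det_mul det_transpose power2_eq_square)
  have [measurable]: "(\<lambda>x. pd_weighted e (\<lambda>_. 1) (r - outer x x)) \<in> borel_measurable borel"
    by measurable
  have "(\<integral>\<^sup>+x. pd_weighted e (\<lambda>_. 1) (r - outer x x) \<partial>lborel) =
     ennreal \<bar>det h\<bar> * (\<integral>\<^sup>+y. pd_weighted e (\<lambda>_. 1) (r - outer (h *v y) (h *v y)) \<partial>lborel)"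
    by (rule nn_integral_linear_image) (use h in auto)
  also have "\<dots> = ennreal \<bar>det h\<bar> * (\<integral>\<^sup>+(y::real^'n). ennreal (det r powr e) * (ennreal ((1 - y \<bullet> y) powr e) * indicator {y. y \<bullet> y < 1} y) \<partial>lborel)"
  proof -
    have pt: "pd_weighted e (\<lambda>_. 1) (r - outer (h *v y) (h *v y)) = ennreal (det r powr e) * (ennreal ((1 - y \<bullet> y) powr e) * indicator {y. y \<bullet> y < 1} y)" for y
      using pd_cone_diff_outer[OF h(2), of y]
      by (auto simp: pd_weighted_def h(1)[symmetric] dr powr_mult ennreal_mult indicator_def)
    show ?thesis unfolding pt ..
  qed
  also have "\<dots> = ennreal \<bar>det h\<bar> * (ennreal (det r powr e) * ennreal (shift_const CARD('n) e))"
    by (subst nn_integral_cmult) (auto simp: nn_integral_ball_powr[OF e] shift_const_def)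
  also have "\<bar>det h\<bar> = det r powr (1/2)" by (simp add: dr powr_half_sqrt)
  also have "ennreal (det r powr (1/2)) * (ennreal (det r powr e) * ennreal (shift_const CARD('n) e)) = ennreal (shift_const CARD('n) e) * ennreal (det r powr (e + 1/2))"
    by (simp add: powr_add ennreal_mult mult_ac)
  finally show ?thesis using True by (simp add: pd_weighted_def)
qed

text \<open>Fubini and the translation by \<open>outer x x\<close> move the operator from
  \<open>F\<close> to the weight, where \<open>nn_integral_pd_diff_outer\<close> evaluates
  it.\<close>

lemma nn_integral_pd_weighted_gram_op:
  fixes F :: "'n::{finite,linorder} sqmat \<Rightarrow> ennreal"
  assumes e: "e > -1" and [measurable]: "F \<in> borel_measurable borel"
  shows "(\<integral>\<^sup>+r. pd_weighted e (gram_op F) r \<partial>sym_lebesgue) =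
    ennreal (shift_const CARD('n) e) * (\<integral>\<^sup>+r. pd_weighted (e + 1/2) F r \<partial>sym_lebesgue)"
proof -
  let ?P = "real_leb (upper_pairs (UNIV :: 'n set))"
  interpret P: finite_product_sigma_finite "\<lambda>_. lborel :: real measure" "upper_pairs (UNIV :: 'n set)"
    by standard simp
  interpret pair_sigma_finite ?P "lborel :: ((real, 'n) vec) measure" by standard
  have fub: "(\<integral>\<^sup>+r. (\<integral>\<^sup>+x. H r x \<partial>lborel) \<partial>sym_lebesgue) = (\<integral>\<^sup>+x. (\<integral>\<^sup>+r. H r x \<partial>sym_lebesgue) \<partial>lborel)"
    if [measurable]: "case_prod H \<in> borel_measurable (borel \<Otimes>\<^sub>M borel)" for H :: "'n sqmat \<Rightarrow> (real, 'n) vec \<Rightarrow> ennreal"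
  proof -
    have "(\<integral>\<^sup>+r. (\<integral>\<^sup>+x. H r x \<partial>lborel) \<partial>sym_lebesgue) = (\<integral>\<^sup>+p. (\<integral>\<^sup>+x. H (sym_of_upper p) x \<partial>lborel) \<partial>?P)"
      unfolding sym_lebesgue_eq by (subst nn_integral_distr) auto
    also have "\<dots> = (\<integral>\<^sup>+x. (\<integral>\<^sup>+p. H (sym_of_upper p) x \<partial>?P) \<partial>lborel)"
      by (rule Fubini'[symmetric]) measurable
    also have "\<dots> = (\<integral>\<^sup>+x. (\<integral>\<^sup>+r. H r x \<partial>sym_lebesgue) \<partial>lborel)"
      unfolding sym_lebesgue_eq by (subst nn_integral_distr) auto
    finally show ?thesis .
  qed
  define w where "w = pd_weighted e (\<lambda>_ :: 'n sqmat. 1)"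
  have [measurable]: "w \<in> borel_measurable borel" unfolding w_def by measurable
  have "(\<integral>\<^sup>+r. pd_weighted e (gram_op F) r \<partial>sym_lebesgue) = (\<integral>\<^sup>+r. (\<integral>\<^sup>+x. w r * F (r + outer x x) \<partial>lborel) \<partial>sym_lebesgue)"
    by (intro nn_integral_cong) (simp add: nn_integral_cmult, simp add: w_def pd_weighted_def gram_op_def mult.commute)
  also have "\<dots> = (\<integral>\<^sup>+x. (\<integral>\<^sup>+r. w r * F (r + outer x x) \<partial>sym_lebesgue) \<partial>lborel)"
    by (rule fub) measurable
  also have "\<dots> = (\<integral>\<^sup>+x. (\<integral>\<^sup>+r. w (r - outer x x) * F r \<partial>sym_lebesgue) \<partial>lborel)"
  proof (rule nn_integral_cong)
    fix x :: "(real, 'n) vec"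
    have "(\<integral>\<^sup>+r. w (r - outer x x) * F r \<partial>sym_lebesgue) = (\<integral>\<^sup>+r. w (r - outer x x) * F r \<partial>distr sym_lebesgue borel (\<lambda>r. outer x x + 1 *\<^sub>R r))"
      by (subst sym_lebesgue_affine) auto
    also have "\<dots> = (\<integral>\<^sup>+r. w r * F (r + outer x x) \<partial>sym_lebesgue)"
      by (subst nn_integral_distr) (auto simp: add.commute)
    finally show "(\<integral>\<^sup>+r. w r * F (r + outer x x) \<partial>sym_lebesgue) = (\<integral>\<^sup>+r. w (r - outer x x) * F r \<partial>sym_lebesgue)" ..
  qed
  also have "\<dots> = (\<integral>\<^sup>+r. (\<integral>\<^sup>+x. w (r - outer x x) * F r \<partial>lborel) \<partial>sym_lebesgue)"
    by (rule fub[symmetric]) measurable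
  also have "\<dots> = (\<integral>\<^sup>+r. ennreal (shift_const CARD('n) e) * pd_weighted (e + 1/2) F r \<partial>sym_lebesgue)"
  proof (rule nn_integral_cong)
    fix r :: "'n sqmat"
    have "(\<integral>\<^sup>+x. w (r - outer x x) * F r \<partial>lborel) = (\<integral>\<^sup>+x. w (r - outer x x) \<partial>lborel) * F r"
      by (rule nn_integral_multc) measurable
    also have "\<dots> = ennreal (shift_const CARD('n) e) * pd_weighted (e + 1/2) F r"
      unfolding w_def nn_integral_pd_diff_outer[OF e] by (simp add: pd_weighted_def mult_ac)
    finally show "(\<integral>\<^sup>+x. w (r - outer x x) * F r \<partial>lborel) = ennreal (shift_const CARD('n) e) * pd_weighted (e + 1/2) F r" .
  qed
  also have "\<dots> = ennreal (shift_const CARD('n) e) * (\<integral>\<^sup>+r. pd_weighted (e + 1/2) F r \<partial>sym_lebesgue)"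
    by (rule nn_integral_cmult) measurable
  finally show ?thesis .
qed

text \<open>\<pi>^{nm/2} / \<Gamma>_m(n/2), the constant in the density of \<omega>'\<omega> for
  Lebesgue measure on the \<open>n\<close> by \<open>m\<close> matrices.\<close>

definition wishart_const :: "nat \<Rightarrow> nat \<Rightarrow> real" where
  "wishart_const m n = pi powr (real n * real m / 2) /
     (pi powr (real m * (real m - 1) / 4) * (\<Prod>j<m. Gamma ((real n - real j) / 2)))"

lemma wishart_const_pos: "m \<le> n \<Longrightarrow> 0 < wishart_const m n"
  unfolding wishart_const_def by (intro divide_pos_pos mult_pos_pos prod_pos) auto

lemma frame_const_eq: "frame_const m m = wishart_const m m"
proof -
  have "frame_const m m = (\<Prod>i<m. pi powr ((real m - real i) / 2)) / (\<Prod>j<m. Gamma ((real m - real j) / 2))"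
    unfolding frame_const_def prod_dividef[symmetric] by (intro prod.cong) (auto simp: of_nat_diff)
  also have "(\<Prod>i<m. pi powr ((real m - real i) / 2)) = pi powr (\<Sum>i<m. (real m - real i) / 2)"
    by (simp add: powr_sum)
  also have "(\<Sum>i<m. (real m - real i) / 2) = real m * (real m + 1) / 4"
  proof -
    \<comment> \<open>\<open>c\<close> is kept apart from \<open>m\<close>, because the induction
      runs over the length of the sum only.\<close>
    have "(\<Sum>i<m. (c - real i) / 2) = real m * c / 2 - real m * (real m - 1) / 4" for c
      by (induction m) (auto simp: field_simps)
    from this[of "real m"] show ?thesis by (simp add: field_simps)
  qed
  also have "\<dots> = real m * real m / 2 - real m * (real m - 1) / 4" by (simp add: field_simps)
  finally show ?thesis by (simp add: wishart_const_def powr_diff)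
qed

text \<open>Raising \<open>n\<close> by one raises every Gamma argument by 1/2, which amounts to a
  shift of the index \<open>j\<close>; the products telescope and only the two end factors
  differ.\<close>

lemma wishart_const_Suc:
  assumes "m \<le> n" "0 < m"
  shows "wishart_const m (Suc n) = wishart_const m n * shift_const m ((real n - real m - 1) / 2)"
proof -
  have G: "Gamma ((real n - real j) / 2) > 0" if "j < m" for j using that assms by (intro Gamma_real_pos) auto
  have *: "(\<Prod>j<k. Gamma ((real n + 1 - real j) / 2)) * Gamma ((real n + 1 - real k) / 2) =
      (\<Prod>j<k. Gamma ((real n - real j) / 2)) * Gamma ((real n + 1) / 2)" if "k \<le> m" for k
    using that
  proof (induction k)
    case (Suc k)
    have "(\<Prod>j<Suc k. Gamma ((real n + 1 - real j) / 2)) * Gamma ((real n + 1 - real (Suc k)) / 2) =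
       (\<Prod>j<k. Gamma ((real n + 1 - real j) / 2)) * Gamma ((real n + 1 - real k) / 2) * Gamma ((real n - real k) / 2)"
      by (simp add: algebra_simps)
    then show ?case using Suc by (simp add: mult_ac)
  qed simp
  define X where "X = (\<Prod>j<m. Gamma ((real n + 1 - real j) / 2))"
  define Y where "Y = (\<Prod>j<m. Gamma ((real n - real j) / 2))"
  have XY: "X * Gamma ((real n + 1 - real m) / 2) = Y * Gamma ((real n + 1) / 2)"
    using *[of m] by (simp add: X_def Y_def)
  have pos: "Gamma ((real n + 1 - real m) / 2) > 0" "Gamma ((real n + 1) / 2) > 0" "Y > 0"
    using assms G by (auto simp: Y_def intro!: prod_pos)
  have "shift_const m ((real n - real m - 1) / 2) = pi powr (real m / 2) * Gamma ((real n + 1 - real m) / 2) / Gamma ((real n + 1) / 2)"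
    by (simp add: shift_const_def field_simps)
  moreover have "pi powr (real (Suc n) * real m / 2) = pi powr (real n * real m / 2) * pi powr (real m / 2)"
    by (simp add: powr_add[symmetric] field_simps)
  moreover have "Gamma ((real n + 1 - real m) / 2) / (Y * Gamma ((real n + 1) / 2)) = 1 / X"
    using XY pos by (simp add: XY[symmetric])
  moreover have "c1 * c2 / (d * X) = c1 / (d * Y) * (c2 * g1 / g2)" if "g1 / (Y * g2) = 1 / X" for c1 c2 d g1 g2 :: real
  proof -
    have "c1 * c2 / (d * X) = (c1 * c2 / d) * (1 / X)" by simp
    also have "\<dots> = (c1 * c2 / d) * (g1 / (Y * g2))" by (simp only: that)
    also have "\<dots> = c1 / (d * Y) * (c2 * g1 / g2)" by (simp add: mult_ac)
    finally show ?thesis .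
  qed
  ultimately have e: "pi powr (real (Suc n) * real m / 2) / (pi powr (real m * (real m - 1) / 4) * X) =
      pi powr (real n * real m / 2) / (pi powr (real m * (real m - 1) / 4) * Y) * shift_const m ((real n - real m - 1) / 2)"
    by presburger
  have Suc: "real (Suc n) = real n + 1" by simp
  show ?thesis
    using e unfolding wishart_const_def X_def Y_def Suc .
qed

lemma gram_op_funpow_base:
  fixes F :: "'n::{finite,linorder} sqmat \<Rightarrow> ennreal"
  assumes [measurable]: "F \<in> borel_measurable borel"
  shows "(gram_op ^^ CARD('n)) F 0 = ennreal (wishart_const CARD('n) CARD('n)) * (\<integral>\<^sup>+r. pd_weighted (- 1 / 2) F r \<partial>sym_lebesgue)"
proof -
  let ?V = "lborel :: (((real, 'n) vec, 'n) vec) measure"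
  have vl[measurable]: "vec_lambda \<in> measurable (prod_leb UNIV) (borel :: (((real, 'n) vec, 'n) vec) measure)"
    by (rule borel_measurable_vecI) simp
  have mm[measurable]: "(\<lambda>V. F (transpose V ** V)) \<in> borel_measurable borel" "(\<lambda>V. F (V ** transpose V)) \<in> borel_measurable borel"
    by (auto intro!: measurable_compose[OF borel_measurable_continuous_onI assms] continuous_intros)
  have tm[measurable]: "transpose \<in> borel_measurable (borel :: (((real, 'n) vec, 'n) vec) measure)"
    by (intro borel_measurable_continuous_onI continuous_intros)
  have "(gram_op ^^ CARD('n)) F 0 = (\<integral>\<^sup>+x. F (rows_gram UNIV x) \<partial>prod_leb (UNIV :: 'n set))"
    using nn_integral_rows_gram[of "UNIV :: 'n set" F 0] by simp
  also have "\<dots> = (\<integral>\<^sup>+x. F (transpose (vec_lambda x) ** vec_lambda x) \<partial>PiM (UNIV :: 'n set) (\<lambda>_. lborel :: ((real, 'n) vec) measure))"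
    by (intro nn_integral_cong arg_cong[where f = F])
       (simp add: rows_gram_def vec_eq_iff matrix_matrix_mult_def sum_component)
  also have "\<dots> = (\<integral>\<^sup>+V. F (transpose V ** V) \<partial>?V)"
    by (rule nn_integral_lborel_vec[of "\<lambda>V. F (transpose V ** V)", symmetric]) (rule mm)
  also have "\<dots> = (\<integral>\<^sup>+V. F (transpose V ** V) \<partial>distr ?V borel transpose)"
    by (simp only: lborel_distr_transpose)
  also have "\<dots> = (\<integral>\<^sup>+V. F (V ** transpose V) \<partial>?V)"
    by (subst nn_integral_distr) (auto intro: mm)
  also have "\<dots> = (\<integral>\<^sup>+v. F (vec_lambda v ** transpose (vec_lambda v)) \<partial>PiM (UNIV :: 'n set) (\<lambda>_. lborel :: ((real, 'n) vec) measure))"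
    by (rule nn_integral_lborel_vec[of "\<lambda>V. F (V ** transpose V)"]) (rule mm)
  also have "\<dots> = (\<integral>\<^sup>+v. F (sub_mat UNIV (gram v)) \<partial>PiM (UNIV :: 'n set) (\<lambda>_. lborel :: ((real, 'n) vec) measure))"
    by (intro nn_integral_cong arg_cong[where f = F])
       (simp add: vec_eq_iff matrix_matrix_mult_def inner_vec_def)
  also have "\<dots> = ennreal (frame_const CARD('n) CARD('n)) * (\<integral>\<^sup>+x. pd_weighted (- 1 / 2) F (sym_of_upper x) \<partial>prod_leb (upper_pairs UNIV))"
    by (subst nn_integral_sub_gram) simp_all
  also have "(\<integral>\<^sup>+x. pd_weighted (- 1 / 2) F (sym_of_upper x) \<partial>prod_leb (upper_pairs UNIV)) = (\<integral>\<^sup>+r. pd_weighted (- 1 / 2) F r \<partial>sym_lebesgue)"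
    unfolding sym_lebesgue_eq by (subst nn_integral_distr) auto
  finally show ?thesis by (simp add: frame_const_eq)
qed

lemma gram_op_funpow_eq:
  fixes F :: "'n::{finite,linorder} sqmat \<Rightarrow> ennreal"
  assumes "CARD('n) \<le> n" "F \<in> borel_measurable borel"
  shows "(gram_op ^^ n) F 0 = ennreal (wishart_const CARD('n) n) *
    (\<integral>\<^sup>+r. pd_weighted ((real n - real CARD('n) - 1) / 2) F r \<partial>sym_lebesgue)"
  using assms
proof (induction n arbitrary: F rule: dec_induct)
  case base
  then show ?case using gram_op_funpow_base by simp
next
  case (step n)
  let ?e = "(real n - real CARD('n) - 1) / 2"
  \<comment> \<open>The convergence of the Beta integral. For \<open>n \<ge> m\<close> the exponent
    is at least -1/2.\<close>
  have e: "?e > -1" using step(1) by simp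
  have e2: "?e + 1/2 = (real (Suc n) - real CARD('n) - 1) / 2" by (simp add: field_simps)
  have "(gram_op ^^ Suc n) F 0 = (gram_op ^^ n) (gram_op F) 0" by (simp add: funpow_swap1)
  also have "\<dots> = ennreal (wishart_const CARD('n) n) * (\<integral>\<^sup>+r. pd_weighted ?e (gram_op F) r \<partial>sym_lebesgue)"
    by (rule step.IH) (use step in measurable)
  also have "\<dots> = ennreal (wishart_const CARD('n) n * shift_const CARD('n) ?e) * (\<integral>\<^sup>+r. pd_weighted (?e + 1/2) F r \<partial>sym_lebesgue)"
    using wishart_const_pos[OF step(1)]
    by (subst nn_integral_pd_weighted_gram_op[OF e step.prems]) (simp add: ennreal_mult' mult.assoc)
  finally show ?case unfolding e2 by (simp add: wishart_const_Suc[OF step(1)])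
qed

text \<open>As an equality of measures the density formula carries over to Bochner integrals of
  complex functions without an extra integrability argument.\<close>

lemma distr_rows_gram:
  assumes "finite I" "CARD('n::{finite,linorder}) \<le> card I"
  shows "distr (prod_leb I) borel (rows_gram I) =
    density (sym_lebesgue :: 'n sqmat measure)
      (\<lambda>r. ennreal (if r \<in> pd_cone then wishart_const CARD('n) (card I) * det r powr ((real (card I) - real CARD('n) - 1) / 2) else 0))"
    (is "?D = density _ ?w")
proof (rule measure_eqI)
  show "sets ?D = sets (density sym_lebesgue ?w)" by simp
  have [measurable]: "(\<lambda>r::'n sqmat. if r \<in> pd_cone then wishart_const CARD('n) (card I) * det r powr ((real (card I) - real CARD('n) - 1) / 2) else 0) \<in> borel_measurable borel"
    by (intro measurable_If) (auto simp: pd_cone_borel)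
  fix A assume "A \<in> sets ?D"
  then have A[measurable]: "A \<in> sets (borel :: 'n sqmat measure)" by simp
  have "emeasure ?D A = (\<integral>\<^sup>+x. indicator A (0 + rows_gram I x) \<partial>prod_leb I)"
  proof -
    have "emeasure ?D A = (\<integral>\<^sup>+r. indicator A r \<partial>?D)" by simp
    also have "\<dots> = (\<integral>\<^sup>+x. indicator A (rows_gram I x) \<partial>prod_leb I)"
      by (rule nn_integral_distr) auto
    finally show ?thesis by simp
  qed
  also have "\<dots> = (gram_op ^^ card I) (indicator A) 0"
    by (rule nn_integral_rows_gram) (use assms in auto)
  also have "\<dots> = ennreal (wishart_const CARD('n) (card I)) * (\<integral>\<^sup>+r. pd_weighted ((real (card I) - real CARD('n) - 1) / 2) (indicator A) r \<partial>sym_lebesgue)"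
    by (rule gram_op_funpow_eq) (use assms in auto)
  also have "\<dots> = (\<integral>\<^sup>+r. ?w r * indicator A r \<partial>sym_lebesgue)"
    using wishart_const_pos[OF assms(2)]
    by (subst nn_integral_cmult[symmetric]) (auto intro!: nn_integral_cong simp: pd_weighted_def ennreal_mult indicator_def)
  also have "\<dots> = emeasure (density sym_lebesgue ?w) A" by (simp add: emeasure_density)
  finally show "emeasure ?D A = emeasure (density sym_lebesgue ?w) A" .
qed

lemma integral_rows_gram:
  fixes g :: "'n::{finite,linorder} sqmat \<Rightarrow> complex"
  assumes "finite I" "CARD('n) \<le> card I" and [measurable]: "g \<in> borel_measurable borel"
  shows "(LINT x|prod_leb I. g (rows_gram I x)) =
    (LINT r|sym_lebesgue. (if r \<in> pd_cone then wishart_const CARD('n) (card I) * det r powr ((real (card I) - real CARD('n) - 1) / 2) else 0) *\<^sub>R g r)"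
proof -
  have [measurable]: "(\<lambda>r::'n sqmat. if r \<in> pd_cone then wishart_const CARD('n) (card I) * det r powr ((real (card I) - real CARD('n) - 1) / 2) else 0) \<in> borel_measurable borel"
    by (intro measurable_If) (auto simp: pd_cone_borel)
  have "(LINT x|prod_leb I. g (rows_gram I x)) = (LINT r|distr (prod_leb I) borel (rows_gram I). g r)"
    by (subst integral_distr) auto
  also have "\<dots> = (LINT r|sym_lebesgue. (if r \<in> pd_cone then wishart_const CARD('n) (card I) * det r powr ((real (card I) - real CARD('n) - 1) / 2) else 0) *\<^sub>R g r)"
    unfolding distr_rows_gram[OF assms(1,2)]
    by (rule integral_density) (use wishart_const_pos[OF assms(2)] in auto)
  finally show ?thesis .
qed

section \<open>Iterated partial derivatives of compactly supported functions\<close>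

lemma sym_unit_sym_mats: "sym_unit i j \<in> sym_mats"
  by (auto simp: sym_mats_def sym_unit_def vec_eq_iff)

lemma sym_mats_add: "a \<in> sym_mats \<Longrightarrow> b \<in> sym_mats \<Longrightarrow> a + b \<in> sym_mats"
  by (simp add: sym_mats_def transpose_add)

lemma sym_mats_scaleR: "a \<in> sym_mats \<Longrightarrow> c *\<^sub>R a \<in> sym_mats"
  by (simp add: sym_mats_def transpose_scaleR)

lemma sym_mats_add_unit: "r \<in> sym_mats \<Longrightarrow> r + t *\<^sub>R sym_unit i j \<in> sym_mats"
  by (intro sym_mats_add sym_mats_scaleR sym_unit_sym_mats)

lemma sym_mats_sum: "(\<And>p. p \<in> P \<Longrightarrow> f p \<in> sym_mats) \<Longrightarrow> sum f P \<in> sym_mats"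
  by (induction P rule: infinite_finite_induct) (auto simp: sym_mats_add, auto simp: sym_mats_def vec_eq_iff)

lemma pd_cone_subset_sym_mats: "pd_cone \<subseteq> sym_mats"
  by (auto simp: pd_cone_def sym_mats_def)

lemma sym_partials_simps [simp]:
  "sym_partials [] f = f"
  "sym_partials ((i, j) # ps) f = sym_partial i j (sym_partials ps f)"
  by (simp_all add: sym_partials_def)

lemma sym_partials_append: "sym_partials (ps @ qs) f = sym_partials ps (sym_partials qs f)"
  by (simp add: sym_partials_def)

lemma eventually_line_in:
  fixes r e :: "'a::real_normed_vector"
  assumes "open U" "r \<in> U"
  shows "\<forall>\<^sub>F t in nhds (0::real). r + t *\<^sub>R e \<in> U"
proof -
  have "open ((\<lambda>t. r + t *\<^sub>R e) -` U)"
    by (intro open_vimage assms continuous_intros)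
  then show ?thesis
    using assms(2) by (intro eventually_nhds[THEN iffD2] exI[of _ "(\<lambda>t. r + t *\<^sub>R e) -` U"]) auto
qed

text \<open>Derivatives are taken in symmetric directions only, so at a symmetric point the iterated
  ones depend only on the values at nearby symmetric matrices.\<close>

lemma sym_partials_cong_open:
  assumes U: "open U" and eq: "\<And>r. r \<in> sym_mats \<inter> U \<Longrightarrow> f r = g r" and r: "r \<in> sym_mats \<inter> U"
  shows "sym_partials ps f r = sym_partials ps g r"
  using r
proof (induction ps arbitrary: r)
  case Nil
  then show ?case using eq by simp
next
  case (Cons p ps)
  obtain i j where p: "p = (i, j)" by force
  have "\<forall>\<^sub>F t in nhds 0. r + t *\<^sub>R sym_unit i j \<in> U"
    using Cons.prems U by (intro eventually_line_in) auto
  then have "\<forall>\<^sub>F t in nhds 0. sym_partials ps f (r + t *\<^sub>R sym_unit i j) = sym_partials ps g (r + t *\<^sub>R sym_unit i j)"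
  proof eventually_elim
    case (elim t)
    show ?case by (rule Cons.IH) (use elim Cons.prems sym_mats_add_unit in auto)
  qed
  then show ?case
    unfolding p sym_partials_simps sym_partial_def
    by (intro vector_derivative_cong_eq) (auto elim: eventually_mono)
qed

lemma sym_partials_zero: "sym_partials ps (\<lambda>_. 0) = (\<lambda>_. 0)"
  by (induction ps) (auto simp: sym_partial_def fun_eq_iff)

lemma differentiable_cong_nhds:
  assumes "\<forall>\<^sub>F t in nhds x. f t = g t" "f differentiable (at x)"
  shows "g differentiable (at x)"
proof -
  obtain D where D: "(f has_derivative D) (at x)" using assms(2) by (auto simp: differentiable_def)
  have "(g has_derivative D) (at x)"
  proof (rule has_derivative_transform_eventually[OF D])
    show "\<forall>\<^sub>F x' in at x. f x' = g x'"
      using assms(1) by (auto simp: eventually_at_filter elim: eventually_mono)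
    show "f x = g x" using assms(1) by (rule eventually_nhds_x_imp_x)
  qed simp
  then show ?thesis by (auto simp: differentiable_def)
qed

text \<open>Smoothness is required at all symmetric matrices: the points s - \<omega>'\<omega> do
  not stay in the cone, and integration by parts must not produce boundary terms. Values at matrices
  that are not symmetric remain arbitrary.\<close>

definition smooth_compact :: "('m::finite sqmat \<Rightarrow> complex) \<Rightarrow> bool" where
  "smooth_compact f \<longleftrightarrow>
     (\<forall>ps. continuous_on sym_mats (sym_partials ps f) \<and>
        (\<forall>r\<in>sym_mats. \<forall>i j. (\<lambda>t::real. sym_partials ps f (r + t *\<^sub>R sym_unit i j)) differentiable (at 0))) \<and>
     (\<exists>K. compact K \<and> K \<subseteq> pd_cone \<and> (\<forall>r\<in>sym_mats - K. f r = 0))"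

definition cone_ext :: "('m::finite sqmat \<Rightarrow> complex) \<Rightarrow> 'm sqmat \<Rightarrow> complex" where
  "cone_ext f r = (if r \<in> pd_cone then f r else 0)"

text \<open>The cone and the complement of \<open>K\<close> are relatively open and cover the
  symmetric matrices; on the first the extension is \<open>f\<close>, on the second it is
  zero.\<close>

lemma smooth_compact_cone_ext:
  fixes f :: "'m::finite sqmat \<Rightarrow> complex"
  assumes "f \<in> test_functions"
  shows "smooth_compact (cone_ext f)"
proof -
  obtain K where K: "compact K" "K \<subseteq> pd_cone" "\<And>r. r \<in> pd_cone - K \<Longrightarrow> f r = 0"
    and f: "smooth_on_cone f" using assms by (auto simp: test_functions_def)
  obtain U :: "'m sqmat set" where U: "open U" "pd_cone = sym_mats \<inter> U" by (rule pd_cone_open_Int)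
  have K': "open (- K)" using K(1) compact_imp_closed by auto
  have 1: "sym_partials ps (cone_ext f) r = sym_partials ps f r" if "r \<in> pd_cone" for ps r
    by (rule sym_partials_cong_open[OF U(1)]) (use U that in \<open>auto simp: cone_ext_def\<close>)
  have z: "cone_ext f r = 0" if "r \<in> sym_mats - K" for r
    using that K by (auto simp: cone_ext_def)
  have 2: "sym_partials ps (cone_ext f) r = 0" if "r \<in> sym_mats - K" for ps r
    using sym_partials_cong_open[OF K', of "cone_ext f" "\<lambda>_. 0" r ps] that z by (auto simp: sym_partials_zero)
  have un: "sym_mats = pd_cone \<union> (sym_mats - K)" using K pd_cone_subset_sym_mats by auto
  have "continuous_on sym_mats (sym_partials ps (cone_ext f))" for ps
  proof -
    have "continuous_on (pd_cone \<union> (sym_mats - K)) (sym_partials ps (cone_ext f))"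
    proof (rule continuous_on_Un_local_open)
      show "openin (top_of_set (pd_cone \<union> (sym_mats - K))) pd_cone"
        unfolding un[symmetric] using U by (auto simp: openin_open)
      show "openin (top_of_set (pd_cone \<union> (sym_mats - K))) (sym_mats - K)"
        unfolding un[symmetric] using K' by (auto simp: openin_open)
      show "continuous_on pd_cone (sym_partials ps (cone_ext f))"
        by (rule continuous_on_eq[of _ "sym_partials ps f"]) (use f 1 in \<open>auto simp: smooth_on_cone_def\<close>)
      show "continuous_on (sym_mats - K) (sym_partials ps (cone_ext f))"
        by (rule continuous_on_eq[of _ "\<lambda>_. 0"]) (use 2 in auto)
    qed
    then show ?thesis using un by simp
  qed
  moreover have "(\<lambda>t::real. sym_partials ps (cone_ext f) (r + t *\<^sub>R sym_unit i j)) differentiable (at 0)"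
    if r: "r \<in> sym_mats" for ps r i j
  proof (cases "r \<in> pd_cone")
    case True
    have "\<forall>\<^sub>F t in nhds 0. r + t *\<^sub>R sym_unit i j \<in> U"
      using True U by (intro eventually_line_in) auto
    then have "\<forall>\<^sub>F t in nhds 0. sym_partials ps f (r + t *\<^sub>R sym_unit i j) = sym_partials ps (cone_ext f) (r + t *\<^sub>R sym_unit i j)"
      by eventually_elim (metis 1 IntI U(2) r sym_mats_add_unit)
    then show ?thesis
      by (rule differentiable_cong_nhds) (use f True in \<open>auto simp: smooth_on_cone_def\<close>)
  next
    case False
    then have "r \<in> - K" using K by auto
    then have "\<forall>\<^sub>F t in nhds 0. r + t *\<^sub>R sym_unit i j \<in> - K"
      by (intro eventually_line_in K')
    then have "\<forall>\<^sub>F t in nhds 0. 0 = sym_partials ps (cone_ext f) (r + t *\<^sub>R sym_unit i j)"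
      by eventually_elim (metis 2 ComplD DiffI r sym_mats_add_unit)
    then show ?thesis
      by (rule differentiable_cong_nhds) auto
  qed
  ultimately show ?thesis unfolding smooth_compact_def
    by (intro conjI allI ballI exI[of _ K] K z)
qed

lemma smooth_compact_sym_partials:
  assumes "smooth_compact f" shows "smooth_compact (sym_partials ps f)"
proof -
  obtain K where K: "compact K" "K \<subseteq> pd_cone" "\<And>r. r \<in> sym_mats - K \<Longrightarrow> f r = 0"
    using assms by (auto simp: smooth_compact_def)
  have K': "open (- K)" using K(1) compact_imp_closed by auto
  have "sym_partials ps f r = 0" if "r \<in> sym_mats - K" for r
    using sym_partials_cong_open[OF K', of f "\<lambda>_. 0" r ps] that K by (auto simp: sym_partials_zero)
  then show ?thesis
    using assms K unfolding smooth_compact_def sym_partials_append[symmetric] by blast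
qed

lemma smooth_compact_sym_partial: "smooth_compact f \<Longrightarrow> smooth_compact (sym_partial i j f)"
  using smooth_compact_sym_partials[of f "[(i, j)]"] by simp

lemma smooth_compact_continuous: "smooth_compact f \<Longrightarrow> continuous_on sym_mats f"
  by (metis smooth_compact_def sym_partials_simps(1))

lemma smooth_compact_has_vector_derivative:
  assumes f: "smooth_compact f" and r: "r \<in> sym_mats"
  shows "((\<lambda>t. f (r + t *\<^sub>R sym_unit i j)) has_vector_derivative sym_partial i j f (r + t *\<^sub>R sym_unit i j)) (at t)"
proof -
  have "(\<lambda>s. f ((r + t *\<^sub>R sym_unit i j) + s *\<^sub>R sym_unit i j)) differentiable (at 0)"
    using f sym_mats_add_unit[OF r] unfolding smooth_compact_def by (metis sym_partials_simps(1))
  then have "((\<lambda>s. f ((r + t *\<^sub>R sym_unit i j) + s *\<^sub>R sym_unit i j)) has_vector_derivative sym_partial i j f (r + t *\<^sub>R sym_unit i j)) (at (t - t))"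
    by (simp add: sym_partial_def vector_derivative_works)
  then have "((\<lambda>s. f ((r + t *\<^sub>R sym_unit i j) + s *\<^sub>R sym_unit i j)) \<circ> (\<lambda>s. s - t) has_vector_derivative 1 *\<^sub>R sym_partial i j f (r + t *\<^sub>R sym_unit i j)) (at t)"
    by (intro vector_diff_chain_at) (auto intro!: derivative_eq_intros simp: has_vector_derivative_def)
  then show ?thesis by (simp add: comp_def algebra_simps)
qed

lemma sym_partials_linear:
  assumes "smooth_compact f" "smooth_compact g" "r \<in> sym_mats"
  shows "sym_partials ps (\<lambda>r. c * f r + d * g r) r = c * sym_partials ps f r + d * sym_partials ps g r"
  using assms(3)
proof (induction ps arbitrary: r)
  case (Cons p ps)
  obtain i j where p: "p = (i, j)" by force
  have D: "((\<lambda>t. sym_partials ps h (r + t *\<^sub>R sym_unit i j)) has_vector_derivative sym_partials (p # ps) h r) (at 0)"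
    if "smooth_compact h" for h
    using smooth_compact_has_vector_derivative[OF smooth_compact_sym_partials[OF that] Cons.prems, of ps i j 0]
    by (simp add: p)
  have "sym_partials ps (\<lambda>r. c * f r + d * g r) (r + t *\<^sub>R sym_unit i j) =
      c * sym_partials ps f (r + t *\<^sub>R sym_unit i j) + d * sym_partials ps g (r + t *\<^sub>R sym_unit i j)" for t
    by (rule Cons.IH) (rule sym_mats_add_unit[OF Cons.prems])
  then have "((\<lambda>t. sym_partials ps (\<lambda>r. c * f r + d * g r) (r + t *\<^sub>R sym_unit i j)) has_vector_derivative
      c * sym_partials (p # ps) f r + d * sym_partials (p # ps) g r) (at 0)"
    using D[OF assms(1)] D[OF assms(2)] by (auto intro!: derivative_eq_intros)
  then show ?case unfolding p sym_partials_simps(2) sym_partial_def[of i j "sym_partials ps (\<lambda>r. c * f r + d * g r)"]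
    by (rule vector_derivative_at)
qed simp

lemma smooth_compact_linear:
  assumes f: "smooth_compact f" and g: "smooth_compact g"
  shows "smooth_compact (\<lambda>r. c * f r + d * g r)"
proof -
  obtain K where K: "compact K" "K \<subseteq> pd_cone" "\<And>r. r \<in> sym_mats - K \<Longrightarrow> f r = 0"
    using f by (auto simp: smooth_compact_def)
  obtain L where L: "compact L" "L \<subseteq> pd_cone" "\<And>r. r \<in> sym_mats - L \<Longrightarrow> g r = 0"
    using g by (auto simp: smooth_compact_def)
  have "continuous_on sym_mats (sym_partials ps (\<lambda>r. c * f r + d * g r))" for ps
  proof -
    have "continuous_on sym_mats (\<lambda>r. c * sym_partials ps f r + d * sym_partials ps g r)"
      using f g unfolding smooth_compact_def by (intro continuous_intros) auto
    then show ?thesis by (simp add: sym_partials_linear[OF f g] cong: continuous_on_cong)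
  qed
  moreover have "(\<lambda>t::real. sym_partials ps (\<lambda>r. c * f r + d * g r) (r + t *\<^sub>R sym_unit i j)) differentiable (at 0)"
    if r: "r \<in> sym_mats" for ps r i j
  proof -
    have "(\<lambda>t::real. c * sym_partials ps f (r + t *\<^sub>R sym_unit i j) + d * sym_partials ps g (r + t *\<^sub>R sym_unit i j)) differentiable (at 0)"
      using f g r unfolding smooth_compact_def
      by (intro differentiable_add differentiable_mult differentiable_const) auto
    then show ?thesis by (simp add: sym_partials_linear[OF f g] sym_mats_add_unit r)
  qed
  moreover have "compact (K \<union> L)" "K \<union> L \<subseteq> pd_cone" "\<And>r. r \<in> sym_mats - (K \<union> L) \<Longrightarrow> c * f r + d * g r = 0"
    using K L by auto
  ultimately show ?thesis unfolding smooth_compact_def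
    by (intro conjI allI ballI exI[of _ "K \<union> L"])
qed

lemma smooth_compact_zero: "smooth_compact (\<lambda>_. 0)"
  unfolding smooth_compact_def by (auto simp: sym_partials_zero intro!: exI[of _ "{}"])

lemma smooth_compact_sum:
  assumes "\<And>p. p \<in> P \<Longrightarrow> smooth_compact (f p)"
  shows "smooth_compact (\<lambda>r. \<Sum>p\<in>P. c p * f p r)"
  using assms
proof (induction P rule: infinite_finite_induct)
  case (insert p P)
  then show ?case using smooth_compact_linear[of "f p" "\<lambda>r. \<Sum>p\<in>P. c p * f p r" "c p" 1] by simp
qed (auto simp: smooth_compact_zero)

text \<open>Given are only partial derivatives in the directions \<open>sym_unit\<close>, so
  differentiability along a curve has to come from their continuity. The directions are added one at
  a time.\<close>

lemma smooth_compact_chain_rule: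
  assumes f: "smooth_compact f" and "finite P" and "r \<in> sym_mats"
    and "\<And>p. p \<in> P \<Longrightarrow> (c p has_real_derivative c' p) (at t0)"
  shows "((\<lambda>t. f (r + (\<Sum>p\<in>P. c p t *\<^sub>R sym_unit (fst p) (snd p)))) has_vector_derivative
     (\<Sum>p\<in>P. c' p *\<^sub>R sym_partial (fst p) (snd p) f (r + (\<Sum>p\<in>P. c p t0 *\<^sub>R sym_unit (fst p) (snd p))))) (at t0)"
  using assms(2-4)
proof (induction P arbitrary: r rule: finite_induct)
  case empty
  then show ?case by simp
next
  case (insert p P)
  define E where "E = sym_unit (fst p) (snd p)"
  define S where "S t = (\<Sum>p\<in>P. c p t *\<^sub>R sym_unit (fst p) (snd p))" for t
  define g where "g = sym_partial (fst p) (snd p) f"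
  define D where "D = (\<Sum>q\<in>P. c' q *\<^sub>R sym_partial (fst q) (snd q) f (r + c p t0 *\<^sub>R E + S t0))"
  have Ssym: "S t \<in> sym_mats" for t
    unfolding S_def by (intro sym_mats_sum sym_mats_scaleR sym_unit_sym_mats)
  have Esym: "E \<in> sym_mats" by (simp add: E_def sym_unit_sym_mats)
  have gc: "continuous_on sym_mats g"
    unfolding g_def by (intro smooth_compact_continuous smooth_compact_sym_partial f)
  have cc: "(c q \<longlongrightarrow> c q t0) (at t0)" if "q \<in> insert p P" for q
    using insert.prems(2)[OF that] DERIV_isCont isCont_def by blast
  have Sc: "(S \<longlongrightarrow> S t0) (at t0)"
    unfolding S_def by (intro tendsto_intros cc) auto
  \<comment> \<open>Total derivative in two variables: \<open>t\<close> runs through the old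
    directions along \<open>S\<close>, where the induction hypothesis gives the derivative, and
    \<open>a\<close> moves in the new direction, where the partial derivative is continuous.\<close>
  have "((\<lambda>(t, a). f (r + S t + a *\<^sub>R E)) has_derivative
      (\<lambda>(dt, da). dt *\<^sub>R D + blinfun_apply (blinfun_scaleR_left (g (r + S t0 + c p t0 *\<^sub>R E))) da)) (at (t0, c p t0) within UNIV \<times> UNIV)"
  proof (rule has_derivative_partialsI)
    have "((\<lambda>t. f (r + c p t0 *\<^sub>R E + S t)) has_vector_derivative D) (at t0)"
      unfolding D_def S_def using insert.prems Esym
      by (intro insert.IH) (auto intro!: sym_mats_add sym_mats_scaleR)
    then show "((\<lambda>t. f (r + S t + c p t0 *\<^sub>R E)) has_derivative (\<lambda>h. h *\<^sub>R D)) (at t0)"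
      by (simp add: has_vector_derivative_def add_ac)
  next
    fix t a
    show "((\<lambda>a. f (r + S t + a *\<^sub>R E)) has_derivative blinfun_apply (blinfun_scaleR_left (g (r + S t + a *\<^sub>R E)))) (at a)"
      using smooth_compact_has_vector_derivative[OF f, of "r + S t" "fst p" "snd p" a] insert.prems Ssym
      by (simp add: E_def[symmetric] g_def[symmetric] has_vector_derivative_def sym_mats_add)
  next
    have "((\<lambda>x. g (r + S (fst x) + snd x *\<^sub>R E)) \<longlongrightarrow> g (r + S t0 + c p t0 *\<^sub>R E)) (at (t0, c p t0))"
    proof (rule continuous_on_tendsto_compose[OF gc])
      have "(fst \<longlongrightarrow> t0) (at (t0, c p t0))" by (auto intro!: tendsto_eq_intros)
      then have "((\<lambda>x. S (fst x)) \<longlongrightarrow> S t0) (at (t0, c p t0))"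
        using Sc by (intro isCont_tendsto_compose[of t0 S]) (auto simp: isCont_def)
      then show "((\<lambda>x. r + S (fst x) + snd x *\<^sub>R E) \<longlongrightarrow> r + S t0 + c p t0 *\<^sub>R E) (at (t0, c p t0))"
        by (intro tendsto_intros) (auto intro!: tendsto_eq_intros)
    qed (use insert.prems Ssym Esym in \<open>auto intro!: sym_mats_add sym_mats_scaleR always_eventually\<close>)
    then show "continuous (at (t0, c p t0) within UNIV \<times> UNIV) (\<lambda>(t, a). blinfun_scaleR_left (g (r + S t + a *\<^sub>R E)))"
      unfolding continuous_within case_prod_beta
      by (simp, intro bounded_linear.tendsto[OF bounded_linear_blinfun_scaleR_left])
  qed auto
  then have H: "((\<lambda>(t, a). f (r + S t + a *\<^sub>R E)) has_derivative
      (\<lambda>(dt, da). dt *\<^sub>R D + da *\<^sub>R g (r + S t0 + c p t0 *\<^sub>R E))) (at (t0, c p t0))"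
    by simp
  have "((\<lambda>t. (t, c p t)) has_derivative (\<lambda>h. (h, h * c' p))) (at t0)"
    using insert.prems(2)[of p] by (auto intro!: derivative_eq_intros simp: has_field_derivative_def mult.commute)
  from has_derivative_compose[OF this H]
  have 1: "((\<lambda>t. f (r + S t + c p t *\<^sub>R E)) has_vector_derivative c' p *\<^sub>R g (r + S t0 + c p t0 *\<^sub>R E) + D) (at t0)"
    by (simp add: has_vector_derivative_def scaleR_add_right add.commute)
  have 2: "r + (\<Sum>q\<in>insert p P. c q t *\<^sub>R sym_unit (fst q) (snd q)) = r + S t + c p t *\<^sub>R E" for t
    using insert by (simp add: S_def E_def)
  have 3: "r + c p t0 *\<^sub>R E + S t0 = r + S t0 + c p t0 *\<^sub>R E" by simp
  show ?case
    unfolding 2 unfolding sum.insert[OF insert(1,2)] using 1 unfolding D_def g_def 3 .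
qed

text \<open>Schwarz's theorem. An increment of \<open>f\<close> along \<open>F\<close> is the
  integral of \<open>fq\<close>; differentiating it in direction \<open>E\<close> under the integral
  sign and then in the upper limit \<open>b\<close> gives the two orders of differentiation.\<close>

lemma sym_partial_sym_partial_commute:
  assumes f: "smooth_compact f" and r: "r \<in> sym_mats"
  shows "sym_partial i j (sym_partial k l f) r = sym_partial k l (sym_partial i j f) r"
proof -
  define E where "E = sym_unit i j"
  define F where "F = sym_unit k l"
  define fq where "fq = sym_partial k l f"
  define fp where "fp = sym_partial i j f"
  define h where "h \<beta> = sym_partial i j fq (r + \<beta> *\<^sub>R F)" for \<beta>
  have sm: "smooth_compact fq" "smooth_compact fp" "smooth_compact (sym_partial i j fq)"
    unfolding fq_def fp_def by (intro smooth_compact_sym_partial f)+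
  have rs: "r + a *\<^sub>R E + b *\<^sub>R F \<in> sym_mats" "r + b *\<^sub>R F \<in> sym_mats" "r + a *\<^sub>R E \<in> sym_mats" for a b
    unfolding E_def F_def by (intro sym_mats_add_unit r)+
  have dE: "((\<lambda>a. g (x + a *\<^sub>R E)) has_vector_derivative sym_partial i j g (x + a *\<^sub>R E)) (at a within A)"
    if "smooth_compact g" "x \<in> sym_mats" for g x a A
    using smooth_compact_has_vector_derivative[OF that, of i j a] unfolding E_def by (rule has_vector_derivative_at_within)
  have dF: "((\<lambda>a. g (x + a *\<^sub>R F)) has_vector_derivative sym_partial k l g (x + a *\<^sub>R F)) (at a within A)"
    if "smooth_compact g" "x \<in> sym_mats" for g x a A
    using smooth_compact_has_vector_derivative[OF that, of k l a] unfolding F_def by (rule has_vector_derivative_at_within)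
  have hc: "continuous_on A h" for A
    unfolding h_def by (rule continuous_on_compose2[OF smooth_compact_continuous[OF sm(3)]]) (auto intro!: continuous_intros rs)
  have key: "fp (r + b *\<^sub>R F) - fp r = integral {0..b} h" if b: "0 \<le> b" for b
  proof -
    have I: "((\<lambda>\<beta>. fq (r + a *\<^sub>R E + \<beta> *\<^sub>R F)) has_integral (f (r + a *\<^sub>R E + b *\<^sub>R F) - f (r + a *\<^sub>R E + 0 *\<^sub>R F))) {0..b}" for a
      by (rule fundamental_theorem_of_calculus[OF b]) (use dF[OF f rs(3)] in \<open>simp add: fq_def\<close>)
    have 1: "((\<lambda>a. integral (cbox 0 b) (\<lambda>\<beta>. fq (r + a *\<^sub>R E + \<beta> *\<^sub>R F))) has_vector_derivative
        integral (cbox 0 b) (\<lambda>\<beta>. sym_partial i j fq (r + 0 *\<^sub>R E + \<beta> *\<^sub>R F))) (at 0 within UNIV)"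
    proof (rule leibniz_rule_vector_derivative)
      fix a \<beta>
      show "((\<lambda>a. fq (r + a *\<^sub>R E + \<beta> *\<^sub>R F)) has_vector_derivative sym_partial i j fq (r + a *\<^sub>R E + \<beta> *\<^sub>R F)) (at a)"
        using dE[OF sm(1) rs(2), of \<beta> a UNIV] by (simp add: add_ac)
      show "(\<lambda>\<beta>. fq (r + a *\<^sub>R E + \<beta> *\<^sub>R F)) integrable_on cbox 0 b"
        using I[of a] by auto
    next
      show "continuous_on (UNIV \<times> cbox 0 b) (\<lambda>(a, \<beta>). sym_partial i j fq (r + a *\<^sub>R E + \<beta> *\<^sub>R F))"
        unfolding case_prod_beta
        by (rule continuous_on_compose2[OF smooth_compact_continuous[OF sm(3)]]) (auto intro!: continuous_intros rs)
    qed auto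
    have "((\<lambda>a. f (r + a *\<^sub>R E + b *\<^sub>R F) - f (r + a *\<^sub>R E)) has_vector_derivative integral {0..b} h) (at 0)"
      using 1 I by (simp add: h_def[abs_def] has_integral_iff)
    moreover have "((\<lambda>a. f (r + a *\<^sub>R E + b *\<^sub>R F) - f (r + a *\<^sub>R E)) has_vector_derivative
        fp (r + b *\<^sub>R F) - fp r) (at 0)"
      using has_vector_derivative_diff[OF dE[OF f rs(2), of b 0 UNIV] dE[OF f r, of 0 UNIV]]
      by (simp add: fp_def add_ac)
    ultimately show ?thesis by (rule vector_derivative_unique_at[rotated])
  qed
  \<comment> \<open>The identity \<open>key\<close> holds for \<open>b \<ge> 0\<close>, hence the
    derivative at 0 within \<open>{0..1}\<close>, which is still unique.\<close>
  have "((\<lambda>b. integral {0..b} h) has_vector_derivative h 0) (at 0 within {0..1})"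
    by (rule integral_has_vector_derivative[OF hc]) auto
  then have "((\<lambda>b. fp (r + b *\<^sub>R F) - fp r) has_vector_derivative h 0) (at 0 within {0..1})"
    by (rule has_vector_derivative_transform[rotated 2]) (use key in auto)
  moreover have "((\<lambda>b. fp (r + b *\<^sub>R F) - fp r) has_vector_derivative sym_partial k l fp r - 0) (at 0 within {0..1})"
    using has_vector_derivative_diff[OF dF[OF sm(2) r, of 0 "{0..1}"] has_vector_derivative_const[of "fp r" "at 0 within {0..1}"]] by simp
  ultimately have "h 0 = sym_partial k l fp r"
    using vector_derivative_unique_within[of 0 "{0..1}"] by (force simp: at_within_Icc_at trivial_limit_within)
  then show ?thesis by (simp add: h_def fq_def fp_def)
qed

text \<open>The Leibniz formula lists derivatives in the order of the indices; expanding along a row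
  or exchanging two rows of the operator matrix changes that order.\<close>

lemma sym_partials_mset_cong:
  assumes f: "smooth_compact f" and "mset ps = mset qs" and "r \<in> sym_mats"
  shows "sym_partials ps f r = sym_partials qs f r"
  using assms(2,3)
proof (induction ps arbitrary: qs r)
  case (Cons p ps)
  have cong: "sym_partials [p] g r = sym_partials [p] h r" if "\<And>r. r \<in> sym_mats \<Longrightarrow> g r = h r" "r \<in> sym_mats" for g h p r
    by (rule sym_partials_cong_open[of UNIV]) (use that in auto)
  have move: "sym_partials (as @ [p]) g r = sym_partials (p # as) g r" if "smooth_compact g" "r \<in> sym_mats" for as g r
    using that(2)
  proof (induction as arbitrary: r)
    case (Cons a as)
    have "sym_partials (a # as @ [p]) g r = sym_partials [a] (sym_partials (as @ [p]) g) r"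
      by (metis append_Cons append_Nil sym_partials_append)
    also have "\<dots> = sym_partials [a] (sym_partials (p # as) g) r"
      by (rule cong) (use Cons in auto)
    also have "\<dots> = sym_partials [p] (sym_partials (a # as) g) r"
      by (cases a; cases p) (simp add: sym_partial_sym_partial_commute[OF smooth_compact_sym_partials[OF that(1)] Cons.prems])
    also have "\<dots> = sym_partials (p # a # as) g r"
      by (metis append_Cons append_Nil sym_partials_append)
    finally show ?case by simp
  qed simp
  have "p \<in> set qs" using Cons.prems by (metis list.set_intros(1) set_mset_mset)
  then obtain as bs where qs: "qs = as @ p # bs" by (meson split_list)
  have ms: "mset ps = mset (as @ bs)" using Cons.prems by (simp add: qs)
  have "sym_partials (p # ps) f r = sym_partials [p] (sym_partials ps f) r"
    by (metis append_Cons append_Nil sym_partials_append)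
  also have "\<dots> = sym_partials [p] (sym_partials (as @ bs) f) r"
    by (rule cong) (use Cons ms in auto)
  also have "\<dots> = sym_partials (p # as) (sym_partials bs f) r"
    by (metis append_Cons append_Nil sym_partials_append)
  also have "\<dots> = sym_partials (as @ [p]) (sym_partials bs f) r"
    by (rule move[symmetric]) (use smooth_compact_sym_partials[OF f] Cons in auto)
  also have "\<dots> = sym_partials qs f r"
    by (metis append_Cons append_Nil sym_partials_append append_assoc qs)
  finally show ?case .
qed simp

section \<open>The Cayley-type operator and rank-two perturbations\<close>

text \<open>The principal minor of the operator matrix with indices in \<open>S\<close>. The
  induction removes one index at a time, down to the empty minor, which is the identity.\<close>

definition det_op :: "'m set \<Rightarrow> ('m::{finite,linorder} sqmat \<Rightarrow> complex) \<Rightarrow> 'm sqmat \<Rightarrow> complex" where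
  "det_op S f r = (\<Sum>p | p permutes S. of_int (sign p) * complex_of_real (\<Prod>i\<in>S. eta i (p i)) *
     sym_partials (map (\<lambda>i. (i, p i)) (sorted_list_of_set S)) f r)"

lemma D_plus_eq_det_op: "D_plus = det_op UNIV"
  by (simp add: fun_eq_iff D_plus_def det_op_def)

lemma smooth_compact_det_op:
  assumes "smooth_compact f" shows "smooth_compact (det_op S f)"
  unfolding det_op_def[abs_def]
  by (intro smooth_compact_sum smooth_compact_sym_partials assms)

lemma det_op_empty: "det_op {} f = f"
proof -
  have "{p. p permutes ({} :: 'a set)} = {id}" by auto
  then show ?thesis by (simp add: det_op_def fun_eq_iff sign_id)
qed

lemma mset_sorted_list_of_set: "mset (sorted_list_of_set A) = mset_set (A :: 'a::{finite,linorder} set)"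
  using mset_set_set[of "sorted_list_of_set A"] by simp

text \<open>Multiply row \<open>j\<close> of the operator determinant by \<open>x\<^sub>j\<close> and add \<open>x\<^sub>i\<close> times row \<open>i\<close>: the terms with
  \<open>i \<noteq> j\<close> have two equal rows and cancel under \<open>p \<mapsto> p \<circ> (i j)\<close> because partial derivatives commute.\<close>

lemma det_op_row_combination:
  fixes x :: "'m::{finite,linorder} \<Rightarrow> real"
  assumes f: "smooth_compact f" and r: "r \<in> sym_mats" and j: "j \<in> S"
  defines "G \<equiv> \<lambda>p. sym_partials (map (\<lambda>i. (i, p i)) (sorted_list_of_set (S - {j}))) f"
  shows "complex_of_real (x j) * det_op S f r =
    (\<Sum>p | p permutes S. of_int (sign p) * complex_of_real (\<Prod>i\<in>S - {j}. eta i (p i)) *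
       (\<Sum>i\<in>S. (x i * eta i (p j)) *\<^sub>R sym_partial i (p j) (G p) r))"
proof -
  define L where "L = sorted_list_of_set (S - {j})"
  have mL: "mset L = mset_set (S - {j})" unfolding L_def by (rule mset_sorted_list_of_set)
  define T where "T i p = of_int (sign p) * complex_of_real (eta i (p j) * (\<Prod>k\<in>S - {j}. eta k (p k))) *
      sym_partials ((i, p j) # map (\<lambda>k. (k, p k)) L) f r" for i p
  have diag: "(\<Sum>p | p permutes S. T j p) = det_op S f r"
  proof -
    have "T j p = of_int (sign p) * complex_of_real (\<Prod>i\<in>S. eta i (p i)) *
       sym_partials (map (\<lambda>i. (i, p i)) (sorted_list_of_set S)) f r" for p
    proof -
      have "mset ((j, p j) # map (\<lambda>k. (k, p k)) L) = image_mset (\<lambda>i. (i, p i)) (add_mset j (mset_set (S - {j})))"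
        by (simp add: mL)
      also have "\<dots> = mset (map (\<lambda>i. (i, p i)) (sorted_list_of_set S))"
        by (simp add: mset_sorted_list_of_set mset_set.remove[OF finite j])
      finally have "sym_partials ((j, p j) # map (\<lambda>k. (k, p k)) L) f r = sym_partials (map (\<lambda>i. (i, p i)) (sorted_list_of_set S)) f r"
        by (rule sym_partials_mset_cong[OF f _ r])
      moreover have "eta j (p j) * (\<Prod>k\<in>S - {j}. eta k (p k)) = (\<Prod>i\<in>S. eta i (p i))"
        using j by (simp add: prod.remove)
      ultimately show ?thesis by (simp add: T_def)
    qed
    then show ?thesis by (simp add: det_op_def)
  qed
  have off: "(\<Sum>p | p permutes S. T i p) = 0" if i: "i \<in> S" "i \<noteq> j" for i
  proof -
    define t where "t = Transposition.transpose i j"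
    have t: "t permutes S" unfolding t_def using i j by (intro permutes_swap_id)
    have Si: "S - {j} = insert i (S - {i, j})" using i by auto
    have "T i (p \<circ> t) = - T i p" if p: "p permutes S" for p
    proof -
      have pt: "p (t k) = (if k = i then p j else if k = j then p i else p k)" for k
        by (auto simp: t_def Transposition.transpose_def)
      have sg: "sign (p \<circ> t) = - sign p"
      proof -
        have "permutation p" "permutation t" using p t finite[of S] permutation_permutes by blast+
        then show ?thesis using i by (simp add: sign_compose t_def sign_swap_id)
      qed
      have e: "eta i ((p \<circ> t) j) * (\<Prod>k\<in>S - {j}. eta k ((p \<circ> t) k)) = eta i (p j) * (\<Prod>k\<in>S - {j}. eta k (p k))"
      proof -
        have "(\<Prod>k\<in>S - {i, j}. eta k ((p \<circ> t) k)) = (\<Prod>k\<in>S - {i, j}. eta k (p k))"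
          by (intro prod.cong refl) (auto simp: pt)
        then show ?thesis using i unfolding Si by (simp add: pt mult_ac)
      qed
      have "mset ((i, (p \<circ> t) j) # map (\<lambda>k. (k, (p \<circ> t) k)) L) = mset ((i, p j) # map (\<lambda>k. (k, p k)) L)"
      proof -
        have 1: "mset_set (S - {j}) = add_mset i (mset_set (S - {i, j}))"
          unfolding Si by simp
        have "image_mset (\<lambda>k. (k, (p \<circ> t) k)) (mset_set (S - {i, j})) = image_mset (\<lambda>k. (k, p k)) (mset_set (S - {i, j}))"
          by (intro image_mset_cong) (auto simp: pt)
        then show ?thesis using i by (simp add: mL 1 pt)
      qed
      then have "sym_partials ((i, (p \<circ> t) j) # map (\<lambda>k. (k, (p \<circ> t) k)) L) f r = sym_partials ((i, p j) # map (\<lambda>k. (k, p k)) L) f r"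
        by (rule sym_partials_mset_cong[OF f _ r])
      then show ?thesis unfolding T_def sg e by simp
    qed
    then have "(\<Sum>p | p permutes S. T i (p \<circ> t)) = - (\<Sum>p | p permutes S. T i p)"
      unfolding sum_negf[symmetric] by (intro sum.cong) auto
    moreover have "(\<Sum>p | p permutes S. T i (p \<circ> t)) = (\<Sum>p | p permutes S. T i p)"
      using sum_permutations_compose_right[OF t, of "T i"] by simp
    ultimately show ?thesis by simp
  qed
  have "(\<Sum>p | p permutes S. of_int (sign p) * complex_of_real (\<Prod>i\<in>S - {j}. eta i (p i)) *
       (\<Sum>i\<in>S. (x i * eta i (p j)) *\<^sub>R sym_partial i (p j) (G p) r)) =
     (\<Sum>p | p permutes S. \<Sum>i\<in>S. complex_of_real (x i) * T i p)"
    by (intro sum.cong refl) (simp add: T_def G_def L_def sum_distrib_left scaleR_conv_of_real mult_ac)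
  also have "\<dots> = (\<Sum>i\<in>S. complex_of_real (x i) * (\<Sum>p | p permutes S. T i p))"
    by (subst sum.swap) (simp add: sum_distrib_left)
  also have "\<dots> = (\<Sum>i\<in>S. if i = j then complex_of_real (x j) * det_op S f r else 0)"
    by (intro sum.cong refl) (auto simp: diag off)
  also have "\<dots> = complex_of_real (x j) * det_op S f r"
    using j by simp
  finally show ?thesis ..
qed

text \<open>\<open>Re zz\<^sup>*\<close> for \<open>z\<^sub>a = w(a, True) + i w(a, False)\<close>, restricted to the indices in \<open>S\<close>.\<close>

definition pair_gram :: "'m set \<Rightarrow> ('m \<times> bool \<Rightarrow> real) \<Rightarrow> 'm::finite sqmat" where
  "pair_gram S w = (\<chi> a b. if a \<in> S \<and> b \<in> S then w (a, True) * w (b, True) + w (a, False) * w (b, False) else 0)"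

lemma pair_gram_sym_mats: "pair_gram S w \<in> sym_mats"
  by (auto simp: sym_mats_def pair_gram_def vec_eq_iff mult.commute)

lemma sym_mats_diff: "a \<in> sym_mats \<Longrightarrow> b \<in> sym_mats \<Longrightarrow> a - b \<in> sym_mats"
  by (simp add: sym_mats_def transpose_diff)

text \<open>The origin of \<open>eta\<close>: in one component of z_l the diagonal entry
  \<open>(l, l)\<close> is quadratic and the entries \<open>(a, l)\<close> are linear, so the factor
  is 2 on the diagonal and 1 off it, in both cases twice the weight.\<close>

lemma has_vector_derivative_pair_gram:
  fixes w :: "'m::finite \<times> bool \<Rightarrow> real"
  assumes g: "smooth_compact g" and s: "s \<in> sym_mats" and l: "l \<in> S"
  shows "((\<lambda>t. g (s - pair_gram S (w((l, b) := t)))) has_vector_derivative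
     (- 2) *\<^sub>R (\<Sum>a\<in>S. ((w((l, b) := t0)) (a, b) * eta a l) *\<^sub>R sym_partial a l g (s - pair_gram S (w((l, b) := t0))))) (at t0)"
proof -
  \<comment> \<open>The base point has the moving coordinate set to 0, so that the coefficients
    \<open>c p t\<close> are monomials in \<open>t\<close>.\<close>
  define r where "r = s - pair_gram S (w((l, b) := 0))"
  define c where "c p t = (if fst p = l then - (t\<^sup>2) else - t * w (fst p, b))" for p :: "'m \<times> 'm" and t :: real
  define c' where "c' p = (if fst p = l then - 2 * t0 else - w (fst p, b))" for p :: "'m \<times> 'm"
  define P where "P = (\<lambda>a. (a, l)) ` S"
  have inj: "inj_on (\<lambda>a. (a, l)) S" by (auto simp: inj_on_def)
  have r: "r \<in> sym_mats" unfolding r_def by (intro sym_mats_diff s pair_gram_sym_mats)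
  have eq: "r + (\<Sum>p\<in>P. c p t *\<^sub>R sym_unit (fst p) (snd p)) = s - pair_gram S (w((l, b) := t))" for t
  proof -
    have "(\<Sum>p\<in>P. c p t *\<^sub>R sym_unit (fst p) (snd p)) = (\<Sum>a\<in>S. c (a, l) t *\<^sub>R sym_unit a l)"
      unfolding P_def by (subst sum.reindex[OF inj]) simp
    moreover have "(\<Sum>a\<in>S. c (a, l) t *\<^sub>R sym_unit a l) $ x $ y =
        (pair_gram S (w((l, b) := 0)) - pair_gram S (w((l, b) := t))) $ x $ y" for x y
    proof -
      have "(\<Sum>a\<in>S. c (a, l) t *\<^sub>R sym_unit a l) $ x $ y = (\<Sum>a\<in>S. if y = l \<and> a = x \<or> x = l \<and> a = y then c (a, l) t else 0)"
        by (simp add: sum_component sym_unit_def) (intro sum.cong refl, auto)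
      also have "\<dots> = (if y = l then (if x \<in> S then c (x, l) t else 0) else if x = l then (if y \<in> S then c (y, l) t else 0) else 0)"
        by (cases "y = l"; cases "x = l") (auto simp: sum.delta')
      also have "\<dots> = (pair_gram S (w((l, b) := 0)) - pair_gram S (w((l, b) := t))) $ x $ y"
        using l by (cases b) (auto simp: pair_gram_def c_def power2_eq_square)
      finally show ?thesis .
    qed
    ultimately have "(\<Sum>p\<in>P. c p t *\<^sub>R sym_unit (fst p) (snd p)) = pair_gram S (w((l, b) := 0)) - pair_gram S (w((l, b) := t))"
      by (simp add: vec_eq_iff)
    then show ?thesis by (simp add: r_def)
  qed
  have "((\<lambda>t. g (r + (\<Sum>p\<in>P. c p t *\<^sub>R sym_unit (fst p) (snd p)))) has_vector_derivative
     (\<Sum>p\<in>P. c' p *\<^sub>R sym_partial (fst p) (snd p) g (r + (\<Sum>p\<in>P. c p t0 *\<^sub>R sym_unit (fst p) (snd p))))) (at t0)"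
    by (rule smooth_compact_chain_rule[OF g _ r])
       (auto simp: P_def c_def[abs_def] c'_def intro!: derivative_eq_intros)
  then have "((\<lambda>t. g (s - pair_gram S (w((l, b) := t)))) has_vector_derivative
     (\<Sum>p\<in>P. c' p *\<^sub>R sym_partial (fst p) (snd p) g (s - pair_gram S (w((l, b) := t0))))) (at t0)"
    by (simp only: eq)
  also have "(\<Sum>p\<in>P. c' p *\<^sub>R sym_partial (fst p) (snd p) g (s - pair_gram S (w((l, b) := t0)))) =
     (\<Sum>a\<in>S. (- 2 * ((w((l, b) := t0)) (a, b) * eta a l)) *\<^sub>R sym_partial a l g (s - pair_gram S (w((l, b) := t0))))"
    unfolding P_def by (subst sum.reindex[OF inj]) (auto intro!: sum.cong simp: c'_def eta_def)
  also have "\<dots> = (- 2) *\<^sub>R (\<Sum>a\<in>S. ((w((l, b) := t0)) (a, b) * eta a l) *\<^sub>R sym_partial a l g (s - pair_gram S (w((l, b) := t0))))"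
    by (simp add: scaleR_sum_right)
  finally show ?thesis .
qed

section \<open>Integration by parts for integrands with bounded support\<close>

lemma integrable_PiM_bounded_support:
  fixes h :: "('i \<Rightarrow> 'a::euclidean_space) \<Rightarrow> 'b::{banach, second_countable_topology}"
  assumes I: "finite I" and h: "h \<in> borel_measurable (prod_leb I)"
    and C: "\<And>w. norm (h w) \<le> C" and B: "\<And>w i. i \<in> I \<Longrightarrow> B < norm (w i) \<Longrightarrow> h w = 0"
  shows "integrable (prod_leb I) h"
proof -
  interpret finite_product_sigma_finite "\<lambda>_. lborel :: 'a measure" I by standard (fact I)
  show ?thesis
  proof (rule integrableI_bounded_set)
    show "PiE I (\<lambda>_. cball 0 B) \<in> sets (prod_leb I)"
      using I by (intro sets_PiM_I_finite) auto
    have "emeasure (prod_leb I) (PiE I (\<lambda>_. cball (0 :: 'a) B)) = (\<Prod>i\<in>I. emeasure lborel (cball (0 :: 'a) B))"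
      by (rule measure_times) simp
    also have "\<dots> < \<infinity>"
      using emeasure_bounded_finite[OF bounded_cball, of "0 :: 'a" B] by (auto simp: power_less_top_ennreal less_top)
    finally show "emeasure (prod_leb I) (PiE I (\<lambda>_. cball (0 :: 'a) B)) < \<infinity>" .
    show "AE x in prod_leb I. x \<in> PiE I (\<lambda>_. cball 0 B) \<longrightarrow> norm (h x) \<le> C"
      using C by simp
    show "AE x in prod_leb I. x \<notin> PiE I (\<lambda>_. cball 0 B) \<longrightarrow> h x = 0"
    proof (rule AE_I2, rule impI)
      fix x assume "x \<in> space (PiM I (\<lambda>_. lborel :: 'a measure))" "x \<notin> PiE I (\<lambda>_. cball 0 B)"
      then obtain i where "i \<in> I" "B < norm (x i)" by (force simp: space_PiM PiE_iff)
      then show "h x = 0" by (rule B)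
    qed
  qed (fact h)
qed

lemma integral_PiM_derivative_eq_0:
  fixes v v' :: "('i \<Rightarrow> real) \<Rightarrow> 'b::euclidean_space"
  assumes I: "finite I" "c \<in> I" and int: "integrable (prod_leb I) v'"
    and der: "\<And>w t. ((\<lambda>t. v (w(c := t))) has_vector_derivative v' (w(c := t))) (at t)"
    and cont: "\<And>w. continuous_on UNIV (\<lambda>t. v' (w(c := t)))"
    and B: "\<And>w. B < \<bar>w c\<bar> \<Longrightarrow> v w = 0 \<and> v' w = 0"
  shows "(LINT w|prod_leb I. v' w) = 0"
proof -
  have ins: "insert c (I - {c}) = I" using I by auto
  have "(LINT w|prod_leb I. v' w) = (LINT w|prod_leb (I - {c}). (LINT t|lborel. v' (w(c := t))))"
    using lborel_PiM.product_integral_insert[of "I - {c}" c v'] I int unfolding ins by simp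
  moreover have "(LINT t|lborel. v' (w(c := t))) = 0" for w
  proof -
    \<comment> \<open>Larger than \<open>B\<close>, and positive whatever the sign of
      \<open>B\<close>, so that both end points lie outside the support.\<close>
    define b where "b = \<bar>B\<bar> + 1"
    have "(LINT t|lborel. v' (w(c := t))) = (LINT t|lborel. indicator {-b..b} t *\<^sub>R v' (w(c := t)))"
    proof (rule Bochner_Integration.integral_cong)
      fix t :: real
      show "v' (w(c := t)) = indicator {-b..b} t *\<^sub>R v' (w(c := t))"
        using B[of "w(c := t)"] by (cases "t \<in> {-b..b}") (auto simp: b_def)
    qed simp
    also have "\<dots> = v (w(c := b)) - v (w(c := - b))"
    proof (rule integral_FTC_Icc)
      show "- b \<le> b" by (simp add: b_def)
      show "((\<lambda>t. v (w(c := t))) has_vector_derivative v' (w(c := t))) (at t within {- b..b})" for t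
        by (rule has_vector_derivative_at_within[OF der])
      show "continuous_on {- b..b} (\<lambda>t. v' (w(c := t)))"
        by (rule continuous_on_subset[OF cont]) simp
    qed
    also have "\<dots> = 0" using B[of "w(c := b)"] B[of "w(c := - b)"] by (simp add: b_def)
    finally show ?thesis .
  qed
  ultimately show ?thesis by simp
qed

abbreviation pair_index :: "'m set \<Rightarrow> ('m \<times> bool) set" where
  "pair_index S \<equiv> S \<times> UNIV"

definition radius2 :: "'m \<Rightarrow> ('m \<times> bool \<Rightarrow> real) \<Rightarrow> real" where
  "radius2 j w = (w (j, True))\<^sup>2 + (w (j, False))\<^sup>2"

lemma radius2_nonneg [simp]: "0 \<le> radius2 j w"
  by (simp add: radius2_def)

text \<open>One bound for all coordinates. The summand 1 comes from |x| \<le> x^2 + 1, which is used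
  in place of a square root.\<close>

definition support_bound :: "'m::finite sqmat \<Rightarrow> real" where
  "support_bound s = (\<Sum>a\<in>UNIV. \<bar>s $ a $ a\<bar>) + 1"

lemma abs_le_support_bound:
  assumes "x\<^sup>2 < s $ a $ a" shows "\<bar>x\<bar> < support_bound s"
proof -
  have "\<bar>x\<bar> \<le> x\<^sup>2 + 1"
    using zero_le_power2[of "\<bar>x\<bar> - 1"] by (simp add: power2_diff)
  moreover have "\<bar>s $ a $ a\<bar> \<le> (\<Sum>a\<in>UNIV. \<bar>s $ a $ a\<bar>)" by (rule member_le_sum) auto
  ultimately show ?thesis using assms by (simp add: support_bound_def)
qed

lemma pd_cone_diag_pos: "r \<in> pd_cone \<Longrightarrow> 0 < r $ a $ a"
  using pd_cone_posD[of r "axis a 1"] by (simp add: matrix_vector_mult_basis inner_axis' column_def)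

lemma smooth_compact_nonzero_pd:
  assumes "smooth_compact f" "r \<in> sym_mats" "f r \<noteq> 0" shows "r \<in> pd_cone"
  using assms by (auto simp: smooth_compact_def)

text \<open>A nonzero value puts the argument into the cone, where diagonal entries are positive;
  hence |z_a|^2 is below the diagonal entry of \<open>s\<close>. Positive definiteness thus confines
  the integration to a bounded set.\<close>

lemma smooth_compact_pair_gram_support:
  assumes f: "smooth_compact f" and s: "s \<in> sym_mats" and nz: "f (s - pair_gram S w) \<noteq> 0" and p: "p \<in> pair_index S"
  shows "\<bar>w p\<bar> < support_bound s"
proof -
  obtain a b where ab: "p = (a, b)" "a \<in> S" using p by auto
  have "s - pair_gram S w \<in> pd_cone"
    by (rule smooth_compact_nonzero_pd[OF f sym_mats_diff[OF s pair_gram_sym_mats] nz])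
  from pd_cone_diag_pos[OF this, of a] have "(w (a, True))\<^sup>2 + (w (a, False))\<^sup>2 < s $ a $ a"
    using ab by (simp add: pair_gram_def power2_eq_square)
  then have "(w p)\<^sup>2 < s $ a $ a"
  proof (rule le_less_trans[rotated])
    show "(w p)\<^sup>2 \<le> (w (a, True))\<^sup>2 + (w (a, False))\<^sup>2" by (cases b) (simp_all add: ab)
  qed
  then show ?thesis by (rule abs_le_support_bound)
qed

lemma smooth_compact_bounded:
  assumes f: "smooth_compact f"
  obtains C where "0 < C" "\<And>r. r \<in> sym_mats \<Longrightarrow> norm (f r) \<le> C"
proof -
  obtain K where K: "compact K" "K \<subseteq> pd_cone" "\<And>r. r \<in> sym_mats - K \<Longrightarrow> f r = 0"
    using f by (auto simp: smooth_compact_def)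
  have "continuous_on K f"
    using smooth_compact_continuous[OF f] K pd_cone_subset_sym_mats by (meson continuous_on_subset order_trans)
  then have "bounded (f ` K)" using K compact_continuous_image compact_imp_bounded by blast
  then obtain C where "C > 0" "\<And>r. r \<in> K \<Longrightarrow> norm (f r) \<le> C" by (auto simp: bounded_pos)
  then show ?thesis using that[of C] K by force
qed

lemma smooth_compact_measurable:
  assumes f: "smooth_compact f" and X: "X \<in> borel_measurable M" and "\<And>w. X w \<in> sym_mats"
  shows "(\<lambda>w. f (X w)) \<in> borel_measurable M"
proof -
  have "f \<in> borel_measurable (restrict_space borel sym_mats)"
    by (rule borel_measurable_continuous_on_restrict[OF smooth_compact_continuous[OF f]])
  moreover have "X \<in> measurable M (restrict_space borel sym_mats)"
    using assms by (intro measurable_restrict_space2) auto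
  ultimately show ?thesis by (rule measurable_compose[rotated])
qed

lemma borel_measurable_pair_gram [measurable]:
  "pair_gram S \<in> borel_measurable (prod_leb (pair_index S))"
proof (intro borel_measurable_vecI)
  fix i j
  have c: "(\<lambda>w. w k) \<in> borel_measurable (real_leb (pair_index S))" if "k \<in> pair_index S" for k
    using measurable_component_singleton[OF that, of "\<lambda>_. lborel :: real measure"] by simp
  show "(\<lambda>w. pair_gram S w $ i $ j) \<in> borel_measurable (prod_leb (pair_index S))"
    using c by (cases "i \<in> S \<and> j \<in> S") (auto simp: pair_gram_def)
qed

lemma smooth_compact_pair_gram_measurable:
  assumes "smooth_compact f" "s \<in> sym_mats"
  shows "(\<lambda>w. f (s - pair_gram S w)) \<in> borel_measurable (prod_leb (pair_index S))"
  by (rule smooth_compact_measurable[OF assms(1)]) (auto intro: sym_mats_diff assms pair_gram_sym_mats)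

lemma radius2_measurable [measurable]:
  assumes "j \<in> S"
  shows "radius2 j \<in> borel_measurable (prod_leb (pair_index S))"
proof -
  have "(\<lambda>w. w (j, b)) \<in> borel_measurable (real_leb (pair_index S))" for b
    using measurable_component_singleton[of "(j, b)" "pair_index S" "\<lambda>_. lborel :: real measure"] assms by simp
  then show ?thesis unfolding radius2_def[abs_def] by simp
qed

lemma integrable_weighted_pair_gram:
  fixes f :: "'m::finite sqmat \<Rightarrow> complex" and k :: "('m \<times> bool \<Rightarrow> real) \<Rightarrow> real"
  assumes f: "smooth_compact f" and s: "s \<in> sym_mats"
    and k: "k \<in> borel_measurable (prod_leb (pair_index S))"
    and kC: "\<And>w. (\<And>p. p \<in> pair_index S \<Longrightarrow> \<bar>w p\<bar> \<le> support_bound s) \<Longrightarrow> \<bar>k w\<bar> \<le> C"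
  shows "integrable (prod_leb (pair_index S)) (\<lambda>w. k w *\<^sub>R f (s - pair_gram S w))"
proof -
  obtain D where D: "0 < D" "\<And>r. r \<in> sym_mats \<Longrightarrow> norm (f r) \<le> D"
    using smooth_compact_bounded[OF f] by metis
  have sp: "f (s - pair_gram S w) = 0" if "p \<in> pair_index S" "\<not> \<bar>w p\<bar> \<le> support_bound s" for p w
    using smooth_compact_pair_gram_support[OF f s _ that(1), of w] that(2) by force
  show ?thesis
  proof (rule integrable_PiM_bounded_support)
    show "finite (pair_index S)" by simp
    show "(\<lambda>w. k w *\<^sub>R f (s - pair_gram S w)) \<in> borel_measurable (prod_leb (pair_index S))"
      using k smooth_compact_pair_gram_measurable[OF f s] by simp
    show "norm (k w *\<^sub>R f (s - pair_gram S w)) \<le> \<bar>C\<bar> * D" for w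
    proof (cases "\<forall>p\<in>pair_index S. \<bar>w p\<bar> \<le> support_bound s")
      case True
      then have "\<bar>k w\<bar> \<le> \<bar>C\<bar>" using kC[of w] by force
      moreover have "norm (f (s - pair_gram S w)) \<le> D" by (intro D sym_mats_diff s pair_gram_sym_mats)
      ultimately show ?thesis using D(1) by (simp add: mult_mono)
    next
      case False
      then show ?thesis using sp D(1) by force
    qed
    show "support_bound s < norm (w p) \<Longrightarrow> k w *\<^sub>R f (s - pair_gram S w) = 0" if "p \<in> pair_index S" for w p
      using sp[OF that] by simp
  qed
qed

text \<open>The bounds that grow as \<epsilon> decreases are for integrability at fixed \<epsilon>;
  the third one is uniform and provides the domination as \<epsilon> tends to 0.\<close>

lemma weight_bounds:
  assumes "0 < \<epsilon>"
  shows "\<bar>w (j, b) / (radius2 j w + \<epsilon>)\<bar> \<le> 1 + 1 / \<epsilon>"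
    and "\<bar>1 / (radius2 j w + \<epsilon>) - 2 * (w (j, b))\<^sup>2 / (radius2 j w + \<epsilon>)\<^sup>2\<bar> \<le> 3 / \<epsilon>"
    and "\<bar>radius2 j w / (radius2 j w + \<epsilon>)\<bar> \<le> 1"
    and "\<bar>\<epsilon> / (radius2 j w + \<epsilon>)\<^sup>2\<bar> \<le> 1 / \<epsilon>"
proof -
  define \<rho> where "\<rho> = radius2 j w"
  have r: "0 \<le> \<rho>" by (simp add: \<rho>_def)
  have wr: "(w (j, b))\<^sup>2 \<le> \<rho>" by (cases b) (simp_all add: \<rho>_def radius2_def)
  have "\<bar>w (j, b)\<bar> \<le> (w (j, b))\<^sup>2 + 1"
    using zero_le_power2[of "\<bar>w (j, b)\<bar> - 1"] by (simp add: power2_diff)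
  then have "\<bar>w (j, b)\<bar> \<le> \<rho> + 1" using wr by simp
  also have "\<rho> + 1 \<le> (1 + 1 / \<epsilon>) * (\<rho> + \<epsilon>)" using r assms by (simp add: field_simps)
  finally have "\<bar>w (j, b)\<bar> / (\<rho> + \<epsilon>) \<le> 1 + 1 / \<epsilon>" using r assms by (simp add: pos_divide_le_eq)
  then show "\<bar>w (j, b) / (radius2 j w + \<epsilon>)\<bar> \<le> 1 + 1 / \<epsilon>" using r assms by (simp add: \<rho>_def[symmetric])
  have i: "1 / (\<rho> + \<epsilon>) \<le> 1 / \<epsilon>" using r assms by (simp add: frac_le)
  have q: "\<epsilon> * (\<rho> + \<epsilon>) \<le> (\<rho> + \<epsilon>)\<^sup>2" using r assms by (simp add: power2_eq_square mult_right_mono)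
  have "(w (j, b))\<^sup>2 * \<epsilon> \<le> (\<rho> + \<epsilon>)\<^sup>2"
  proof -
    have "(w (j, b))\<^sup>2 * \<epsilon> \<le> (\<rho> + \<epsilon>) * \<epsilon>" using wr assms by (intro mult_right_mono) auto
    then show ?thesis using q by (simp add: mult.commute)
  qed
  then have "(w (j, b))\<^sup>2 / (\<rho> + \<epsilon>)\<^sup>2 \<le> 1 / \<epsilon>" using r assms by (simp add: field_simps)
  then have "2 * (w (j, b))\<^sup>2 / (\<rho> + \<epsilon>)\<^sup>2 \<le> 2 / \<epsilon>" by simp
  have "0 \<le> 1 / (\<rho> + \<epsilon>)" "0 \<le> 2 * (w (j, b))\<^sup>2 / (\<rho> + \<epsilon>)\<^sup>2" using r assms by auto
  then show "\<bar>1 / (radius2 j w + \<epsilon>) - 2 * (w (j, b))\<^sup>2 / (radius2 j w + \<epsilon>)\<^sup>2\<bar> \<le> 3 / \<epsilon>"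
  proof -
    have "3 / \<epsilon> = 1 / \<epsilon> + 2 / \<epsilon>" by (simp add: add_divide_distrib[symmetric])
    moreover have "0 \<le> 1 / \<epsilon>" "0 \<le> 2 / \<epsilon>" using assms by auto
    ultimately show ?thesis
      using i \<open>2 * (w (j, b))\<^sup>2 / (\<rho> + \<epsilon>)\<^sup>2 \<le> 2 / \<epsilon>\<close> \<open>0 \<le> 1 / (\<rho> + \<epsilon>)\<close>
        \<open>0 \<le> 2 * (w (j, b))\<^sup>2 / (\<rho> + \<epsilon>)\<^sup>2\<close>
      unfolding \<rho>_def[symmetric] abs_le_iff by linarith
  qed
  show "\<bar>radius2 j w / (radius2 j w + \<epsilon>)\<bar> \<le> 1" using r assms by (simp add: \<rho>_def[symmetric])
  have "\<epsilon> * \<epsilon> \<le> (\<rho> + \<epsilon>)\<^sup>2" using r assms by (simp add: power2_eq_square mult_mono)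
  then show "\<bar>\<epsilon> / (radius2 j w + \<epsilon>)\<^sup>2\<bar> \<le> 1 / \<epsilon>" using r assms by (simp add: \<rho>_def[symmetric] field_simps)
qed

text \<open>\<open>D\<close> is the derivative of \<open>g\<close> at s - Re zz^* in one component
  of z_l, while the kernel depends on z_j alone. For \<open>l \<noteq> j\<close> the product is
  itself a derivative and integrates to 0; for \<open>l = j\<close> the derivative of the kernel
  remains.\<close>

lemma integral_by_parts_pair_gram:
  fixes g :: "'m::finite sqmat \<Rightarrow> complex" and b :: bool
  assumes g: "smooth_compact g" and s: "s \<in> sym_mats" and j: "j \<in> S" and l: "l \<in> S" and e: "0 < \<epsilon>"
  defines "D \<equiv> \<lambda>w. (- 2) *\<^sub>R (\<Sum>a\<in>S. (w (a, b) * eta a l) *\<^sub>R sym_partial a l g (s - pair_gram S w))"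
  shows "integrable (prod_leb (pair_index S)) (\<lambda>w. (w (j, b) / (radius2 j w + \<epsilon>)) *\<^sub>R D w)"
    and "(LINT w|prod_leb (pair_index S). (w (j, b) / (radius2 j w + \<epsilon>)) *\<^sub>R D w) =
      (if l = j then - (LINT w|prod_leb (pair_index S).
         (1 / (radius2 j w + \<epsilon>) - 2 * (w (j, b))\<^sup>2 / (radius2 j w + \<epsilon>)\<^sup>2) *\<^sub>R g (s - pair_gram S w)) else 0)"
proof -
  let ?M = "real_leb (pair_index S)"
  define k where "k w = w (j, b) / (radius2 j w + \<epsilon>)" for w :: "'m \<times> bool \<Rightarrow> real"
  define k' where "k' w = (if l = j then 1 / (radius2 j w + \<epsilon>) - 2 * (w (j, b))\<^sup>2 / (radius2 j w + \<epsilon>)\<^sup>2 else 0)" for w :: "'m \<times> bool \<Rightarrow> real"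
  have re: "radius2 j w + \<epsilon> > 0" "radius2 j w + \<epsilon> \<noteq> 0" for w using e radius2_nonneg[of j w] by linarith+
  have cm: "(\<lambda>w. w (a, b)) \<in> borel_measurable ?M" if "a \<in> S" for a b
    using measurable_component_singleton[of "(a, b)" "pair_index S" "\<lambda>_. lborel :: real measure"] that by simp
  note [measurable] = cm[OF j] radius2_measurable[OF j]
  have km: "k \<in> borel_measurable ?M" "k' \<in> borel_measurable ?M"
    unfolding k_def[abs_def] k'_def[abs_def] by measurable
  have Deq: "k w *\<^sub>R D w = (\<Sum>a\<in>S. (- 2 * (k w * (w (a, b) * eta a l))) *\<^sub>R sym_partial a l g (s - pair_gram S w))" for w
    by (simp add: D_def scaleR_sum_right mult_ac)
  have iD: "integrable ?M (\<lambda>w. k w *\<^sub>R D w)"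
    unfolding Deq
  proof (rule Bochner_Integration.integrable_sum)
    fix a assume a: "a \<in> S"
    show "integrable ?M (\<lambda>w. (- 2 * (k w * (w (a, b) * eta a l))) *\<^sub>R sym_partial a l g (s - pair_gram S w))"
    proof (rule integrable_weighted_pair_gram[OF smooth_compact_sym_partial[OF g] s])
      show "(\<lambda>w. - 2 * (k w * (w (a, b) * eta a l))) \<in> borel_measurable ?M"
        using km cm[OF a] by simp
      fix w :: "'m \<times> bool \<Rightarrow> real" assume "\<And>p. p \<in> pair_index S \<Longrightarrow> \<bar>w p\<bar> \<le> support_bound s"
      then have "\<bar>w (a, b)\<bar> \<le> support_bound s" using a by auto
      moreover have "\<bar>k w\<bar> \<le> 1 + 1 / \<epsilon>" unfolding k_def by (rule weight_bounds[OF e])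
      moreover have "\<bar>eta a l\<bar> \<le> 1" by (simp add: eta_def)
      ultimately have "\<bar>k w\<bar> * (\<bar>w (a, b)\<bar> * \<bar>eta a l\<bar>) \<le> (1 + 1 / \<epsilon>) * (support_bound s * 1)"
        using e by (intro mult_mono) auto
      then show "\<bar>- 2 * (k w * (w (a, b) * eta a l))\<bar> \<le> 2 * ((1 + 1 / \<epsilon>) * support_bound s)"
        by (simp add: abs_mult)
    qed
  qed
  then show "integrable ?M (\<lambda>w. (w (j, b) / (radius2 j w + \<epsilon>)) *\<^sub>R D w)" by (simp add: k_def)
  have ig: "integrable ?M (\<lambda>w. k' w *\<^sub>R g (s - pair_gram S w))"
    by (rule integrable_weighted_pair_gram[OF g s km(2), where C = "3 / \<epsilon>"])
       (use weight_bounds(2)[OF e] e in \<open>auto simp: k'_def\<close>)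
  have "(LINT w|?M. k w *\<^sub>R D w + k' w *\<^sub>R g (s - pair_gram S w)) = 0"
  proof (rule integral_PiM_derivative_eq_0[where c = "(l, b)" and v = "\<lambda>w. k w *\<^sub>R g (s - pair_gram S w)" and B = "support_bound s"])
    show "finite (pair_index S)" "(l, b) \<in> pair_index S" using l by auto
    show "integrable ?M (\<lambda>w. k w *\<^sub>R D w + k' w *\<^sub>R g (s - pair_gram S w))"
      using iD ig by simp
    fix w :: "'m \<times> bool \<Rightarrow> real"
    have kd: "((\<lambda>t. k (w((l, b) := t))) has_real_derivative k' (w((l, b) := t))) (at t)" for t
    proof (cases "l = j")
      case True
      define o2 where "o2 = (w (j, \<not> b))\<^sup>2"
      have kt: "k (w((l, b) := t)) = t / (t\<^sup>2 + o2 + \<epsilon>)" for t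
        using True by (cases b) (auto simp: k_def radius2_def o2_def add_ac)
      have rt: "radius2 j (w((l, b) := t)) = t\<^sup>2 + o2" for t
        using True by (cases b) (auto simp: radius2_def o2_def)
      have nz: "t\<^sup>2 + o2 + \<epsilon> \<noteq> 0" using re(2)[of "w((l, b) := t)"] by (simp add: rt)
      have "((\<lambda>t. t / (t\<^sup>2 + o2 + \<epsilon>)) has_real_derivative (1 / (t\<^sup>2 + o2 + \<epsilon>) - 2 * t\<^sup>2 / (t\<^sup>2 + o2 + \<epsilon>)\<^sup>2)) (at t)"
      proof -
        define N where "N = t\<^sup>2 + o2 + \<epsilon>"
        have N: "N \<noteq> 0" using nz by (simp add: N_def)
        have "((\<lambda>t. t / (t\<^sup>2 + o2 + \<epsilon>)) has_real_derivative (1 * N - t * (2 * t)) / (N * N)) (at t)"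
          using N unfolding N_def by (auto intro!: derivative_eq_intros)
        also have "(1 * N - t * (2 * t)) / (N * N) = 1 / N - 2 * t\<^sup>2 / N\<^sup>2"
          using N by (simp add: diff_divide_distrib power2_eq_square)
        finally show ?thesis by (simp add: N_def)
      qed
      moreover have "(\<lambda>t. k (w((l, b) := t))) = (\<lambda>t. t / (t\<^sup>2 + o2 + \<epsilon>))" by (rule ext) (rule kt)
      moreover have "k' (w((l, b) := t)) = 1 / (t\<^sup>2 + o2 + \<epsilon>) - 2 * t\<^sup>2 / (t\<^sup>2 + o2 + \<epsilon>)\<^sup>2"
        using True rt[of t] by (simp add: k'_def)
      ultimately show ?thesis by (simp only:)
    next
      case False
      then have "k (w((l, b) := t)) = k w" for t by (auto simp: k_def radius2_def)
      then show ?thesis using False by (simp add: k'_def)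
    qed
    show "((\<lambda>t. k (w((l, b) := t)) *\<^sub>R g (s - pair_gram S (w((l, b) := t)))) has_vector_derivative
        k (w((l, b) := t)) *\<^sub>R D (w((l, b) := t)) + k' (w((l, b) := t)) *\<^sub>R g (s - pair_gram S (w((l, b) := t)))) (at t)" for t
      unfolding D_def
      by (rule has_vector_derivative_scaleR[OF kd has_vector_derivative_pair_gram[OF g s l]])
    have cc: "continuous_on UNIV (\<lambda>t. (w((l, b) := t)) q)" for q
      by (cases "q = (l, b)") (auto intro: continuous_intros)
    have cr: "continuous_on UNIV (\<lambda>t. radius2 j (w((l, b) := t)))"
      unfolding radius2_def by (intro continuous_intros cc)
    have ck: "continuous_on UNIV (\<lambda>t. k (w((l, b) := t)))" "continuous_on UNIV (\<lambda>t. k' (w((l, b) := t)))"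
    proof -
      show "continuous_on UNIV (\<lambda>t. k (w((l, b) := t)))"
        unfolding k_def by (intro continuous_intros cc cr) (use re(2) in blast)
      show "continuous_on UNIV (\<lambda>t. k' (w((l, b) := t)))"
      proof (cases "l = j")
        case True
        have "continuous_on UNIV (\<lambda>t. 1 / (radius2 j (w((l, b) := t)) + \<epsilon>) - 2 * ((w((l, b) := t)) (j, b))\<^sup>2 / (radius2 j (w((l, b) := t)) + \<epsilon>)\<^sup>2)"
          by (intro continuous_on_diff continuous_on_divide continuous_on_mult continuous_on_power continuous_on_add continuous_on_const cc cr)
            (use re(2) in \<open>simp_all del: fun_upd_apply\<close>)
        then show ?thesis using True by (simp only: k'_def if_True simp_thms)
      qed (simp add: k'_def)
    qed
    have cp: "continuous_on UNIV (\<lambda>t. s - pair_gram S (w((l, b) := t)))"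
      unfolding pair_gram_def
    proof (intro continuous_intros)
      fix x y
      show "continuous_on UNIV (\<lambda>t. if x \<in> S \<and> y \<in> S then (w((l, b) := t)) (x, True) * (w((l, b) := t)) (y, True) + (w((l, b) := t)) (x, False) * (w((l, b) := t)) (y, False) else 0)"
        by (cases "x \<in> S \<and> y \<in> S") (auto intro!: continuous_on_add continuous_on_mult cc simp del: fun_upd_apply)
    qed
    have ch: "continuous_on UNIV (\<lambda>t. h (s - pair_gram S (w((l, b) := t))))" if "smooth_compact h" for h
      by (rule continuous_on_compose2[OF smooth_compact_continuous[OF that] cp]) (auto intro: sym_mats_diff s pair_gram_sym_mats)
    show "continuous_on UNIV (\<lambda>t. k (w((l, b) := t)) *\<^sub>R D (w((l, b) := t)) + k' (w((l, b) := t)) *\<^sub>R g (s - pair_gram S (w((l, b) := t))))"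
      unfolding D_def
      by (intro continuous_on_add continuous_on_scaleR continuous_on_sum continuous_on_mult continuous_on_const ck cc ch smooth_compact_sym_partial g)
    assume B: "support_bound s < \<bar>w (l, b)\<bar>"
    have "h (s - pair_gram S w) = 0" if "smooth_compact h" for h
      using smooth_compact_pair_gram_support[OF that s _, of S w "(l, b)"] l B by force
    from this[OF g] this[OF smooth_compact_sym_partial[OF g]]
    show "k w *\<^sub>R g (s - pair_gram S w) = 0 \<and> k w *\<^sub>R D w + k' w *\<^sub>R g (s - pair_gram S w) = 0"
      by (simp add: D_def)
  qed
  then have "(LINT w|?M. k w *\<^sub>R D w) = - (LINT w|?M. k' w *\<^sub>R g (s - pair_gram S w))"
    using iD ig by (simp add: Bochner_Integration.integral_add eq_neg_iff_add_eq_0)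
  then show "(LINT w|?M. (w (j, b) / (radius2 j w + \<epsilon>)) *\<^sub>R D w) =
      (if l = j then - (LINT w|?M. (1 / (radius2 j w + \<epsilon>) - 2 * (w (j, b))\<^sup>2 / (radius2 j w + \<epsilon>)\<^sup>2) *\<^sub>R g (s - pair_gram S w)) else 0)"
    by (auto simp: k_def k'_def)
qed

lemma permutes_remove_iff:
  assumes "j \<in> S" shows "p permutes S \<and> p j = j \<longleftrightarrow> p permutes (S - {j})"
proof
  assume "p permutes S \<and> p j = j"
  then show "p permutes (S - {j})" by (auto intro: permutes_superset[where S = S])
next
  assume "p permutes (S - {j})"
  then show "p permutes S \<and> p j = j"
    using permutes_subset[of p "S - {j}" S] permutes_not_in[of p "S - {j}" j] by auto
qed

text \<open>Cauchy-Pompeiu with the kernel \<open>1/z\<^sub>j\<close> regularized to \<open>cnj z\<^sub>j / (|z\<^sub>j|\<^sup>2 + \<epsilon>)\<close>: only permutations fixing \<open>j\<close>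
  survive the integration by parts.\<close>

lemma integral_det_op_regularized:
  fixes f :: "'m::{finite,linorder} sqmat \<Rightarrow> complex"
  assumes f: "smooth_compact f" and s: "s \<in> sym_mats" and j: "j \<in> S" and e: "0 < \<epsilon>"
  shows "(LINT w|prod_leb (pair_index S). (radius2 j w / (radius2 j w + \<epsilon>)) *\<^sub>R det_op S f (s - pair_gram S w)) =
    (LINT w|prod_leb (pair_index S). (\<epsilon> / (radius2 j w + \<epsilon>)\<^sup>2) *\<^sub>R det_op (S - {j}) f (s - pair_gram S w))"
proof -
  let ?M = "real_leb (pair_index S)"
  let ?r = "\<lambda>w. radius2 j w + \<epsilon>"
  let ?u = "\<lambda>w. \<epsilon> / (radius2 j w + \<epsilon>)\<^sup>2"
  define G where "G p = sym_partials (map (\<lambda>i. (i, p i)) (sorted_list_of_set (S - {j}))) f" for p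
  define c where "c p = of_int (sign p) * complex_of_real (\<Prod>i\<in>S - {j}. eta i (p i))" for p
  define D where "D p b w = (- 2) *\<^sub>R (\<Sum>a\<in>S. (w (a, b) * eta a (p j)) *\<^sub>R sym_partial a (p j) (G p) (s - pair_gram S w))" for p b and w :: "'m \<times> bool \<Rightarrow> real"
  define k where "k b w = w (j, b) / (?r w)" for b and w :: "'m \<times> bool \<Rightarrow> real"
  define k' where "k' b w = 1 / (?r w) - 2 * (w (j, b))\<^sup>2 / (?r w)\<^sup>2" for b and w :: "'m \<times> bool \<Rightarrow> real"
  have G: "smooth_compact (G p)" for p unfolding G_def by (rule smooth_compact_sym_partials[OF f])
  have re: "?r w > 0" "?r w \<noteq> 0" for w using e radius2_nonneg[of j w] by linarith+
  \<comment> \<open>The row combination with coefficients \<open>w (i, b)\<close> is multiplied by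
    the kernel and summed over both components \<open>b\<close>: there z_j meets its conjugate and
    yields |z_j|^2 / (|z_j|^2 + \<epsilon>). The factor -1/2 undoes the -2 in
    \<open>D\<close>.\<close>
  have pt: "(radius2 j w / (?r w)) *\<^sub>R det_op S f (s - pair_gram S w) =
      (\<Sum>b\<in>UNIV. \<Sum>p | p permutes S. (- c p / 2) * (k b w *\<^sub>R D p b w))" for w
  proof -
    have "complex_of_real (w (j, b)) * det_op S f (s - pair_gram S w) = (\<Sum>p | p permutes S. (- c p / 2) * D p b w)" for b
    proof -
      have "complex_of_real (w (j, b)) * det_op S f (s - pair_gram S w) =
        (\<Sum>p | p permutes S. c p * (\<Sum>i\<in>S. (w (i, b) * eta i (p j)) *\<^sub>R sym_partial i (p j) (G p) (s - pair_gram S w)))"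
        unfolding c_def G_def
        by (rule det_op_row_combination[where x = "\<lambda>i. w (i, b)"]) (intro f sym_mats_diff s pair_gram_sym_mats j)+
      also have "\<dots> = (\<Sum>p | p permutes S. (- c p / 2) * D p b w)"
        by (intro sum.cong refl) (simp add: D_def scaleR_conv_of_real)
      finally show ?thesis .
    qed
    then have "(\<Sum>b\<in>UNIV. complex_of_real (k b w) * (\<Sum>p | p permutes S. (- c p / 2) * D p b w)) =
       (\<Sum>b\<in>UNIV. complex_of_real (k b w * w (j, b))) * det_op S f (s - pair_gram S w)"
      by (simp add: sum_distrib_right mult.assoc)
    also have "(\<Sum>b\<in>UNIV. complex_of_real (k b w * w (j, b))) = complex_of_real (radius2 j w / (?r w))"
      by (simp add: UNIV_bool k_def radius2_def power2_eq_square add_divide_distrib add.commute)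
    finally show ?thesis
      by (simp add: scaleR_conv_of_real sum_distrib_left mult_ac)
  qed
  have iD: "integrable ?M (\<lambda>w. k b w *\<^sub>R D p b w)"
    and lD: "(LINT w|?M. k b w *\<^sub>R D p b w) = (if p j = j then - (LINT w|?M. k' b w *\<^sub>R G p (s - pair_gram S w)) else 0)"
    if p: "p permutes S" for p b
  proof -
    have l: "p j \<in> S" using permutes_in_image[OF p, of j] j by simp
    show "integrable ?M (\<lambda>w. k b w *\<^sub>R D p b w)"
      unfolding k_def D_def by (rule integral_by_parts_pair_gram(1)[OF G s j l e])
    show "(LINT w|?M. k b w *\<^sub>R D p b w) = (if p j = j then - (LINT w|?M. k' b w *\<^sub>R G p (s - pair_gram S w)) else 0)"
      unfolding k_def D_def k'_def by (rule integral_by_parts_pair_gram(2)[OF G s j l e])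
  qed
  have cm: "(\<lambda>w. w (j, b)) \<in> borel_measurable ?M" for b
    using measurable_component_singleton[of "(j, b)" "pair_index S" "\<lambda>_. lborel :: real measure"] j by simp
  note [measurable] = cm radius2_measurable[OF j]
  have km: "k' b \<in> borel_measurable ?M" for b unfolding k'_def[abs_def] by measurable
  have ik: "integrable ?M (\<lambda>w. k' b w *\<^sub>R G p (s - pair_gram S w))" for b p
    by (rule integrable_weighted_pair_gram[OF G s km, where C = "3 / \<epsilon>"]) (unfold k'_def, rule weight_bounds(2)[OF e])
  \<comment> \<open>The divergence of the plane vector field z / (|z|^2 + \<epsilon>).\<close>
  have ke: "k' True w + k' False w = 2 * ?u w" for w
  proof -
    have "k' True w + k' False w = 2 / (?r w) - 2 * radius2 j w / (?r w)\<^sup>2"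
      by (simp add: k'_def radius2_def[of j w, symmetric] add_divide_distrib[symmetric] distrib_left[symmetric])
         (simp add: radius2_def add_divide_distrib distrib_left)
    also have "2 / (?r w) = 2 * (?r w) / (?r w)\<^sup>2"
    proof -
      have "2 / x = 2 * x / x\<^sup>2" if "x \<noteq> 0" for x :: real using that by (simp add: power2_eq_square)
      from this[OF re(2)] show ?thesis .
    qed
    finally show ?thesis by (simp add: diff_divide_distrib[symmetric] algebra_simps)
  qed
  have "(LINT w|?M. (radius2 j w / (?r w)) *\<^sub>R det_op S f (s - pair_gram S w)) =
     (\<Sum>b\<in>UNIV. \<Sum>p | p permutes S. (- c p / 2) * (LINT w|?M. k b w *\<^sub>R D p b w))"
  proof -
    have iX: "integrable ?M (\<lambda>w. (- c p / 2) * (k b w *\<^sub>R D p b w))" if "p permutes S" for p b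
      by (intro integrable_mult_right iD that)
    have "(LINT w|?M. (\<Sum>b\<in>UNIV. \<Sum>p | p permutes S. (- c p / 2) * (k b w *\<^sub>R D p b w))) =
        (\<Sum>b\<in>UNIV. LINT w|?M. (\<Sum>p | p permutes S. (- c p / 2) * (k b w *\<^sub>R D p b w)))"
      by (rule Bochner_Integration.integral_sum) (intro Bochner_Integration.integrable_sum iX, simp)
    also have "\<dots> = (\<Sum>b\<in>UNIV. \<Sum>p | p permutes S. LINT w|?M. (- c p / 2) * (k b w *\<^sub>R D p b w))"
      by (intro sum.cong refl Bochner_Integration.integral_sum iX) simp
    also have "\<dots> = (\<Sum>b\<in>UNIV. \<Sum>p | p permutes S. (- c p / 2) * (LINT w|?M. k b w *\<^sub>R D p b w))"
      by (simp only: integral_mult_right_zero)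
    finally show ?thesis unfolding pt .
  qed
  also have "\<dots> = (\<Sum>b\<in>UNIV. \<Sum>p | p permutes S. if p j = j then (c p / 2) * (LINT w|?M. k' b w *\<^sub>R G p (s - pair_gram S w)) else 0)"
    by (intro sum.cong refl) (simp add: lD)
  also have "\<dots> = (\<Sum>p | p permutes S. if p j = j then (c p / 2) * (\<Sum>b\<in>UNIV. LINT w|?M. k' b w *\<^sub>R G p (s - pair_gram S w)) else 0)"
    by (subst sum.swap) (auto intro!: sum.cong simp: sum_distrib_left)
  also have "\<dots> = (\<Sum>p | p permutes S \<and> p j = j. (c p / 2) * (\<Sum>b\<in>UNIV. LINT w|?M. k' b w *\<^sub>R G p (s - pair_gram S w)))"
    by (simp add: sum.inter_filter[symmetric] finite_permutations)
  also have "\<dots> = (\<Sum>p | p permutes (S - {j}). c p * (LINT w|?M. ?u w *\<^sub>R G p (s - pair_gram S w)))"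
  proof (rule sum.cong)
    fix p
    have "(\<Sum>b\<in>UNIV. LINT w|?M. k' b w *\<^sub>R G p (s - pair_gram S w)) = (LINT w|?M. (k' True w + k' False w) *\<^sub>R G p (s - pair_gram S w))"
      using ik by (simp add: UNIV_bool scaleR_add_left Bochner_Integration.integral_add add.commute)
    also have "\<dots> = 2 * (LINT w|?M. ?u w *\<^sub>R G p (s - pair_gram S w))"
    proof -
      have "(2 * X) *\<^sub>R z = 2 * (X *\<^sub>R z)" for X :: real and z :: complex
        by (simp add: scaleR_conv_of_real)
      then show ?thesis by (simp only: ke integral_mult_right_zero)
    qed
    finally show "(c p / 2) * (\<Sum>b\<in>UNIV. LINT w|?M. k' b w *\<^sub>R G p (s - pair_gram S w)) = c p * (LINT w|?M. ?u w *\<^sub>R G p (s - pair_gram S w))"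
      by simp
  qed (use permutes_remove_iff[OF j] in auto)
  also have "\<dots> = (LINT w|?M. (\<Sum>p | p permutes (S - {j}). c p * (?u w *\<^sub>R G p (s - pair_gram S w))))"
  proof -
    have "integrable ?M (\<lambda>w. ?u w *\<^sub>R G p (s - pair_gram S w))" for p
      by (rule integrable_weighted_pair_gram[OF G s, where C = "1 / \<epsilon>"]) (measurable, rule weight_bounds(4)[OF e])
    then have "(LINT w|?M. (\<Sum>p | p permutes (S - {j}). c p * (?u w *\<^sub>R G p (s - pair_gram S w)))) =
        (\<Sum>p | p permutes (S - {j}). LINT w|?M. c p * (?u w *\<^sub>R G p (s - pair_gram S w)))"
      by (intro Bochner_Integration.integral_sum integrable_mult_right)
    then show ?thesis by (simp only: integral_mult_right_zero)
  qed
  also have "\<dots> = (LINT w|?M. ?u w *\<^sub>R det_op (S - {j}) f (s - pair_gram S w))"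
    unfolding det_op_def c_def G_def
    by (simp only: scaleR_sum_right mult_scaleR_right)
  finally show ?thesis .
qed

section \<open>The fundamental solution\<close>

lemma integral_PiM_lborel_scale:
  fixes G :: "('i \<Rightarrow> real) \<Rightarrow> complex"
  assumes "finite I" and c: "c \<noteq> (0::real)" and [measurable]: "G \<in> borel_measurable (prod_leb I)"
  shows "(LINT x|prod_leb I. G x) = \<bar>c\<bar> ^ card I *\<^sub>R (LINT x|prod_leb I. G (\<lambda>i\<in>I. c * x i))"
proof -
  let ?P = "real_leb I"
  have meas[measurable]: "(\<lambda>x. \<lambda>i\<in>I. c * x i) \<in> measurable ?P ?P"
    by (intro measurable_restrict) auto
  have "(LINT x|?P. G x) = (LINT x|density (distr ?P ?P (\<lambda>x. \<lambda>i\<in>I. c * x i)) (\<lambda>_. ennreal (\<bar>c\<bar> ^ card I)). G x)"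
  proof -
    have "density (distr lborel borel (\<lambda>x. c * x)) (\<lambda>_. ennreal \<bar>c\<bar>) = (lborel :: real measure)"
      using lborel_real_affine[OF c, of 0] by simp
    then show ?thesis
      using PiM_lborel_coordinatewise[OF assms(1), of "\<lambda>_ x. c * x" "ennreal \<bar>c\<bar>"] by (simp add: ennreal_power)
  qed
  also have "\<dots> = (LINT x|distr ?P ?P (\<lambda>x. \<lambda>i\<in>I. c * x i). (\<bar>c\<bar> ^ card I) *\<^sub>R G x)"
    by (rule integral_density) auto
  also have "\<dots> = (LINT x|?P. (\<bar>c\<bar> ^ card I) *\<^sub>R G (\<lambda>i\<in>I. c * x i))"
    by (rule integral_distr) auto
  finally show ?thesis by simp
qed

text \<open>In the variable t = |z|^2 Lebesgue measure of the plane has the constant density \<pi>,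
  and 1 / (t + 1)^2 has integral 1 over t > 0. This is the mass of the weight for \<epsilon> = 1,
  and by scaling for every \<epsilon>.\<close>

lemma cauchy_weight_integral:
  fixes j :: 'm
  defines "M \<equiv> real_leb (pair_index {j})"
  shows "integrable M (\<lambda>e. 1 / (radius2 j e + 1)\<^sup>2)" "(LINT e|M. 1 / (radius2 j e + 1)\<^sup>2) = pi"
proof -
  have rad: "radius2 j e = (\<Sum>i\<in>pair_index {j}. (e i)\<^sup>2)" for e
  proof -
    have "pair_index {j} = {(j, True), (j, False)}" by (auto simp: UNIV_bool)
    then show ?thesis by (simp add: radius2_def)
  qed
  have rm[measurable]: "radius2 j \<in> borel_measurable M"
    unfolding M_def by (rule radius2_measurable) simp
  have "(\<integral>\<^sup>+e. ennreal (1 / (radius2 j e + 1)\<^sup>2) \<partial>M) = (\<integral>\<^sup>+t. ennreal (1 / (t + 1)\<^sup>2) * ennreal (pi powr (card (pair_index {j}) / 2) / Gamma (card (pair_index {j}) / 2) * t powr (card (pair_index {j}) / 2 - 1)) * indicator {0<..} t \<partial>lborel)"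
    unfolding rad M_def by (rule nn_integral_PiM_sum_squares) auto
  also have "\<dots> = (\<integral>\<^sup>+t. ennreal (pi / (t + 1)\<^sup>2) * indicator {0..} t \<partial>lborel)"
    by (intro nn_integral_cong_AE AE_I[of _ _ "{0}"])
       (auto simp: indicator_def ennreal_mult[symmetric] card_cartesian_product)
  also have "\<dots> = ennreal (0 - (- (pi / (0 + 1))))"
  proof (rule nn_integral_FTC_atLeast)
    show "((\<lambda>t. - (pi / (t + 1))) has_real_derivative pi / (t + 1)\<^sup>2) (at t)" if "0 \<le> t" for t :: real
      using that by (auto intro!: derivative_eq_intros simp: power2_eq_square)
    have "filterlim (\<lambda>t::real. t + 1) at_top at_top"
      by (rule filterlim_tendsto_add_at_top[OF tendsto_const filterlim_ident, of 1, unfolded add.commute[of 1]])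
    then have "((\<lambda>t::real. pi / (t + 1)) \<longlongrightarrow> 0) at_top"
      by (intro tendsto_divide_0[OF tendsto_const] filterlim_at_top_imp_at_infinity)
    from tendsto_minus[OF this] show "((\<lambda>t. - (pi / (t + 1))) \<longlongrightarrow> 0) (at_top :: real filter)"
      by simp
  qed auto
  finally have nn: "(\<integral>\<^sup>+e. ennreal (1 / (radius2 j e + 1)\<^sup>2) \<partial>M) = ennreal pi" by simp
  show "integrable M (\<lambda>e. 1 / (radius2 j e + 1)\<^sup>2)"
    by (rule integrableI_nn_integral_finite[OF _ _ nn]) auto
  show "(LINT e|M. 1 / (radius2 j e + 1)\<^sup>2) = pi"
    by (rule integral_eq_nn_integral[THEN trans]) (auto simp: nn)
qed

lemma radius2_AE_nonzero:
  assumes j: "j \<in> (S :: 'm::finite set)"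
  shows "AE w in prod_leb (pair_index S). radius2 j w \<noteq> 0"
proof (rule AE_I)
  interpret finite_product_sigma_finite "\<lambda>_. lborel :: real measure" "pair_index S" by standard simp
  define N where "N = (\<Pi>\<^sub>E p\<in>pair_index S. if p = (j, True) then {0} else UNIV :: real set)"
  show "{w \<in> space (prod_leb (pair_index S)). \<not> radius2 j w \<noteq> 0} \<subseteq> N"
    by (force simp: N_def space_PiM PiE_def radius2_def sum_power2_eq_zero_iff)
  show "N \<in> sets (prod_leb (pair_index S))"
    unfolding N_def by (intro sets_PiM_I_finite) auto
  have "emeasure (prod_leb (pair_index S)) N = (\<Prod>p\<in>pair_index S. emeasure lborel (if p = (j, True) then {0} else UNIV :: real set))"
    unfolding N_def by (rule measure_times) auto
  also have "\<dots> = 0"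
    using j by (intro prod_zero bexI[of _ "(j, True)"]) auto
  finally show "emeasure (prod_leb (pair_index S)) N = 0" .
qed

text \<open>As \<open>\<epsilon> \<rightarrow> 0\<close>, the weights \<open>\<epsilon> / (|z\<^sub>j|\<^sup>2 + \<epsilon>)\<^sup>2\<close> tend to \<open>\<pi>\<close> times the point mass at \<open>z\<^sub>j = 0\<close>.\<close>

lemma integral_det_op_insert:
  fixes f :: "'m::{finite,linorder} sqmat \<Rightarrow> complex"
  assumes f: "smooth_compact f" and s: "s \<in> sym_mats" and j: "j \<notin> T"
  shows "(LINT w|prod_leb (pair_index (insert j T)). det_op (insert j T) f (s - pair_gram (insert j T) w)) =
    pi *\<^sub>R (LINT w|prod_leb (pair_index T). det_op T f (s - pair_gram T w))"
proof -
  define S where "S = insert j T"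
  have jS: "j \<in> S" and ST: "S - {j} = T" using j by (auto simp: S_def)
  let ?MS = "real_leb (pair_index S)"
  let ?MT = "real_leb (pair_index T)"
  let ?MJ = "real_leb (pair_index {j})"
  define F where "F = det_op S f"
  define h where "h = det_op T f"
  have F: "smooth_compact F" and h: "smooth_compact h" unfolding F_def h_def by (intro smooth_compact_det_op f)+
  define \<epsilon> where "\<epsilon> n = inverse (real (Suc n))" for n
  let ?sc = "\<lambda>n x. \<lambda>i\<in>pair_index {j}. sqrt (\<epsilon> n) * x i :: real"
  let ?mg = "merge (pair_index {j}) (pair_index T)"
  let ?wt = "\<lambda>x. 1 / (radius2 j x + 1)\<^sup>2"
  have e: "0 < \<epsilon> n" for n by (simp add: \<epsilon>_def)
  have e0: "\<epsilon> \<longlonglongrightarrow> 0" unfolding \<epsilon>_def by (rule LIMSEQ_inverse_real_of_nat)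
  have mr[measurable]: "radius2 j \<in> borel_measurable ?MS" by (rule radius2_measurable[OF jS])
  have mrJ[measurable]: "radius2 j \<in> borel_measurable ?MJ" by (rule radius2_measurable) simp
  have mF[measurable]: "(\<lambda>w. F (s - pair_gram S w)) \<in> borel_measurable ?MS"
    by (rule smooth_compact_pair_gram_measurable[OF F s])
  have mh[measurable]: "(\<lambda>w. h (s - pair_gram S w)) \<in> borel_measurable ?MS"
    by (rule smooth_compact_pair_gram_measurable[OF h s])
  have iF: "integrable ?MS (\<lambda>w. F (s - pair_gram S w))"
    using integrable_weighted_pair_gram[OF F s, where k = "\<lambda>_. 1" and C = 1] by simp
  have lim1: "(\<lambda>n. LINT w|?MS. (radius2 j w / (radius2 j w + \<epsilon> n)) *\<^sub>R F (s - pair_gram S w)) \<longlonglongrightarrow> (LINT w|?MS. F (s - pair_gram S w))"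
  proof (rule integral_dominated_convergence[where w = "\<lambda>w. norm (F (s - pair_gram S w))"])
    show "AE w in ?MS. (\<lambda>n. (radius2 j w / (radius2 j w + \<epsilon> n)) *\<^sub>R F (s - pair_gram S w)) \<longlonglongrightarrow> F (s - pair_gram S w)"
      using radius2_AE_nonzero[OF jS]
    proof eventually_elim
      case (elim w)
      have "(\<lambda>n. (radius2 j w / (radius2 j w + \<epsilon> n)) *\<^sub>R F (s - pair_gram S w)) \<longlonglongrightarrow> (radius2 j w / (radius2 j w + 0)) *\<^sub>R F (s - pair_gram S w)"
        using elim by (intro tendsto_intros e0) auto
      then show ?case using elim by simp
    qed
    fix n
    show "AE w in ?MS. norm ((radius2 j w / (radius2 j w + \<epsilon> n)) *\<^sub>R F (s - pair_gram S w)) \<le> norm (F (s - pair_gram S w))"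
      unfolding norm_scaleR real_norm_def
      by (intro AE_I2 mult_left_le_one_le norm_ge_zero abs_ge_zero weight_bounds(3)[OF e])
  qed (use iF in \<open>auto intro: integrable_norm\<close>)
  \<comment> \<open>The integral over all variables except z_j, as a function of z_j;
    \<open>\<Psi>0\<close> is its value at z_j = 0.\<close>
  define \<Psi> where "\<Psi> x = (LINT w|?MT. h (s - pair_gram S (?mg (x, w))))" for x
  define \<Psi>0 where "\<Psi>0 = (LINT w|?MT. h (s - pair_gram T w))"
  obtain C where C: "0 < C" "\<And>r. r \<in> sym_mats \<Longrightarrow> norm (h r) \<le> C" using smooth_compact_bounded[OF h] by metis
  define B where "B = support_bound s"
  \<comment> \<open>In the variables of \<open>T\<close> the support is bounded independently of
    z_j, so a multiple of the indicator of \<open>box\<close> dominates the inner integrands for all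
    z_j at once.\<close>
  define box where "box = (\<Pi>\<^sub>E p\<in>pair_index T. {-B..B})"
  interpret MT: finite_product_sigma_finite "\<lambda>_. lborel :: real measure" "pair_index T" by standard simp
  have boxm[measurable]: "box \<in> sets ?MT" unfolding box_def by (intro sets_PiM_I_finite) auto
  have boxf: "emeasure ?MT box < \<infinity>"
  proof -
    have "emeasure ?MT box = (\<Prod>p\<in>pair_index T. emeasure lborel {-B..B})" unfolding box_def by (rule MT.measure_times) simp
    also have "\<dots> < \<infinity>"
      using emeasure_bounded_finite[OF bounded_closed_interval[of "- B" B]] by (auto simp: power_less_top_ennreal)
    finally show ?thesis .
  qed
  have ibox: "integrable ?MT (\<lambda>w. C * indicator box w)"
    using boxf by (intro integrable_mult_right integrable_real_indicator boxm) auto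
  have dj: "pair_index {j} \<inter> pair_index T = {}" using j by auto
  have un: "pair_index {j} \<union> pair_index T = pair_index S" by (auto simp: S_def)
  have mm: "(\<lambda>p. h (s - pair_gram S (?mg p))) \<in> borel_measurable (?MJ \<Otimes>\<^sub>M ?MT)"
    using measurable_compose[OF measurable_merge[of "pair_index {j}" "pair_index T" "\<lambda>_. lborel :: real measure"], unfolded un, OF mh] .
  have mw: "(\<lambda>w. h (s - pair_gram S (?mg (x, w)))) \<in> borel_measurable ?MT" if "x \<in> space ?MJ" for x
    using measurable_compose[OF measurable_Pair1'[OF that] mm] .
  have bnd: "norm (h (s - pair_gram S (?mg (x, w)))) \<le> C * indicator box w" if w: "w \<in> space ?MT" for x w
  proof (cases "h (s - pair_gram S (?mg (x, w))) = 0")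
    case True
    then show ?thesis using C by simp
  next
    case False
    have "w p \<in> {- B..B}" if p: "p \<in> pair_index T" for p
    proof -
      have "p \<in> pair_index S" "p \<notin> pair_index {j}" using p j by (auto simp: S_def)
      then have "?mg (x, w) p = w p" using p by (auto simp: merge_def)
      with smooth_compact_pair_gram_support[OF h s False \<open>p \<in> pair_index S\<close>] have "\<bar>w p\<bar> < B" by (simp add: B_def)
      then show ?thesis by (simp add: abs_less_iff)
    qed
    then have "w \<in> box" using w unfolding box_def space_PiM PiE_iff by blast
    moreover have "norm (h (s - pair_gram S (?mg (x, w)))) \<le> C"
      by (intro C sym_mats_diff s pair_gram_sym_mats)
    ultimately show ?thesis by simp
  qed
  have \<Psi>m[measurable]: "\<Psi> \<in> borel_measurable ?MJ"
    unfolding \<Psi>_def[abs_def] by (rule MT.borel_measurable_lebesgue_integral) (use mm in \<open>simp add: case_prod_beta'\<close>)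
  have \<Psi>b: "norm (\<Psi> x) \<le> C * measure ?MT box" if x: "x \<in> space ?MJ" for x
  proof -
    have "norm (\<Psi> x) \<le> (LINT w|?MT. C * indicator box w)"
    proof -
      have i: "integrable ?MT (\<lambda>w. h (s - pair_gram S (?mg (x, w))))"
      proof (rule Bochner_Integration.integrable_bound[OF ibox mw[OF x]], rule AE_I2)
        fix w assume "w \<in> space ?MT"
        from bnd[OF this, of x] show "norm (h (s - pair_gram S (?mg (x, w)))) \<le> norm (C * indicator box w :: real)"
          by simp
      qed
      have "norm (\<Psi> x) \<le> (LINT w|?MT. norm (h (s - pair_gram S (?mg (x, w)))))"
        unfolding \<Psi>_def by (rule integral_norm_bound)
      also have "\<dots> \<le> (LINT w|?MT. C * indicator box w)"
        by (intro integral_mono integrable_norm i ibox bnd)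
      finally show ?thesis .
    qed
    also have "\<dots> = C * measure ?MT box" by simp
    finally show ?thesis .
  qed
  have scale_space: "(\<lambda>i\<in>pair_index {j}. c * x i) \<in> space ?MJ" for c and x :: "'m \<times> bool \<Rightarrow> real"
    by (auto simp: space_PiM)
  have \<Psi>lim: "(\<lambda>n. \<Psi> (?sc n x)) \<longlonglongrightarrow> \<Psi>0" for x
    unfolding \<Psi>_def \<Psi>0_def
  proof (rule integral_dominated_convergence[OF _ _ ibox])
    show "(\<lambda>w. h (s - pair_gram T w)) \<in> borel_measurable ?MT" by (rule smooth_compact_pair_gram_measurable[OF h s])
    fix n
    show "(\<lambda>w. h (s - pair_gram S (?mg (?sc n x, w)))) \<in> borel_measurable ?MT"
      by (rule mw[OF scale_space])
    show "AE w in ?MT. norm (h (s - pair_gram S (?mg (?sc n x, w)))) \<le> C * indicator box w"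
      by (intro AE_I2 bnd)
  next
    show "AE w in ?MT. (\<lambda>n. h (s - pair_gram S (?mg (?sc n x, w)))) \<longlonglongrightarrow> h (s - pair_gram T w)"
    proof (intro AE_I2 continuous_on_tendsto_compose[OF smooth_compact_continuous[OF h]])
      fix w :: "'m \<times> bool \<Rightarrow> real"
      define m where "m c = ?mg (\<lambda>i\<in>pair_index {j}. c * x i, w)" for c
      have mc: "m c p = (if fst p = j then c * x p else w p)" if "fst p \<in> S" for c p
        using that j by (cases p) (auto simp: m_def merge_def S_def)
      have sq: "(\<lambda>n. sqrt (\<epsilon> n)) \<longlonglongrightarrow> 0" using tendsto_real_sqrt[OF e0] by simp
      have ml: "(\<lambda>n. m (sqrt (\<epsilon> n)) p) \<longlonglongrightarrow> m 0 p" if "fst p \<in> S" for p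
        unfolding mc[OF that] using tendsto_mult_right[OF sq, of "x p"] by (cases "fst p = j") auto
      have "(\<lambda>n. pair_gram S (m (sqrt (\<epsilon> n)))) \<longlonglongrightarrow> pair_gram S (m 0)"
      proof (intro vec_tendstoI)
        fix a b
        show "(\<lambda>n. pair_gram S (m (sqrt (\<epsilon> n))) $ a $ b) \<longlonglongrightarrow> pair_gram S (m 0) $ a $ b"
          by (cases "a \<in> S \<and> b \<in> S") (auto simp: pair_gram_def intro!: tendsto_add tendsto_mult ml)
      qed
      moreover have "pair_gram S (m 0) = pair_gram T w"
        using j by (auto simp: pair_gram_def vec_eq_iff mc S_def)
      ultimately show "(\<lambda>n. s - pair_gram S (?mg (?sc n x, w))) \<longlonglongrightarrow> s - pair_gram T w"
        unfolding m_def by (intro tendsto_intros) simp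
    qed (auto intro!: sym_mats_diff s pair_gram_sym_mats always_eventually)
  qed
  \<comment> \<open>Dilation of z_j by sqrt \<epsilon>: two real variables give the Jacobian
    \<epsilon>, which turns the weight into that for \<epsilon> = 1 and moves \<epsilon> into the
    argument of \<open>\<Psi>\<close>.\<close>
  have Y: "(LINT w|?MS. (\<epsilon> n / (radius2 j w + \<epsilon> n)\<^sup>2) *\<^sub>R h (s - pair_gram S w)) =
      (LINT x|?MJ. ?wt x *\<^sub>R \<Psi> (?sc n x))" for n
  proof -
    have wt: "\<epsilon> n * (\<epsilon> n / (radius2 j (?sc n x) + \<epsilon> n)\<^sup>2) = 1 / (radius2 j x + 1)\<^sup>2" for x
    proof -
      have "radius2 j (?sc n x) + \<epsilon> n = \<epsilon> n * (radius2 j x + 1)"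
        using e[of n] by (simp add: radius2_def power_mult_distrib algebra_simps)
      then show ?thesis using e[of n] by (simp add: power_mult_distrib power2_eq_square)
    qed
    have "integrable ?MS (\<lambda>w. (\<epsilon> n / (radius2 j w + \<epsilon> n)\<^sup>2) *\<^sub>R h (s - pair_gram S w))"
      by (rule integrable_weighted_pair_gram[OF h s, where C = "1 / \<epsilon> n"]) (measurable, rule weight_bounds(4)[OF e])
    then have "(LINT w|?MS. (\<epsilon> n / (radius2 j w + \<epsilon> n)\<^sup>2) *\<^sub>R h (s - pair_gram S w)) =
       (LINT x|?MJ. (LINT w|?MT. (\<epsilon> n / (radius2 j (?mg (x, w)) + \<epsilon> n)\<^sup>2) *\<^sub>R h (s - pair_gram S (?mg (x, w)))))"
      using lborel_PiM.product_integral_fold[OF dj, of "\<lambda>w. (\<epsilon> n / (radius2 j w + \<epsilon> n)\<^sup>2) *\<^sub>R h (s - pair_gram S w)"] by (simp add: un)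
    also have "\<dots> = (LINT x|?MJ. (\<epsilon> n / (radius2 j x + \<epsilon> n)\<^sup>2) *\<^sub>R \<Psi> x)"
      by (simp add: \<Psi>_def radius2_def merge_def)
    also have "\<dots> = \<bar>sqrt (\<epsilon> n)\<bar> ^ card (pair_index {j}) *\<^sub>R (LINT x|?MJ. (\<epsilon> n / (radius2 j (?sc n x) + \<epsilon> n)\<^sup>2) *\<^sub>R \<Psi> (?sc n x))"
      by (rule integral_PiM_lborel_scale) (use e[of n] in auto)
    also have "\<bar>sqrt (\<epsilon> n)\<bar> ^ card (pair_index {j}) = \<epsilon> n"
      using e[of n] by (simp add: card_cartesian_product)
    also have "\<epsilon> n *\<^sub>R (LINT x|?MJ. (\<epsilon> n / (radius2 j (?sc n x) + \<epsilon> n)\<^sup>2) *\<^sub>R \<Psi> (?sc n x)) =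
       (LINT x|?MJ. ?wt x *\<^sub>R \<Psi> (?sc n x))"
      by (simp only: integral_scaleR_right[symmetric] scaleR_scaleR wt)
    finally show ?thesis .
  qed
  have lim2: "(\<lambda>n. LINT x|?MJ. ?wt x *\<^sub>R \<Psi> (?sc n x)) \<longlonglongrightarrow> (LINT x|?MJ. ?wt x *\<^sub>R \<Psi>0)"
  proof (rule integral_dominated_convergence[where w = "\<lambda>x. ?wt x * (C * measure ?MT box)"])
    show "integrable ?MJ (\<lambda>x. ?wt x * (C * measure ?MT box))"
      by (intro integrable_mult_left cauchy_weight_integral)
    fix n
    have [measurable]: "(\<lambda>x. \<lambda>i\<in>pair_index {j}. sqrt (\<epsilon> n) * x i) \<in> measurable ?MJ ?MJ"
      by (intro measurable_restrict) auto
    show "(\<lambda>x. ?wt x *\<^sub>R \<Psi> (?sc n x)) \<in> borel_measurable ?MJ"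
      by measurable
    show "AE x in ?MJ. norm (?wt x *\<^sub>R \<Psi> (?sc n x)) \<le> ?wt x * (C * measure ?MT box)"
    proof (rule AE_I2)
      fix x
      show "norm (?wt x *\<^sub>R \<Psi> (?sc n x)) \<le> ?wt x * (C * measure ?MT box)"
        unfolding norm_scaleR using \<Psi>b[OF scale_space, of "sqrt (\<epsilon> n)" x]
        by (intro mult_mono) auto
    qed
  next
    show "AE x in ?MJ. (\<lambda>n. ?wt x *\<^sub>R \<Psi> (?sc n x)) \<longlonglongrightarrow> ?wt x *\<^sub>R \<Psi>0"
      by (intro AE_I2 tendsto_intros \<Psi>lim)
  qed measurable
  have "(LINT x|?MJ. ?wt x *\<^sub>R \<Psi>0) = pi *\<^sub>R \<Psi>0"
    using cauchy_weight_integral[where j = j] by (subst integral_scaleR_left) auto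
  moreover have "(LINT w|?MS. (radius2 j w / (radius2 j w + \<epsilon> n)) *\<^sub>R F (s - pair_gram S w)) = (LINT w|?MS. (\<epsilon> n / (radius2 j w + \<epsilon> n)\<^sup>2) *\<^sub>R h (s - pair_gram S w))" for n
    unfolding F_def h_def using integral_det_op_regularized[OF f s jS e] by (simp add: ST)
  ultimately have "(LINT w|?MS. F (s - pair_gram S w)) = pi *\<^sub>R \<Psi>0"
    using LIMSEQ_unique[OF lim1] lim2 by (simp add: Y)
  then show ?thesis by (simp add: F_def \<Psi>0_def h_def S_def)
qed

text \<open>For \<open>S = UNIV\<close> this makes \<pi>^{-m} times the distribution of Re zz^* a
  fundamental solution of \<open>D_plus\<close>.\<close>

theorem integral_det_op_pair_gram:
  fixes f :: "'m::{finite,linorder} sqmat \<Rightarrow> complex"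
  assumes f: "smooth_compact f" and s: "s \<in> sym_mats"
  shows "(LINT w|prod_leb (pair_index S). det_op S f (s - pair_gram S w)) = (pi ^ card S) *\<^sub>R f s"
  using finite[of S]
proof (induction S rule: finite_induct)
  case empty
  have "pair_gram {} w = 0" for w :: "'m \<times> bool \<Rightarrow> real" by (simp add: pair_gram_def vec_eq_iff)
  then show ?case by (simp add: det_op_empty PiM_empty lebesgue_integral_count_space_finite)
next
  case (insert j T)
  then show ?case using integral_det_op_insert[OF f s insert(2)] by (simp add: mult.commute)
qed

section \<open>The fractional integrals at half-integers\<close>

text \<open>The entry in row \<open>b\<close> and column \<open>a\<close> has the key
  \<open>(a, b)\<close>. For two rows indexed by \<open>bool\<close> these are the coordinates of
  \<open>pair_gram\<close>.\<close>

lemma lborel_matrix_eq_distr_PiM: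
  "distr (prod_leb UNIV) borel (\<lambda>w. \<chi> b a. w (a, b)) = (lborel :: ((real, 'm::finite) vec, 'k::finite) vec measure)"
proof (rule lborel_eqI[symmetric])
  let ?P = "real_leb (UNIV :: ('m \<times> 'k) set)"
  interpret finite_product_sigma_finite "\<lambda>_. lborel :: real measure" "UNIV :: ('m \<times> 'k) set"
    by standard simp
  have [measurable]: "(\<lambda>w. \<chi> b a. w (a, b)) \<in> measurable ?P (borel :: ((real, 'm) vec, 'k) vec measure)"
    by (intro borel_measurable_vecI) simp
  show "sets (distr ?P borel (\<lambda>w. \<chi> b a. w (a, b))) = sets borel" by simp
  fix l u :: "((real, 'm) vec, 'k) vec" assume lu: "\<And>b. b \<in> Basis \<Longrightarrow> l \<bullet> b \<le> u \<bullet> b"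
  have ax: "axis i (axis j 1) \<in> (Basis :: ((real, 'm) vec, 'k) vec set)" for i j
    by (simp add: axis_in_Basis_iff)
  have lu': "l $ b $ a \<le> u $ b $ a" for a b
    using lu[OF ax[of b a]] by (simp add: inner_axis)
  have bij: "bij_betw (\<lambda>(a, b). axis b (axis a 1)) UNIV (Basis :: ((real, 'm) vec, 'k) vec set)"
    by (auto simp: bij_betw_def inj_on_def Basis_vec_def axis_eq_axis)
  have "(\<lambda>w. \<chi> b a. w (a, b)) -` box l u \<inter> space ?P = PiE UNIV (\<lambda>p. {l $ snd p $ fst p <..< u $ snd p $ fst p})"
    by (auto simp: space_PiM PiE_iff box_def Basis_vec_def inner_axis)
  then have "emeasure (distr ?P borel (\<lambda>w. \<chi> b a. w (a, b))) (box l u) = emeasure ?P (PiE UNIV (\<lambda>p. {l $ snd p $ fst p <..< u $ snd p $ fst p}))"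
    by (simp add: emeasure_distr)
  also have "\<dots> = (\<Prod>p\<in>UNIV. emeasure lborel {l $ snd p $ fst p <..< u $ snd p $ fst p})"
    by (rule measure_times) simp
  also have "\<dots> = (\<Prod>p\<in>UNIV. ennreal ((u - l) \<bullet> axis (snd p) (axis (fst p) 1)))"
    using lu' by (intro prod.cong) (auto simp: inner_axis)
  also have "\<dots> = ennreal (\<Prod>p\<in>UNIV. (u - l) \<bullet> axis (snd p) (axis (fst p) 1))"
    using lu' by (intro prod_ennreal) (auto simp: inner_axis)
  also have "(\<Prod>p\<in>UNIV. (u - l) \<bullet> axis (snd p) (axis (fst p) 1)) = (\<Prod>b\<in>Basis. (u - l) \<bullet> b)"
    using prod.reindex_bij_betw[OF bij, of "\<lambda>b. (u - l) \<bullet> b"] by (simp add: split_def)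
  finally show "emeasure (distr ?P borel (\<lambda>w. \<chi> b a. w (a, b))) (box l u) = ennreal (\<Prod>b\<in>Basis. (u - l) \<bullet> b)" .
qed

lemma rows_gram_sym_mats: "rows_gram I x \<in> sym_mats"
  unfolding rows_gram_def by (intro sym_mats_sum) (simp add: sym_mats_def)

text \<open>Continuity of \<open>f\<close> is known on the symmetric matrices only; the cutoff makes
  r -> f(s - r) Borel on the space of all matrices, where the distributions of Gram matrices
  live.\<close>

definition reflected :: "('m::finite sqmat \<Rightarrow> complex) \<Rightarrow> 'm sqmat \<Rightarrow> 'm sqmat \<Rightarrow> complex" where
  "reflected f s r = (if r \<in> sym_mats then f (s - r) else 0)"

lemma borel_measurable_reflected:
  assumes f: "smooth_compact f" and s: "s \<in> sym_mats"
  shows "reflected f s \<in> borel_measurable borel"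
proof -
  have "continuous_on sym_mats (\<lambda>r. f (s - r))"
    by (rule continuous_on_compose2[OF smooth_compact_continuous[OF f]]) (auto intro!: continuous_intros sym_mats_diff s)
  then have "(\<lambda>r. indicator sym_mats r *\<^sub>R f (s - r)) \<in> borel_measurable borel"
    by (intro borel_measurable_continuous_on_indicator borel_closed closed_sym_mats)
  moreover have "(\<lambda>r. indicator sym_mats r *\<^sub>R f (s - r)) = reflected f s"
    by (auto simp: reflected_def fun_eq_iff)
  ultimately show ?thesis by simp
qed

text \<open>Only the number of rows matters. This links the index types \<open>'k\<close> and
  \<open>bool\<close> with the sets \<open>{..<n}\<close> of natural numbers.\<close>

lemma distr_rows_gram_cong:
  assumes "finite I" "finite J" "card I = card J"
  shows "distr (prod_leb I) borel (rows_gram I) = (distr (prod_leb J) borel (rows_gram J) :: 'n::finite sqmat measure)"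
proof (rule measure_eqI)
  fix A assume "A \<in> sets (distr (prod_leb I) borel (rows_gram I) :: 'n sqmat measure)"
  then have A[measurable]: "A \<in> sets (borel :: 'n sqmat measure)" by simp
  have *: "emeasure (distr (prod_leb K) borel (rows_gram K)) A = (gram_op ^^ card K) (indicator A) 0"
    if "finite K" for K :: "'k set"
  proof -
    have "emeasure (distr (prod_leb K) borel (rows_gram K)) A = (\<integral>\<^sup>+r. indicator A r \<partial>distr (prod_leb K) borel (rows_gram K))"
      by simp
    also have "\<dots> = (\<integral>\<^sup>+x. indicator A (0 + rows_gram K x) \<partial>prod_leb K)"
      by (subst nn_integral_distr) auto
    also have "\<dots> = (gram_op ^^ card K) (indicator A) 0"
      by (rule nn_integral_rows_gram) (use that in auto)
    finally show ?thesis .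
  qed
  show "emeasure (distr (prod_leb I) borel (rows_gram I)) A = emeasure (distr (prod_leb J) borel (rows_gram J)) A"
    using *[OF assms(1)] *[OF assms(2)] assms(3) by simp
qed simp

lemma integral_rows_gram_cong:
  fixes f :: "'m::finite sqmat \<Rightarrow> complex"
  assumes IJ: "finite I" "finite J" "card I = card J" and f: "smooth_compact f" and s: "s \<in> sym_mats"
  shows "(LINT x|prod_leb I. f (s - rows_gram I x)) = (LINT x|prod_leb J. f (s - rows_gram J x))"
proof -
  note [measurable] = borel_measurable_reflected[OF f s]
  have *: "(LINT x|prod_leb K. f (s - rows_gram K x)) = (LINT r|distr (prod_leb K) borel (rows_gram K). reflected f s r)"
    for K :: "'k set"
    by (subst integral_distr) (auto simp: reflected_def rows_gram_sym_mats)
  show ?thesis unfolding * distr_rows_gram_cong[OF IJ] ..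
qed

lemma integral_rows_gram_lborel:
  fixes f :: "'m::finite sqmat \<Rightarrow> complex"
  assumes f: "smooth_compact f" and s: "s \<in> sym_mats"
  shows "(LINT x|prod_leb (UNIV :: 'k::finite set). f (s - rows_gram UNIV x)) =
    (LINT \<omega>|(lborel :: ((real, 'm) vec, 'k) vec measure). f (s - transpose \<omega> ** \<omega>))"
proof -
  note [measurable] = borel_measurable_reflected[OF f s]
  have sym: "transpose \<omega> ** \<omega> \<in> sym_mats" for \<omega> :: "((real, 'm) vec, 'k) vec"
    by (simp add: sym_mats_def matrix_transpose_mul)
  have [measurable]: "(\<lambda>\<omega> :: ((real, 'm) vec, 'k) vec. transpose \<omega> ** \<omega>) \<in> borel_measurable borel"
    by (intro borel_measurable_continuous_onI continuous_intros)
  have [measurable]: "vec_lambda \<in> measurable (prod_leb UNIV) (borel :: (((real, 'm) vec, 'k) vec) measure)"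
    by (rule borel_measurable_vecI) simp
  have "transpose (vec_lambda x) ** vec_lambda x = rows_gram UNIV x" for x :: "'k \<Rightarrow> (real, 'm) vec"
    by (simp add: rows_gram_def vec_eq_iff matrix_matrix_mult_def sum_component)
  then have "(LINT x|prod_leb (UNIV :: 'k set). f (s - rows_gram UNIV x)) =
      (LINT x|prod_leb (UNIV :: 'k set). reflected f s (transpose (vec_lambda x) ** vec_lambda x))"
    by (simp add: reflected_def rows_gram_sym_mats)
  also have "\<dots> = (LINT \<omega>|(lborel :: ((real, 'm) vec, 'k) vec measure). reflected f s (transpose \<omega> ** \<omega>))"
    by (subst lborel_vec_eq_distr_PiM, subst integral_distr) auto
  finally show ?thesis by (simp add: reflected_def sym)
qed

lemma integral_D_plus_two_rows:
  fixes f :: "'m::{finite,linorder} sqmat \<Rightarrow> complex"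
  assumes f: "smooth_compact f" and s: "s \<in> sym_mats" and J: "finite J" "card J = 2"
  shows "(LINT x|prod_leb J. D_plus f (s - rows_gram J x)) = (pi ^ CARD('m)) *\<^sub>R f s"
proof -
  have D: "smooth_compact (D_plus f)" unfolding D_plus_eq_det_op by (rule smooth_compact_det_op[OF f])
  note [measurable] = borel_measurable_reflected[OF D s]
  let ?B = "lborel :: ((real, 'm) vec, bool) vec measure"
  let ?P = "real_leb (UNIV :: ('m \<times> bool) set)"
  have [measurable]: "(\<lambda>\<omega> :: ((real, 'm) vec, bool) vec. transpose \<omega> ** \<omega>) \<in> borel_measurable borel"
    by (intro borel_measurable_continuous_onI continuous_intros)
  have [measurable]: "(\<lambda>w. \<chi> b a. w (a, b)) \<in> measurable ?P (borel :: ((real, 'm) vec, bool) vec measure)"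
    by (intro borel_measurable_vecI) simp
  have sym: "transpose \<omega> ** \<omega> \<in> sym_mats" for \<omega> :: "((real, 'm) vec, bool) vec"
    by (simp add: sym_mats_def matrix_transpose_mul)
  have pg: "transpose (\<chi> b a. w (a, b)) ** (\<chi> b a. w (a, b)) = pair_gram UNIV w" for w :: "'m \<times> bool \<Rightarrow> real"
    by (simp add: vec_eq_iff matrix_matrix_mult_def pair_gram_def UNIV_bool add.commute)
  have "(LINT x|prod_leb J. D_plus f (s - rows_gram J x)) = (LINT x|prod_leb (UNIV :: bool set). D_plus f (s - rows_gram UNIV x))"
    by (rule integral_rows_gram_cong[OF J(1) _ _ D s]) (use J in auto)
  also have "\<dots> = (LINT \<omega>|?B. D_plus f (s - transpose \<omega> ** \<omega>))"
    by (rule integral_rows_gram_lborel[OF D s])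
  also have "\<dots> = (LINT \<omega>|distr ?P borel (\<lambda>w. \<chi> b a. w (a, b)). reflected (D_plus f) s (transpose \<omega> ** \<omega>))"
    unfolding lborel_matrix_eq_distr_PiM by (simp add: reflected_def sym)
  also have "\<dots> = (LINT w|?P. reflected (D_plus f) s (pair_gram UNIV w))"
    by (subst integral_distr) (auto simp: pg)
  also have "\<dots> = (LINT w|?P. det_op UNIV f (s - pair_gram UNIV w))"
    by (simp add: reflected_def pair_gram_sym_mats D_plus_eq_det_op)
  also have "\<dots> = (pi ^ CARD('m)) *\<^sub>R f s"
    using integral_det_op_pair_gram[OF f s, of UNIV] by simp
  finally show ?thesis .
qed

lemma integrable_rows_gram:
  fixes f :: "'m::finite sqmat \<Rightarrow> complex"
  assumes I: "finite I" and f: "smooth_compact f" and s: "s \<in> sym_mats"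
  shows "integrable (prod_leb I) (\<lambda>x. f (s - rows_gram I x))"
proof -
  obtain C where C: "0 < C" "\<And>r. r \<in> sym_mats \<Longrightarrow> norm (f r) \<le> C" using smooth_compact_bounded[OF f] by metis
  show ?thesis
  proof (rule integrable_PiM_bounded_support[OF I])
    show "(\<lambda>x. f (s - rows_gram I x)) \<in> borel_measurable (prod_leb I)"
      by (rule smooth_compact_measurable[OF f]) (auto intro: sym_mats_diff s rows_gram_sym_mats)
    show "norm (f (s - rows_gram I x)) \<le> C" for x by (intro C sym_mats_diff s rows_gram_sym_mats)
    fix x :: "'a \<Rightarrow> (real, 'm) vec" and i assume i: "i \<in> I" and B: "(\<Sum>a\<in>(UNIV :: 'm set). support_bound s) < norm (x i)"
    show "f (s - rows_gram I x) = 0"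
    proof (rule ccontr)
      assume nz: "f (s - rows_gram I x) \<noteq> 0"
      have pd: "s - rows_gram I x \<in> pd_cone"
        by (rule smooth_compact_nonzero_pd[OF f sym_mats_diff[OF s rows_gram_sym_mats] nz])
      have "\<bar>x i $ a\<bar> \<le> support_bound s" for a
      proof -
        have "(x i $ a)\<^sup>2 \<le> (\<Sum>k\<in>I. (x k $ a)\<^sup>2)" by (rule member_le_sum) (use i I in auto)
        also have "\<dots> < s $ a $ a"
          using pd_cone_diag_pos[OF pd, of a] by (simp add: rows_gram_def sum_component power2_eq_square)
        finally show ?thesis using abs_le_support_bound[of "x i $ a" s a] by simp
      qed
      then have "norm (x i) \<le> (\<Sum>a\<in>(UNIV :: 'm set). support_bound s)"
        using norm_le_l1_cart[of "x i"] by (meson order_trans sum_mono)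
      then show False using B by simp
    qed
  qed
qed

text \<open>The Gram matrix of the union is the sum of the two, and the integral over
  \<open>J\<close> is evaluated at the point \<open>s - rows_gram I x\<close>. This point is
  symmetric but may lie outside the cone, which is why the identities are proved for all symmetric
  \<open>s\<close>.\<close>

lemma integral_D_plus_rows:
  fixes f :: "'m::{finite,linorder} sqmat \<Rightarrow> complex"
  assumes f: "smooth_compact f" and s: "s \<in> sym_mats" and IJ: "finite I" "finite J" "card J = 2" "I \<inter> J = {}"
  shows "(LINT x|prod_leb (I \<union> J). D_plus f (s - rows_gram (I \<union> J) x)) =
    (pi ^ CARD('m)) *\<^sub>R (LINT x|prod_leb I. f (s - rows_gram I x))"
proof -
  have D: "smooth_compact (D_plus f)" unfolding D_plus_eq_det_op by (rule smooth_compact_det_op[OF f])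
  have rg: "rows_gram (I \<union> J) (merge I J (x, y)) = rows_gram I x + rows_gram J y" for x y :: "'a \<Rightarrow> (real, 'm) vec"
  proof -
    have "rows_gram (I \<union> J) (merge I J (x, y)) = rows_gram I (merge I J (x, y)) + rows_gram J (merge I J (x, y))"
      unfolding rows_gram_def by (rule sum.union_disjoint) (use IJ in auto)
    moreover have "rows_gram I (merge I J (x, y)) = rows_gram I x"
      unfolding rows_gram_def by (intro sum.cong) (auto simp: merge_def)
    moreover have "rows_gram J (merge I J (x, y)) = rows_gram J y"
      unfolding rows_gram_def using IJ(4) by (intro sum.cong) (auto simp: merge_def)
    ultimately show ?thesis by simp
  qed
  have "(LINT x|prod_leb (I \<union> J). D_plus f (s - rows_gram (I \<union> J) x)) =
      (LINT x|prod_leb I. (LINT y|prod_leb J. D_plus f (s - rows_gram (I \<union> J) (merge I J (x, y)))))"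
    by (rule lborel_PiM.product_integral_fold[OF IJ(4,1,2)]) (rule integrable_rows_gram[OF _ D s], use IJ in auto)
  also have "\<dots> = (LINT x|prod_leb I. (pi ^ CARD('m)) *\<^sub>R f (s - rows_gram I x))"
  proof (rule Bochner_Integration.integral_cong[OF refl])
    fix x :: "'a \<Rightarrow> (real, 'm) vec"
    have "s - rows_gram I x \<in> sym_mats" by (intro sym_mats_diff s rows_gram_sym_mats)
    from integral_D_plus_two_rows[OF f this IJ(2,3)]
    show "(LINT y|prod_leb J. D_plus f (s - rows_gram (I \<union> J) (merge I J (x, y)))) = (pi ^ CARD('m)) *\<^sub>R f (s - rows_gram I x)"
      by (simp add: rg diff_diff_eq)
  qed
  finally show ?thesis by simp
qed

section \<open>Iteration of the operator and identification of the fractional integral\<close>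

lemma smooth_compact_D_plus_funpow:
  "smooth_compact f \<Longrightarrow> smooth_compact ((D_plus ^^ l) f)"
  by (induction l) (auto simp: D_plus_eq_det_op intro: smooth_compact_det_op)

lemma integral_D_plus_funpow_rows:
  fixes f :: "'m::{finite,linorder} sqmat \<Rightarrow> complex"
  assumes f: "smooth_compact f" and s: "s \<in> sym_mats"
  shows "(LINT x|prod_leb {..<k + 2 * l}. (D_plus ^^ l) f (s - rows_gram {..<k + 2 * l} x)) =
    (pi ^ (CARD('m) * l)) *\<^sub>R (LINT x|prod_leb {..<k}. f (s - rows_gram {..<k} x))"
proof (induction l)
  case (Suc l)
  let ?J = "{k + 2 * l, Suc (k + 2 * l)}"
  have un: "{..<k + 2 * Suc l} = {..<k + 2 * l} \<union> ?J" by auto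
  show ?case
    using integral_D_plus_rows[OF smooth_compact_D_plus_funpow[OF f, of l] s, of "{..<k + 2 * l}" ?J] Suc
    unfolding un by (simp add: power_add mult.commute)
qed simp

text \<open>The fractional integral applies the operator to \<open>f\<close> itself, whose values
  off the cone are arbitrary. As the cone is relatively open, the result on the cone is that for the
  extension by zero.\<close>

lemma D_plus_cong_pd_cone:
  assumes "\<And>r. r \<in> pd_cone \<Longrightarrow> f r = g r" "r \<in> pd_cone"
  shows "D_plus f r = D_plus g r"
proof -
  obtain U :: "'a sqmat set" where U: "open U" "pd_cone = sym_mats \<inter> U" by (rule pd_cone_open_Int)
  have "sym_partials ps f r = sym_partials ps g r" for ps
    by (rule sym_partials_cong_open[OF U(1)]) (use assms U in auto)
  then show ?thesis by (simp add: D_plus_def)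
qed

lemma D_plus_funpow_cong_pd_cone:
  assumes "\<And>r. r \<in> pd_cone \<Longrightarrow> f r = g r" "r \<in> pd_cone"
  shows "(D_plus ^^ l) f r = (D_plus ^^ l) g r"
  using assms(2) by (induction l arbitrary: r) (auto intro: assms(1) D_plus_cong_pd_cone)

lemma Siegel_Gamma_half:
  "Siegel_Gamma TYPE('m::finite) (of_nat n / 2) * complex_of_real (wishart_const CARD('m) n) =
     complex_of_real (pi powr (real n * real CARD('m) / 2))" if "CARD('m) \<le> n"
proof -
  let ?m = "CARD('m)"
  define X where "X = pi powr (real ?m * (real ?m - 1) / 4) * (\<Prod>j<?m. Gamma ((real n - real j) / 2))"
  have X: "X > 0" unfolding X_def using that by (intro mult_pos_pos prod_pos) auto
  have "Gamma (complex_of_nat n / 2 - of_nat j / 2) = complex_of_real (Gamma ((real n - real j) / 2))" for j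
    by (subst Gamma_complex_of_real[symmetric]) (simp add: diff_divide_distrib)
  then have "Siegel_Gamma TYPE('m) (of_nat n / 2) = complex_of_real X"
    by (simp add: Siegel_Gamma_def X_def)
  moreover have "wishart_const ?m n = pi powr (real n * real ?m / 2) / X"
    by (simp add: wishart_const_def X_def)
  ultimately show ?thesis using X by simp
qed

text \<open>The reflection r -> s - r turns the fractional integral into an integral against the
  density of the Gram matrix of \<open>n\<close> rows, and \<open>wishart_const\<close> cancels the
  Gamma factor. \<open>g\<close> is controlled on the cone only; \<open>g0\<close> is its smooth
  extension with compact support.\<close>

lemma GG_integral_half:
  fixes g g0 :: "'m::{finite,linorder} sqmat \<Rightarrow> complex"
  assumes g0: "smooth_compact g0" and eq: "\<And>r. r \<in> pd_cone \<Longrightarrow> g r = g0 r"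
    and s: "s \<in> pd_cone" and n: "CARD('m) \<le> n"
  shows "GG_integral (of_nat n / 2) g s =
    complex_of_real (pi powr (- (real n * real CARD('m) / 2))) * (LINT x|prod_leb {..<n}. g0 (s - rows_gram {..<n} x))"
proof -
  have ss: "s \<in> sym_mats" using s pd_cone_subset_sym_mats by auto
  note [measurable] = borel_measurable_reflected[OF g0 ss] pd_cone_borel
  define e where "e = (real n - real CARD('m) - 1) / 2"
  define W where "W = wishart_const CARD('m) n"
  have W: "W > 0" unfolding W_def by (rule wishart_const_pos[OF n])
  define H where "H r = indicator pd_cone r *\<^sub>R (reflected g0 s r * complex_of_real (det r powr e))" for r
  have Hm[measurable]: "H \<in> borel_measurable borel" unfolding H_def by measurable
  have sr: "s - r \<in> sym_mats \<longleftrightarrow> r \<in> sym_mats" for r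
    using sym_mats_diff[OF ss, of r] sym_mats_diff[OF ss, of "s - r"] by auto
  \<comment> \<open>In \<open>H (s - r)\<close> the condition \<open>r \<in> pd_cone\<close> has
    become the vanishing of \<open>g0\<close> off the cone.\<close>
  have "indicator {r \<in> pd_cone. r \<prec>\<^sub>P s} r *\<^sub>R (g r * complex_of_real \<bar>det (s - r)\<bar> powr (of_nat n / 2 - complex_of_real (dd TYPE('m)))) = H (s - r)" for r
  proof (cases "r \<in> pd_cone \<and> s - r \<in> pd_cone")
    case True
    have "of_nat n / 2 - complex_of_real (dd TYPE('m)) = complex_of_real e"
      by (simp add: dd_def e_def field_simps)
    then have "complex_of_real \<bar>det (s - r)\<bar> powr (of_nat n / 2 - complex_of_real (dd TYPE('m))) = complex_of_real (det (s - r) powr e)"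
      using pd_cone_det_pos[of "s - r"] True by (simp add: powr_of_real)
    moreover have "s - r \<in> sym_mats" using True pd_cone_subset_sym_mats by auto
    ultimately show ?thesis using True eq[of r] by (simp add: H_def reflected_def pd_less_def)
  next
    case False
    have "reflected g0 s (s - r) = 0" if "r \<notin> pd_cone"
      using smooth_compact_nonzero_pd[OF g0, of r] that sr[of r] by (auto simp: reflected_def)
    then show ?thesis using False by (auto simp: H_def pd_less_def)
  qed
  then have "GG_integral (of_nat n / 2) g s = 1 / Siegel_Gamma TYPE('m) (of_nat n / 2) * (LINT r|sym_lebesgue. H (s - r))"
    by (simp add: GG_integral_def set_lebesgue_integral_def)
  also have "(LINT r|sym_lebesgue. H (s - r)) = (LINT r|distr sym_lebesgue borel (\<lambda>r. s + (- 1) *\<^sub>R r). H r)"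
    by (subst integral_distr) auto
  also have "\<dots> = (LINT r|sym_lebesgue. H r)"
    using ss by (subst sym_lebesgue_affine) (auto simp: sym_mats_def)
  finally have 1: "GG_integral (of_nat n / 2) g s = 1 / Siegel_Gamma TYPE('m) (of_nat n / 2) * (LINT r|sym_lebesgue. H r)" .
  have "(LINT x|prod_leb {..<n}. g0 (s - rows_gram {..<n} x)) = (LINT x|prod_leb {..<n}. reflected g0 s (rows_gram {..<n} x))"
    by (simp add: reflected_def rows_gram_sym_mats)
  also have "\<dots> = (LINT r|sym_lebesgue. (if r \<in> pd_cone then wishart_const CARD('m) (card {..<n}) *
      det r powr ((real (card {..<n}) - real CARD('m) - 1) / 2) else 0) *\<^sub>R reflected g0 s r)"
    by (rule integral_rows_gram) (use n in auto)
  also have "\<dots> = (LINT r|sym_lebesgue. W *\<^sub>R H r)"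
    by (intro Bochner_Integration.integral_cong refl) (simp add: H_def W_def e_def scaleR_conv_of_real)
  also have "\<dots> = complex_of_real W * (LINT r|sym_lebesgue. H r)"
    by (simp add: scaleR_conv_of_real)
  finally have 2: "(LINT x|prod_leb {..<n}. g0 (s - rows_gram {..<n} x)) = complex_of_real W * (LINT r|sym_lebesgue. H r)" .
  have SW: "Siegel_Gamma TYPE('m) (of_nat n / 2) * complex_of_real W = complex_of_real (pi powr (real n * real CARD('m) / 2))"
    unfolding W_def by (rule Siegel_Gamma_half[OF n])
  have pe: "complex_of_real (pi powr (- (real n * real CARD('m) / 2))) = 1 / (Siegel_Gamma TYPE('m) (of_nat n / 2) * complex_of_real W)"
    unfolding SW powr_minus of_real_inverse by (rule inverse_eq_divide)
  have gen: "1 / a * X = 1 / (a * b) * (b * X)" if "b \<noteq> 0" for a b X :: complex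
    using that by simp
  show ?thesis
    unfolding 1 2 pe by (rule gen) (simp only: of_real_eq_0_iff less_imp_neq[OF W, symmetric] not_False_eq_True)
qed

text \<open>With rows indexed by \<open>{..<k}\<close> the case \<open>k = 0\<close> is included,
  although no type has cardinality 0.\<close>

lemma I_plus_half:
  fixes f :: "'m::{finite,linorder} sqmat \<Rightarrow> complex"
  assumes f: "f \<in> test_functions" and s: "s \<in> pd_cone"
  shows "I_plus (of_nat k / 2) f s =
    complex_of_real (pi powr (- (real k * real CARD('m) / 2))) * (LINT x|prod_leb {..<k}. cone_ext f (s - rows_gram {..<k} x))"
proof (cases "real k / 2 > dd TYPE('m) - 1")
  case True
  \<comment> \<open>Since d - 1 = (m - 1)/2, the condition says \<open>k > m - 1\<close>.\<close>
  then have "CARD('m) \<le> k" by (simp add: dd_def field_simps)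
  then have "GG_integral (of_nat k / 2) f s = complex_of_real (pi powr (- (real k * real CARD('m) / 2))) * (LINT x|prod_leb {..<k}. cone_ext f (s - rows_gram {..<k} x))"
    by (intro GG_integral_half smooth_compact_cone_ext f s) (simp_all add: cone_ext_def)
  then show ?thesis using True by (simp add: I_plus_def)
next
  case False
  define P where "P l \<longleftrightarrow> l \<ge> 1 \<and> dd TYPE('m) - 1 - real l < real k / 2 \<and> real k / 2 \<le> dd TYPE('m) - real l" for l :: nat
  define l where "l = (THE l. P l)"
  have "P l" unfolding l_def P_def
    by (rule theI'[OF I_plus_step_ex1]) (use False in simp)
  \<comment> \<open>The lower bound in the choice of \<open>l\<close> says (m - 1)/2 - l < k/2,
    which is exactly the range of the density formula for \<open>k + 2 * l\<close> rows.\<close>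
  then have "CARD('m) \<le> k + 2 * l" by (simp add: P_def dd_def field_simps)
  then have "GG_integral (of_nat (k + 2 * l) / 2) ((D_plus ^^ l) f) s = complex_of_real (pi powr (- (real (k + 2 * l) * real CARD('m) / 2))) *
      (LINT x|prod_leb {..<k + 2 * l}. (D_plus ^^ l) (cone_ext f) (s - rows_gram {..<k + 2 * l} x))"
    by (intro GG_integral_half smooth_compact_D_plus_funpow smooth_compact_cone_ext f s D_plus_funpow_cong_pd_cone)
       (simp_all add: cone_ext_def)
  also have "\<dots> = complex_of_real (pi powr (- (real (k + 2 * l) * real CARD('m) / 2)) * pi ^ (CARD('m) * l)) *
      (LINT x|prod_leb {..<k}. cone_ext f (s - rows_gram {..<k} x))"
    using s pd_cone_subset_sym_mats
    by (subst integral_D_plus_funpow_rows[OF smooth_compact_cone_ext[OF f]]) (auto simp: scaleR_conv_of_real)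
  \<comment> \<open>The \<open>l\<close> factors \<pi>^m from removing pairs of rows cancel the
    excess of the normalization for \<open>k + 2 * l\<close> rows over that for \<open>k\<close>
    rows.\<close>
  also have "pi powr (- (real (k + 2 * l) * real CARD('m) / 2)) * pi ^ (CARD('m) * l) = pi powr (- (real k * real CARD('m) / 2))"
  proof -
    have "pi ^ (CARD('m) * l) = pi powr (real (CARD('m) * l))" by (rule powr_realpow[symmetric]) simp
    then show ?thesis by (simp add: powr_add[symmetric] field_simps)
  qed
  finally have "GG_integral (of_nat (k + 2 * l) / 2) ((D_plus ^^ l) f) s = complex_of_real (pi powr (- (real k * real CARD('m) / 2))) *
      (LINT x|prod_leb {..<k}. cone_ext f (s - rows_gram {..<k} x))" .
  moreover have "complex_of_nat (k + 2 * l) / 2 = of_nat k / 2 + of_nat l" by simp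
  moreover have "I_plus (of_nat k / 2) f s = GG_integral (of_nat k / 2 + of_nat l) ((D_plus ^^ l) f) s"
    using False by (simp add: I_plus_def l_def P_def Let_def)
  ultimately show ?thesis by metis
qed

theorem theorem2p8:
  fixes f :: "'m::{finite,linorder} sqmat \<Rightarrow> complex"
    and s :: "'m sqmat"
  assumes "f \<in> test_functions"
    and "s \<in> pd_cone"
  shows "I_plus (of_nat CARD('k::finite) / 2) f s =
           complex_of_real (pi powr (- (real CARD('k) * real CARD('m) / 2))) *
           (LINT \<omega> : {\<omega> :: ('k, 'm) rmat. transpose \<omega> ** \<omega> \<prec>\<^sub>P s} | lborel.
              f (s - transpose \<omega> ** \<omega>))
         \<and> I_plus 0 f s = f s"
proof
  have f: "smooth_compact (cone_ext f)" by (rule smooth_compact_cone_ext[OF assms(1)])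
  have s: "s \<in> sym_mats" using assms(2) pd_cone_subset_sym_mats by auto
  have "(LINT x|prod_leb {..<CARD('k)}. cone_ext f (s - rows_gram {..<CARD('k)} x)) =
      (LINT x|prod_leb (UNIV :: 'k set). cone_ext f (s - rows_gram UNIV x))"
    by (rule integral_rows_gram_cong[OF _ _ _ f s]) auto
  also have "\<dots> = (LINT \<omega>|(lborel :: ('k, 'm) rmat measure). cone_ext f (s - transpose \<omega> ** \<omega>))"
    by (rule integral_rows_gram_lborel[OF f s])
  \<comment> \<open>The zero extension is the indicator of the domain of integration, since s -
    \<omega>'\<omega> lies in the cone exactly there.\<close>
  also have "\<dots> = (LINT \<omega> : {\<omega> :: ('k, 'm) rmat. transpose \<omega> ** \<omega> \<prec>\<^sub>P s} | lborel. f (s - transpose \<omega> ** \<omega>))"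
    unfolding set_lebesgue_integral_def
    by (intro Bochner_Integration.integral_cong) (auto simp: cone_ext_def pd_less_def)
  finally show "I_plus (of_nat CARD('k) / 2) f s =
      complex_of_real (pi powr (- (real CARD('k) * real CARD('m) / 2))) *
      (LINT \<omega> : {\<omega> :: ('k, 'm) rmat. transpose \<omega> ** \<omega> \<prec>\<^sub>P s} | lborel. f (s - transpose \<omega> ** \<omega>))"
    using I_plus_half[OF assms, of "CARD('k)"] by simp
  \<comment> \<open>Without rows the product measure is a point mass and the sum of outer products
    is 0.\<close>
  have "(LINT x|prod_leb {..<0::nat}. cone_ext f (s - rows_gram {..<0::nat} x)) = f s"
    using assms(2) by (simp add: PiM_empty lebesgue_integral_count_space_finite rows_gram_def cone_ext_def)
  then show "I_plus 0 f s = f s"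
    using I_plus_half[OF assms, of 0] by simp
qed

end
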